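(* Suppose that Assumptions 1 and 2 (listed in the context) hold. Then for any compact set $K\subset\mathbb R$ there exists a constant $C_K>0$ such that $\pi^X(x)\le C_K$ for all $x\in K$, where $\pi^X$ is the Lebesgue density of the $X$-marginal of the invariant probability of $(X,\lambda)$.
   Context: **Model.** $M\ge1$ is a fixed integer, $\alpha>0$, $\zeta_i>0$, $c_{i,j}>0$ ($1\le i,j\le M$). $N=(N^{(1)},\dots,N^{(M)})$ is a multivariate counting process (linear Hawkes process) whose components a.s. never jump simultaneously, with intensity $\lambda=(\lambda^{(1)},\dots,\lambda^{(M)})$; $W$ is a standard Brownian motion independent of $N$ and of the initial values $(X_0,\lambda_0)$; and $$d\lambda^{(i)}_t=-\alpha(\lambda^{(i)}_t-\zeta_i)dt+\sum_{j=1}^Mc_{i,j}dN^{(j)}_t\ (1\le i\le M),\qquad dX_t=b(X_t)dt+\sigma(X_t)dW_t+a(X_{t^-})\sum_{j=1}^MdN^{(j)}_t .$$ **Assumption 1.** (1) $b,\sigma$ are $C^2$, $a$ is differentiable, and $|b'|+|\sigma'|+|a'|\le c$ on $\mathbb R$ for some constant $c>0$. (2) There are constants $a_1,\sigma_1>0$ with $|a(x)|<a_1$ and $0<\sigma^2(x)<\sigma_1^2$ for all $x$. (3) There are $c',q>0$ with $|b''(x)|+|\sigma''(x)|\le c'(1+|x|^q)$ for all $x$. (4) There are $d>0$, $r>0$ with $xb(x)\le-dx^2$ for all $|x|>r$. **Assumption 2.** The matrix $H=(c_{i,j}/\alpha)_{1\le i,j\le M}$ has spectral radius $<1$ and is invertible;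 $\sum_j\zeta_j>0$. Under Assumptions 1 and 2 it is known that $(X,\lambda)$ is Markov and positive Harris recurrent with a unique invariant probability $\pi$, and that $\pi^X(dx)=\pi(dx\times\mathbb R^M)$ has a Lebesgue density $x\mapsto\pi^X(x)$ (which is bounded below by a positive constant on each compact set). *)

theory Defs
  imports "HOL-Probability.Probability"
begin

section \<open>Coefficients and parameters\<close>

definition C2 :: "(real \<Rightarrow> real) \<Rightarrow> bool" where
  "C2 f \<longleftrightarrow> (\<forall>x. f field_differentiable at x) \<and> (\<forall>x. deriv f field_differentiable at x)
     \<and> continuous_on UNIV (deriv (deriv f))"

definition coefficient_conditions ::
  "(real \<Rightarrow> real) \<Rightarrow> (real \<Rightarrow> real) \<Rightarrow> (real \<Rightarrow> real) \<Rightarrow> bool" where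
  "coefficient_conditions b \<sigma> a \<longleftrightarrow>
     C2 b \<and> C2 \<sigma> \<and> (\<forall>x. a field_differentiable at x)
   \<and> (\<exists>c>0. \<forall>x. \<bar>deriv b x\<bar> + \<bar>deriv \<sigma> x\<bar> + \<bar>deriv a x\<bar> \<le> c)
   \<and> (\<exists>a\<^sub>1>0. \<exists>\<sigma>\<^sub>1>0. \<forall>x. \<bar>a x\<bar> < a\<^sub>1 \<and> 0 < (\<sigma> x)\<^sup>2 \<and> (\<sigma> x)\<^sup>2 < \<sigma>\<^sub>1\<^sup>2)
   \<and> (\<exists>c'>0. \<exists>q>0. \<forall>x. \<bar>deriv (deriv b) x\<bar> + \<bar>deriv (deriv \<sigma>) x\<bar> \<le> c' * (1 + \<bar>x\<bar> powr q))
   \<and> (\<exists>d>0. \<exists>r>0. \<forall>x. \<bar>x\<bar> > r \<longrightarrow> x * b x \<le> - d * x\<^sup>2)"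

definition eigenvalues :: "complex^'m^'m \<Rightarrow> complex set" where
  "eigenvalues A = {\<mu>. \<exists>v. v \<noteq> 0 \<and> A *v v = \<mu> *s v}"

definition real_spectral_radius :: "real^'m^'m \<Rightarrow> real" where
  "real_spectral_radius A = Max (cmod ` eigenvalues (\<chi> i j. complex_of_real (A $ i $ j)))"

definition stability_conditions :: "real \<Rightarrow> real^'m \<Rightarrow> real^'m^'m \<Rightarrow> bool" where
  "stability_conditions \<alpha> \<zeta> c \<longleftrightarrow>
     (let H = (\<chi> i j. c $ i $ j / \<alpha>) in real_spectral_radius H < 1 \<and> invertible H)
     \<and> (\<Sum>j\<in>UNIV. \<zeta> $ j) > 0"

section \<open>Filtered spaces and martingales\<close>

text \<open>Time is the half-line \<open>[0,\<infinity>)\<close> inside \<open>real\<close>. The library's notion of filtration is indexed by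
  the whole type; \<open>F t\<close> for negative \<open>t\<close> is only required to be a sub-\<open>\<sigma>\<close>-algebra of \<open>F 0\<close>.\<close>

definition filtered_prob_space :: "'w measure \<Rightarrow> (real \<Rightarrow> 'w measure) \<Rightarrow> bool" where
  "filtered_prob_space P F \<longleftrightarrow>
     prob_space P \<and> filtration (space P) F \<and> (\<forall>t. subalgebra P (F t))"

definition martingale :: "'w measure \<Rightarrow> (real \<Rightarrow> 'w measure) \<Rightarrow> (real \<Rightarrow> 'w \<Rightarrow> real) \<Rightarrow> bool" where
  "martingale P F Y \<longleftrightarrow>
     (\<forall>t\<ge>0. Y t \<in> borel_measurable (F t) \<and> integrable P (Y t))
   \<and> (\<forall>s t. 0 \<le> s \<longrightarrow> s \<le> t \<longrightarrow> (AE \<omega> in P. real_cond_exp P (F s) (Y t) \<omega> = Y s \<omega>))"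

text \<open>Localising times may be taken finite (replace \<open>T n\<close> by \<open>min (T n) n\<close>).\<close>

definition local_martingale ::
  "'w measure \<Rightarrow> (real \<Rightarrow> 'w measure) \<Rightarrow> (real \<Rightarrow> 'w \<Rightarrow> real) \<Rightarrow> bool" where
  "local_martingale P F Y \<longleftrightarrow>
     (\<exists>T :: nat \<Rightarrow> 'w \<Rightarrow> real.
        (\<forall>n. stopping_time F (T n))
      \<and> (\<forall>n. \<forall>\<omega>\<in>space P. 0 \<le> T n \<omega> \<and> T n \<omega> \<le> T (Suc n) \<omega>)
      \<and> (AE \<omega> in P. filterlim (\<lambda>n. T n \<omega>) at_top sequentially)
      \<and> (\<forall>n. martingale P F (\<lambda>t \<omega>. Y (min t (T n \<omega>)) \<omega>)))"

definition standard_brownian_motion ::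
  "'w measure \<Rightarrow> (real \<Rightarrow> 'w measure) \<Rightarrow> (real \<Rightarrow> 'w \<Rightarrow> real) \<Rightarrow> bool" where
  "standard_brownian_motion P F W \<longleftrightarrow>
     (\<forall>t\<ge>0. W t \<in> borel_measurable (F t))
   \<and> (AE \<omega> in P. W 0 \<omega> = 0)
   \<and> (\<forall>\<omega>\<in>space P. continuous_on {0..} (\<lambda>t. W t \<omega>))
   \<and> (\<forall>s t. 0 \<le> s \<longrightarrow> s < t \<longrightarrow>
        distributed P lborel (\<lambda>\<omega>. W t \<omega> - W s \<omega>) (normal_density 0 (sqrt (t - s)))
      \<and> prob_space.indep_set P (sets (F s))
          (sets (vimage_algebra (space P) (\<lambda>\<omega>. W t \<omega> - W s \<omega>) borel)))"

section \<open>The Ito integral\<close>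

text \<open>A simple process is given by \<open>m\<close> pieces: it takes the value \<open>\<xi> k\<close> on \<open>(\<tau> k, \<tau> (k+1)]\<close>, where
  \<open>\<xi> k\<close> is bounded and \<open>F (\<tau> k)\<close>-measurable.\<close>

definition simple_process ::
  "'w measure \<Rightarrow> (real \<Rightarrow> 'w measure) \<Rightarrow> nat \<Rightarrow> (nat \<Rightarrow> real) \<Rightarrow> (nat \<Rightarrow> 'w \<Rightarrow> real) \<Rightarrow> bool" where
  "simple_process P F m \<tau> \<xi> \<longleftrightarrow>
     0 \<le> \<tau> 0 \<and> (\<forall>k<m. \<tau> k \<le> \<tau> (Suc k))
   \<and> (\<forall>k<m. \<xi> k \<in> borel_measurable (F (\<tau> k)))
   \<and> (\<exists>B. \<forall>k<m. \<forall>\<omega>\<in>space P. \<bar>\<xi> k \<omega>\<bar> \<le> B)"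

definition simple_value ::
  "nat \<Rightarrow> (nat \<Rightarrow> real) \<Rightarrow> (nat \<Rightarrow> 'w \<Rightarrow> real) \<Rightarrow> real \<Rightarrow> 'w \<Rightarrow> real" where
  "simple_value m \<tau> \<xi> s \<omega> = (\<Sum>k<m. \<xi> k \<omega> * indicator {\<tau> k<..\<tau> (Suc k)} s)"

definition simple_integral_upto ::
  "(real \<Rightarrow> 'w \<Rightarrow> real) \<Rightarrow> nat \<Rightarrow> (nat \<Rightarrow> real) \<Rightarrow> (nat \<Rightarrow> 'w \<Rightarrow> real) \<Rightarrow> real \<Rightarrow> 'w \<Rightarrow> real" where
  "simple_integral_upto W m \<tau> \<xi> t \<omega> =
     (\<Sum>k<m. \<xi> k \<omega> * (W (min t (\<tau> (Suc k))) \<omega> - W (min t (\<tau> k)) \<omega>))"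

definition null_in_probability :: "'w measure \<Rightarrow> (nat \<Rightarrow> 'w \<Rightarrow> ennreal) \<Rightarrow> bool" where
  "null_in_probability P Y \<longleftrightarrow>
     (\<forall>e>0. (\<lambda>n. measure P {\<omega>\<in>space P. ennreal e < Y n \<omega>}) \<longlonglongrightarrow> 0)"

definition progressive ::
  "(real \<Rightarrow> 'w measure) \<Rightarrow> (real \<Rightarrow> 'w \<Rightarrow> real) \<Rightarrow> bool" where
  "progressive F H \<longleftrightarrow>
     (\<forall>t\<ge>0. (\<lambda>(s, \<omega>). H s \<omega>) \<in> borel_measurable (restrict_space borel {0..t} \<Otimes>\<^sub>M F t))"

text \<open>\<open>I\<close> is (a version of) the integral of \<open>H\<close> against \<open>dW\<close> over \<open>[0,t]\<close>: the limit in probability of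
  the integrals of simple processes that approximate \<open>H\<close> in \<open>L\<^sup>2([0,t])\<close>, in probability. The limit
  does not depend on the approximating sequence, up to null sets.\<close>

definition has_ito_integral ::
  "'w measure \<Rightarrow> (real \<Rightarrow> 'w measure) \<Rightarrow> (real \<Rightarrow> 'w \<Rightarrow> real) \<Rightarrow> (real \<Rightarrow> 'w \<Rightarrow> real) \<Rightarrow> real
     \<Rightarrow> ('w \<Rightarrow> real) \<Rightarrow> bool" where
  "has_ito_integral P F W H t I \<longleftrightarrow>
     progressive F H
   \<and> (AE \<omega> in P. (\<integral>\<^sup>+s\<in>{0..t}. ennreal ((H s \<omega>)\<^sup>2) \<partial>lborel) < \<infinity>)
   \<and> I \<in> borel_measurable P
   \<and> (\<exists>m \<tau> \<xi>. (\<forall>n. simple_process P F (m n) (\<tau> n) (\<xi> n))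
      \<and> null_in_probability P
          (\<lambda>n \<omega>. \<integral>\<^sup>+s\<in>{0..t}. ennreal ((simple_value (m n) (\<tau> n) (\<xi> n) s \<omega> - H s \<omega>)\<^sup>2) \<partial>lborel)
      \<and> null_in_probability P
          (\<lambda>n \<omega>. ennreal \<bar>simple_integral_upto W (m n) (\<tau> n) (\<xi> n) t \<omega> - I \<omega>\<bar>))"

section \<open>Counting processes\<close>

definition cadlag :: "(real \<Rightarrow> 'b::t2_space) \<Rightarrow> bool" where
  "cadlag f \<longleftrightarrow> (\<forall>t\<ge>0. (f \<longlongrightarrow> f t) (at_right t)) \<and> (\<forall>t>0. \<exists>l. (f \<longlongrightarrow> l) (at_left t))"

definition left_limit :: "(real \<Rightarrow> 'b::t2_space) \<Rightarrow> real \<Rightarrow> 'b" where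
  "left_limit f t = Lim (at_left t) f"

definition counting_path :: "(real \<Rightarrow> nat) \<Rightarrow> bool" where
  "counting_path n \<longleftrightarrow>
     n 0 = 0 \<and> mono_on {0..} n
   \<and> (\<forall>t\<ge>0. \<forall>\<^sub>F s in at_right t. n s = n t)
   \<and> (\<forall>t>0. \<forall>\<^sub>F s in at_left t. n t \<le> Suc (n s))"

definition jump_times :: "(real \<Rightarrow> nat) \<Rightarrow> real set" where
  "jump_times n = {t. 0 < t \<and> (\<forall>s. 0 \<le> s \<longrightarrow> s < t \<longrightarrow> n s < n t)}"

definition counting_integral :: "(real \<Rightarrow> real) \<Rightarrow> (real \<Rightarrow> nat) \<Rightarrow> real \<Rightarrow> real" where
  "counting_integral h n t = (\<Sum>s\<in>{s \<in> jump_times n. s \<le> t}. h s)"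

text \<open>The intensity is \<open>l\<close>, i.e. the compensator of the counting process \<open>n\<close> is the integral of \<open>l\<close>
  (which does not distinguish the right-continuous \<open>l\<close> from its predictable version \<open>l(t-)\<close>).\<close>

definition has_intensity ::
  "'w measure \<Rightarrow> (real \<Rightarrow> 'w measure) \<Rightarrow> (real \<Rightarrow> 'w \<Rightarrow> nat) \<Rightarrow> (real \<Rightarrow> 'w \<Rightarrow> real) \<Rightarrow> bool" where
  "has_intensity P F n l \<longleftrightarrow>
     (\<forall>t\<ge>0. \<forall>\<omega>\<in>space P. 0 \<le> l t \<omega>)
   \<and> local_martingale P F (\<lambda>t \<omega>. real (n t \<omega>) - (LBINT s:{0..t}. l s \<omega>))"

section \<open>The jump diffusion driven by a Hawkes process\<close>

definition hawkes_jump_diffusion ::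
  "real \<Rightarrow> real^'m \<Rightarrow> real^'m^'m \<Rightarrow> (real \<Rightarrow> real) \<Rightarrow> (real \<Rightarrow> real) \<Rightarrow> (real \<Rightarrow> real)
   \<Rightarrow> 'w measure \<Rightarrow> (real \<Rightarrow> 'w measure) \<Rightarrow> ('m \<Rightarrow> real \<Rightarrow> 'w \<Rightarrow> nat) \<Rightarrow> (real \<Rightarrow> 'w \<Rightarrow> real)
   \<Rightarrow> (real \<Rightarrow> 'w \<Rightarrow> real) \<Rightarrow> (real \<Rightarrow> 'w \<Rightarrow> real^'m) \<Rightarrow> bool" where
  "hawkes_jump_diffusion \<alpha> \<zeta> c b \<sigma> a P F N W X lam \<longleftrightarrow>
     filtered_prob_space P F
   \<and> (\<forall>t\<ge>0. X t \<in> borel_measurable (F t) \<and> lam t \<in> borel_measurable (F t)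
         \<and> (\<forall>i. N i t \<in> measurable (F t) (count_space UNIV)))
   \<and> (\<forall>\<omega>\<in>space P. cadlag (\<lambda>t. X t \<omega>) \<and> cadlag (\<lambda>t. lam t \<omega>) \<and> (\<forall>i. counting_path (\<lambda>t. N i t \<omega>)))
   \<and> (AE \<omega> in P. \<forall>i j. i \<noteq> j \<longrightarrow>
         jump_times (\<lambda>t. N i t \<omega>) \<inter> jump_times (\<lambda>t. N j t \<omega>) = {})
   \<and> (\<forall>i. has_intensity P F (N i) (\<lambda>t \<omega>. lam t \<omega> $ i))
   \<and> standard_brownian_motion P F W
   \<and> prob_space.indep_set P
       (sets (vimage_algebra (space P) (\<lambda>\<omega>. \<lambda>t\<in>{0..}. W t \<omega>) (PiM {0..} (\<lambda>_. borel))))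
       (sets (vimage_algebra (space P)
          (\<lambda>\<omega>. ((\<lambda>(i, t)\<in>UNIV \<times> {0..}. N i t \<omega>), X 0 \<omega>, lam 0 \<omega>))
          (PiM (UNIV \<times> {0..}) (\<lambda>_. count_space UNIV) \<Otimes>\<^sub>M borel \<Otimes>\<^sub>M borel)))
   \<and> (AE \<omega> in P. \<forall>t\<ge>0. \<forall>i.
         lam t \<omega> $ i = lam 0 \<omega> $ i - \<alpha> * (LBINT s:{0..t}. lam s \<omega> $ i - \<zeta> $ i)
           + (\<Sum>j\<in>UNIV. c $ i $ j * real (N j t \<omega>)))
   \<and> (\<exists>I. (\<forall>t\<ge>0. has_ito_integral P F W (\<lambda>s \<omega>. \<sigma> (X s \<omega>)) t (I t))
        \<and> (AE \<omega> in P. \<forall>t\<ge>0.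
             X t \<omega> = X 0 \<omega> + (LBINT s:{0..t}. b (X s \<omega>)) + I t \<omega>
               + (\<Sum>j\<in>UNIV. counting_integral
                     (\<lambda>s. a (left_limit (\<lambda>u. X u \<omega>) s)) (\<lambda>u. N j u \<omega>) t)))"

section \<open>Transition kernels and invariant probabilities\<close>

text \<open>Intensities are nonnegative, so \<open>(X, \<lambda>)\<close> lives on \<open>\<real> \<times> [0,\<infinity>)\<^sup>M\<close>.\<close>

definition state_space :: "(real \<times> (real^'m)) measure" where
  "state_space = restrict_space borel (UNIV \<times> {l. \<forall>i. 0 \<le> l $ i})"

text \<open>\<open>Pr z\<close> is the law under which the process is started at \<open>z\<close>.\<close>

definition hawkes_family ::
  "real \<Rightarrow> real^'m \<Rightarrow> real^'m^'m \<Rightarrow> (real \<Rightarrow> real) \<Rightarrow> (real \<Rightarrow> real) \<Rightarrow> (real \<Rightarrow> real)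
   \<Rightarrow> (real \<times> (real^'m) \<Rightarrow> 'w measure) \<Rightarrow> (real \<Rightarrow> 'w measure) \<Rightarrow> ('m \<Rightarrow> real \<Rightarrow> 'w \<Rightarrow> nat)
   \<Rightarrow> (real \<Rightarrow> 'w \<Rightarrow> real) \<Rightarrow> (real \<Rightarrow> 'w \<Rightarrow> real) \<Rightarrow> (real \<Rightarrow> 'w \<Rightarrow> real^'m) \<Rightarrow> bool" where
  "hawkes_family \<alpha> \<zeta> c b \<sigma> a Pr F N W X lam \<longleftrightarrow>
     (\<forall>z\<in>space state_space.
        hawkes_jump_diffusion \<alpha> \<zeta> c b \<sigma> a (Pr z) F N W X lam
      \<and> (AE \<omega> in Pr z. (X 0 \<omega>, lam 0 \<omega>) = z))"

definition transition ::
  "(real \<times> (real^'m) \<Rightarrow> 'w measure) \<Rightarrow> (real \<Rightarrow> 'w \<Rightarrow> real) \<Rightarrow> (real \<Rightarrow> 'w \<Rightarrow> real^'m)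
   \<Rightarrow> real \<Rightarrow> real \<times> (real^'m) \<Rightarrow> (real \<times> (real^'m)) measure" where
  "transition Pr X lam t z = distr (Pr z) state_space (\<lambda>\<omega>. (X t \<omega>, lam t \<omega>))"

definition invariant_probability :: "'s measure \<Rightarrow> (real \<Rightarrow> 's \<Rightarrow> 's measure) \<Rightarrow> 's measure \<Rightarrow> bool" where
  "invariant_probability S K \<pi> \<longleftrightarrow>
     prob_space \<pi> \<and> sets \<pi> = sets S
   \<and> (\<forall>t\<ge>0. \<forall>A\<in>sets S. emeasure \<pi> A = (\<integral>\<^sup>+z. emeasure (K t z) A \<partial>\<pi>))"

end

theory Submission
  imports Defs
begin

text \<open>Testing invariance against \<open>f (X t)\<close> for small \<open>t\<close> gives, formally,
  \<open>\<integral> (f''(x) \<sigma>(x)\<^sup>2 / 2 + f'(x) b(x) + \<Sum>j. l\<^sub>j (f (x + a(x)) - f(x))) d\<pi>(x, l) = 0\<close>,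
  so that \<open>\<integral> f''(x) \<sigma>(x)\<^sup>2 d\<pi>\<close> is controlled by the suprema of \<open>f\<close> and \<open>f'\<close> as soon as \<open>f'\<close> has
  compact support and the intensities are \<open>\<pi>\<close>-integrable. Taking \<open>f'' = h - (\<integral> h) \<psi>\<close> with \<open>h\<close> close to
  the indicator of an open set \<open>U\<close> and a fixed bump \<open>\<psi>\<close>, both suprema are at most a constant times
  \<open>\<integral> h\<close>; as \<open>\<sigma>\<^sup>2\<close> is bounded below on compact sets, \<open>\<pi>(X \<in> U)\<close> is at most a constant times the
  Lebesgue measure of \<open>U\<close>.

  Only the diffusive term is needed with its exact order in \<open>t\<close>; the drift and the jumps are merely
  bounded by multiples of \<open>t\<close>, so the fourth moments of simple Ito integrals replace Ito's formula.
  The integrability of the intensities comes from the linear Lyapunov function given by a positive left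
  eigenvector \<open>\<kappa>\<close> of \<open>(c\<^sub>i\<^sub>j / \<alpha>)\<close> with eigenvalue \<open>r < 1\<close>.\<close>

section \<open>A Perron vector\<close>

text \<open>Every error must be integrable against \<open>\<pi>\<close> and, after division by
  \<open>t\<close>, either vanish or be proportional to the integral of \<open>h\<close>. Two
  obstacles shape the estimates. The drift grows linearly, while no moment of \<open>X\<close> under
  \<open>\<pi>\<close> is established; therefore \<open>f\<close> is constant outside a compact
  interval, and for far starting points the distance that \<open>X\<close> would have to travel,
  itself of order \<open>1 + \<bar>x0\<bar>\<close>, is compared with a drift of the same order. The
  Lipschitz constant of \<open>h\<close> is unrelated to its integral and enters the Taylor
  remainder; that remainder must therefore be o(t), and second and fourth moments of the Ito
  integral give it the order t sqrt(t). Only lower bounds for the mean of \<open>f (X t)\<close> are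
  required: where \<open>h\<close> is positive the quadratic variation is bounded below, and
  everything else may be lost up to multiples of \<open>t\<close>. Jumps are handled by giving up
  the event that one occurs, whose probability is at most \<open>t\<close> times an affine function
  of the initial intensity; this is where the first moment of the intensity is spent.\<close>

lemma positive_matrix_left_eigenvector:
  fixes H :: "real^'m^'m"
  assumes pos: "\<And>i j. 0 < H $ i $ j"
  obtains \<kappa> :: "real^'m" and r where "\<And>i. 0 < \<kappa> $ i" "0 < r" "\<kappa> v* H = r *\<^sub>R \<kappa>"
proof -
  \<comment> \<open>Brouwer's theorem on the probability simplex \<open>S\<close>, for the row
    action of \<open>H\<close> rescaled to total mass one: a fixed point is a left eigenvector, and
    its eigenvalue is the scaling factor \<open>s \<kappa>\<close>.\<close>
  define S :: "(real^'m) set" where "S = {x. (\<forall>i. 0 \<le> x $ i) \<and> (\<Sum>i\<in>UNIV. x $ i) = 1}"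
  define s where "s x = (\<Sum>j\<in>UNIV. (x v* H) $ j)" for x
  define f where "f x = (1 / s x) *\<^sub>R (x v* H)" for x
  have nth: "(x v* H) $ j = (\<Sum>i\<in>UNIV. H $ i $ j * x $ i)" for x j
    by (simp add: vector_matrix_mult_def mult.commute)
  have vpos: "0 < (x v* H) $ j" if "x \<in> S" for x j
  proof -
    have "\<exists>i. x $ i \<noteq> 0" using that by (auto simp: S_def) (metis sum.neutral zero_neq_one)
    then obtain i where "x $ i \<noteq> 0" by blast
    moreover have "0 \<le> x $ i" using that by (auto simp: S_def)
    ultimately have "x $ i > 0" by simp
    then show ?thesis unfolding nth using that pos
      by (intro sum_pos2[of _ i]) (auto simp: S_def less_imp_le)
  qed
  have spos: "0 < s x" if "x \<in> S" for x
    unfolding s_def by (rule sum_pos) (auto simp: vpos that)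
  have "compact S"
  proof (rule compact_eq_bounded_closed[THEN iffD2, OF conjI])
    have "norm x \<le> 1" if "x \<in> S" for x
      using norm_le_l1_cart[of x] that by (auto simp: S_def)
    then show "bounded S" by (auto simp: bounded_iff)
    have "S = (\<Inter>i. {x. 0 \<le> x $ i}) \<inter> {x. (\<Sum>i\<in>UNIV. x $ i) = 1}" by (auto simp: S_def)
    then show "closed S"
      by (auto intro!: closed_INT closed_Int closed_Collect_le closed_Collect_eq continuous_intros)
  qed
  moreover have "convex S"
    unfolding convex_def S_def by (auto simp: sum.distrib sum_distrib_left[symmetric])
  moreover have "S \<noteq> {}"
  proof -
    have "(axis undefined 1 :: real^'m) \<in> S"
      by (auto simp: S_def axis_def)
    then show ?thesis by auto
  qed
  moreover have "continuous_on S f"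
  proof -
    have "continuous_on S (\<lambda>x. x v* H)" unfolding vector_matrix_mult_def by (intro continuous_intros)
    moreover have "continuous_on S s" unfolding s_def nth by (intro continuous_intros)
    ultimately show ?thesis unfolding f_def using spos by (intro continuous_intros) force+
  qed
  moreover have "f \<in> S \<rightarrow> S"
  proof
    fix x assume x: "x \<in> S"
    have "(\<Sum>i\<in>UNIV. f x $ i) = 1"
      unfolding f_def vector_scaleR_component sum_distrib_left[symmetric] s_def[symmetric]
        real_scaleR_def using spos[OF x] by simp
    moreover have "0 \<le> f x $ i" for i
      using spos[OF x] vpos[OF x, of i] by (auto simp: f_def intro!: divide_nonneg_nonneg)
    ultimately show "f x \<in> S" by (auto simp: S_def)
  qed
  ultimately obtain \<kappa> where k: "\<kappa> \<in> S" "f \<kappa> = \<kappa>" using brouwer by metis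
  have e: "\<kappa> v* H = s \<kappa> *\<^sub>R \<kappa>" using spos[OF k(1)] k(2) unfolding f_def
    by (metis (no_types, lifting) divide_self_if less_irrefl pth_1 scaleR_scaleR times_divide_eq_left mult_1 mult.commute)
  \<comment> \<open>Membership in \<open>S\<close> gives only nonnegativity; strict positivity holds
    because a positive multiple of \<open>\<kappa>\<close> is the image of \<open>\<kappa>\<close>
    under a positive matrix.\<close>
  have "0 < \<kappa> $ i" for i
  proof -
    have "0 < s \<kappa> * \<kappa> $ i" using vpos[OF k(1), of i] unfolding e by simp
    then show ?thesis using spos[OF k(1)] by (simp add: zero_less_mult_iff)
  qed
  with e spos[OF k(1)] show ?thesis using that by blast
qed

text \<open>\<open>real_spectral_radius\<close> is a \<open>Max\<close>, which is known to bound its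
  elements only over a finite set. Eigenvectors to distinct eigenvalues are linearly independent, so
  more than \<open>CARD('m)\<close> eigenvalues would exceed the dimension.\<close>

lemma finite_eigenvalues: "finite (eigenvalues (A :: complex^'m^'m))"
proof (rule ccontr)
  assume inf: "infinite (eigenvalues A)"
  obtain T where T: "finite T" "card T = Suc CARD('m)" "T \<subseteq> eigenvalues A"
    using infinite_arbitrarily_large[OF inf] by blast
  have "\<forall>\<mu>\<in>eigenvalues A. \<exists>v. v \<noteq> 0 \<and> A *v v = \<mu> *s v" by (auto simp: eigenvalues_def)
  then obtain v where v: "\<And>\<mu>. \<mu> \<in> eigenvalues A \<Longrightarrow> v \<mu> \<noteq> 0 \<and> A *v v \<mu> = \<mu> *s v \<mu>" by metis
  have indep: "\<forall>\<mu>\<in>U. c \<mu> = 0" if "finite U" "U \<subseteq> eigenvalues A" "(\<Sum>\<mu>\<in>U. c \<mu> *s v \<mu>) = 0" for U c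
    using that
  proof (induction U arbitrary: c rule: finite_induct)
    case (insert m U)
    have z: "c m *s v m + (\<Sum>\<mu>\<in>U. c \<mu> *s v \<mu>) = 0" using insert by simp
    have lin: "A *v (\<Sum>\<mu>\<in>U. g \<mu>) = (\<Sum>\<mu>\<in>U. A *v g \<mu>)" for g
      by (induction U rule: infinite_finite_induct) (auto simp: matrix_vector_right_distrib)
    \<comment> \<open>Applying \<open>A\<close> to the relation and subtracting \<open>m\<close>
      times the relation removes \<open>v m\<close> and multiplies the other coefficients by the
      nonzero factors \<open>\<mu> - m\<close>.\<close>
    have "A *v (c m *s v m + (\<Sum>\<mu>\<in>U. c \<mu> *s v \<mu>)) = 0" unfolding z by simp
    then have "c m *s (m *s v m) + (\<Sum>\<mu>\<in>U. c \<mu> *s (\<mu> *s v \<mu>)) = 0"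
      using v insert.prems(1)
      by (simp add: matrix_vector_right_distrib lin vec.scale subset_eq
        matrix_vector_mult_scaleR vector_scalar_commute)
    moreover have "m *s (c m *s v m + (\<Sum>\<mu>\<in>U. c \<mu> *s v \<mu>)) = 0" unfolding z by simp
    ultimately have "(\<Sum>\<mu>\<in>U. c \<mu> *s (\<mu> *s v \<mu>)) - (\<Sum>\<mu>\<in>U. m *s (c \<mu> *s v \<mu>)) = 0"
      by (simp add: vec.scale_right_distrib vec.scale_sum_right vector_smult_assoc mult.commute
          add_eq_0_iff)
    then have "(\<Sum>\<mu>\<in>U. (c \<mu> * (\<mu> - m)) *s v \<mu>) = 0"
      by (simp add: sum_subtractf[symmetric] vector_smult_assoc algebra_simps vec.scale_left_diff_distrib)
    from insert.IH[OF _ this] have "\<forall>\<mu>\<in>U. c \<mu> = 0"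
      using insert.prems(1) insert.hyps(2) by auto
    moreover from this z have "c m *s v m = 0" by (simp add: sum.neutral)
    ultimately show ?case using v insert.prems(1) by auto
  qed simp
  have inj: "inj_on v T"
    by (rule inj_onI) (metis T(3) v subsetD vec.scale_cancel_right)
  have "vec.independent (v ` T)"
    unfolding vec.dependent_finite[OF finite_imageI[OF T(1)]]
  proof safe
    fix u x assume u: "x \<in> T" "u (v x) \<noteq> 0" "(\<Sum>w\<in>v ` T. u w *s w) = 0"
    then have "(\<Sum>\<mu>\<in>T. u (v \<mu>) *s v \<mu>) = 0" by (simp add: sum.reindex[OF inj])
    from indep[OF T(1,3) this] u show False by auto
  qed
  then have "card (v ` T) \<le> vec.dim (v ` T)" by (simp add: vec.dim_eq_card_independent)
  also have "\<dots> \<le> CARD('m)" using vec.dim_subset_UNIV[of "v ` T"] by (simp add: card_cart_basis vec.dimension_def)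
  finally show False using T(2) card_image[OF inj] by simp
qed

text \<open>\<open>eigenvalues\<close> refers to right eigenvectors, while the Perron vector is a
  left one. Since \<open>\<kappa>\<close> is orthogonal to the range of \<open>H - r\<close>, that
  map is not onto, hence not injective, and a real kernel vector can be read as a complex
  eigenvector.\<close>

lemma left_eigenvalue_in_eigenvalues:
  fixes H :: "real^'m^'m"
  assumes k: "\<kappa> v* H = r *\<^sub>R \<kappa>" "\<kappa> \<noteq> 0"
  shows "complex_of_real r \<in> eigenvalues (\<chi> i j. complex_of_real (H $ i $ j))"
proof -
  define g where "g v = H *v v - r *\<^sub>R v" for v
  have lin: "linear g" unfolding g_def by (intro linear_compose_sub) (auto simp: linear_scale_self)
  have orth: "\<kappa> \<bullet> g v = 0" for v
    unfolding g_def inner_diff_right using dot_lmul_matrix[of \<kappa> H v] k(1) by simp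
  have "\<not> inj g"
  proof
    assume "inj g"
    then have "surj g" using lin linear_injective_imp_surjective by blast
    then obtain w where "g w = \<kappa>" by (metis surjD)
    with orth[of w] k(2) show False by simp
  qed
  then obtain v where v: "v \<noteq> 0" "g v = 0" using linear_injective_0[OF lin] by blast
  define w :: "complex^'m" where "w = (\<chi> i. complex_of_real (v $ i))"
  have "w \<noteq> 0" using v(1) by (auto simp: w_def vec_eq_iff)
  moreover have "(\<chi> i j. complex_of_real (H $ i $ j)) *v w = complex_of_real r *s w"
  proof (rule vec_eq_iff[THEN iffD2, rule_format])
    fix i
    have "(\<Sum>j\<in>UNIV. H $ i $ j * v $ j) = r * v $ i"
      using arg_cong[OF v(2), of "\<lambda>x. x $ i"] by (simp add: g_def matrix_vector_mult_def)
    then have "complex_of_real (\<Sum>j\<in>UNIV. H $ i $ j * v $ j) = complex_of_real (r * v $ i)" by simp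
    then show "((\<chi> i j. complex_of_real (H $ i $ j)) *v w) $ i = (complex_of_real r *s w) $ i"
      by (simp add: matrix_vector_mult_def w_def)
  qed
  ultimately show ?thesis by (auto simp: eigenvalues_def)
qed

lemma stable_positive_matrix_left_eigenvector:
  fixes H :: "real^'m^'m"
  assumes "\<And>i j. 0 < H $ i $ j" and "real_spectral_radius H < 1"
  obtains \<kappa> :: "real^'m" and r where "\<And>i. 0 < \<kappa> $ i" "0 < r" "r < 1" "\<kappa> v* H = r *\<^sub>R \<kappa>"
proof -
  obtain \<kappa> :: "real^'m" and r where k: "\<And>i. 0 < \<kappa> $ i" "0 < r" "\<kappa> v* H = r *\<^sub>R \<kappa>"
    using positive_matrix_left_eigenvector[OF assms(1)] by metis
  have "\<kappa> \<noteq> 0" using k(1) by (metis less_irrefl zero_index)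
  then have "cmod (complex_of_real r) \<le> real_spectral_radius H"
    unfolding real_spectral_radius_def
    by (intro Max_ge finite_imageI finite_eigenvalues imageI left_eigenvalue_in_eigenvalues[of \<kappa>] k(3))
  then have "r < 1" using assms(2) by simp
  with k that show ?thesis by blast
qed

section \<open>Paths\<close>

text \<open>Time is replaced by the next point of a grid of mesh \<open>1 / Suc n\<close>, always
  strictly to the right, so that the limit along \<open>at_right\<close> applies. The constant
  extension \<open>max 0 s\<close> is there because nothing is known about the paths at negative
  times.\<close>

lemma right_continuous_jointly_measurable:
  fixes Y :: "real \<Rightarrow> 'w \<Rightarrow> 'b::{metric_space}"
  assumes meas: "\<And>t. 0 \<le> t \<Longrightarrow> Y t \<in> borel_measurable M"
    and rc: "\<And>\<omega> t. \<omega> \<in> space M \<Longrightarrow> 0 \<le> t \<Longrightarrow> ((\<lambda>u. Y u \<omega>) \<longlongrightarrow> Y t \<omega>) (at_right t)"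
  shows "(\<lambda>(s, \<omega>). Y (max 0 s) \<omega>) \<in> borel_measurable (borel \<Otimes>\<^sub>M M)"
proof -
  define g where "g n s = nat \<lfloor>real (Suc n) * max 0 s\<rfloor>" for n :: nat and s :: real
  define q where "q n i = real (Suc i) / real (Suc n)" for n i :: nat
  have g_meas: "(\<lambda>x. g n (fst x)) \<in> measurable (borel \<Otimes>\<^sub>M M) (count_space UNIV)" for n
    unfolding g_def by measurable
  have f_meas: "(\<lambda>x. Y (q n (g n (fst x))) (snd x)) \<in> borel_measurable (borel \<Otimes>\<^sub>M M)" for n
    by (rule measurable_compose_countable[OF _ g_meas, where f="\<lambda>i x. Y (q n i) (snd x)"])
      (auto intro!: measurable_compose[OF measurable_snd] meas simp: q_def)
  show ?thesis
  proof (rule borel_measurable_LIMSEQ_metric[OF f_meas])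
    fix x :: "real \<times> 'w" assume x: "x \<in> space (borel \<Otimes>\<^sub>M M)"
    obtain s \<omega> where xs: "x = (s, \<omega>)" by (cases x)
    define t where "t = max 0 s"
    have t: "0 \<le> t" by (simp add: t_def)
    have q1: "t < q n (g n s)" and q2: "q n (g n s) \<le> t + 1 / real (Suc n)" for n
    proof -
      have "0 \<le> real (Suc n) * t" using t by simp
      then have a: "real (g n s) \<le> real (Suc n) * t" "real (Suc n) * t < real (g n s) + 1"
        unfolding g_def t_def[symmetric] by linarith+
      show "t < q n (g n s)" unfolding q_def using a(2) by (simp add: field_simps)
      have "q n (g n s) = real (g n s) / real (Suc n) + 1 / real (Suc n)"
        unfolding q_def by (simp add: add_divide_distrib)
      also have "real (g n s) / real (Suc n) \<le> t" using a(1) by (simp add: field_simps)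
      finally show "q n (g n s) \<le> t + 1 / real (Suc n)" by simp
    qed
    have l: "(\<lambda>n. q n (g n s)) \<longlonglongrightarrow> t"
    proof (rule tendsto_sandwich[of "\<lambda>_. t"])
      show "(\<lambda>n. t + 1 / real (Suc n)) \<longlonglongrightarrow> t"
        using tendsto_add[OF tendsto_const LIMSEQ_inverse_real_of_nat, of t] by (simp add: inverse_eq_divide)
    qed (use q1 q2 in \<open>auto intro!: always_eventually less_imp_le simp del: of_nat_Suc\<close>)
    have "filterlim (\<lambda>n. q n (g n s)) (at_right t) sequentially"
      using l q1 by (auto simp: filterlim_at intro!: always_eventually)
    from filterlim_compose[OF rc this] x t
    show "(\<lambda>n. Y (q n (g n (fst x))) (snd x)) \<longlonglongrightarrow> (case x of (s, \<omega>) \<Rightarrow> Y (max 0 s) \<omega>)"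
      by (auto simp: xs t_def space_pair_measure)
  qed
qed

text \<open>One-sided limits give a bound near every point, and compactness makes it uniform. The
  guard \<open>0 \<le> s\<close> takes care of the left neighbourhood of \<open>0\<close>, where
  \<open>cadlag\<close> says nothing.\<close>

lemma cadlag_bounded:
  fixes f :: "real \<Rightarrow> 'b::real_normed_vector"
  assumes "cadlag f"
  obtains B where "0 \<le> B" "\<And>s. 0 \<le> s \<Longrightarrow> s \<le> t \<Longrightarrow> norm (f s) \<le> B"
proof -
  have loc: "\<exists>U. open U \<and> x \<in> U \<and> (\<exists>B. \<forall>s\<in>U. 0 \<le> s \<longrightarrow> norm (f s) \<le> B)" if "0 \<le> x" for x
  proof -
    have ev: "\<forall>\<^sub>F s in F. norm (f s) \<le> norm l + 1" if "(f \<longlongrightarrow> l) F" for l and F :: "real filter"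
      using tendstoD[OF tendsto_norm[OF that], of 1] by (auto elim!: eventually_mono simp: dist_real_def)
    have r: "\<forall>\<^sub>F s in at_right x. norm (f s) \<le> norm (f x) + 1"
      using assms that by (intro ev) (auto simp: cadlag_def)
    obtain B where l: "\<forall>\<^sub>F s in at_left x. 0 \<le> s \<longrightarrow> norm (f s) \<le> B"
    proof (cases "x = 0")
      case True
      then have "\<forall>\<^sub>F s in at_left x. 0 \<le> s \<longrightarrow> norm (f s) \<le> 0"
        by (auto simp: eventually_at_filter)
      then show ?thesis using that by blast
    next
      case False
      then have "0 < x" using \<open>0 \<le> x\<close> by simp
      then obtain l where "(f \<longlongrightarrow> l) (at_left x)" using assms unfolding cadlag_def by blast
      from ev[OF this] show ?thesis using that by (metis (mono_tags, lifting) eventually_mono)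
    qed
    have "\<forall>\<^sub>F s in nhds x. 0 \<le> s \<longrightarrow> norm (f s) \<le> max B (norm (f x) + 1)"
      unfolding eventually_nhds_conv_at eventually_at_split
      using l r by (auto elim!: eventually_mono)
    then show ?thesis unfolding eventually_nhds by blast
  qed
  obtain U B where U: "\<And>x. 0 \<le> x \<Longrightarrow> open (U x) \<and> x \<in> U x \<and> (\<forall>s\<in>U x. 0 \<le> s \<longrightarrow> norm (f s) \<le> B x)"
    using loc by metis
  have "compact {0..t}" by simp
  then obtain D where D: "D \<subseteq> {0..t}" "finite D" "{0..t} \<subseteq> (\<Union>x\<in>D. U x)"
    by (rule compactE_image[of _ "{0..t}" U]) (use U in auto)
  show ?thesis
  proof (rule that)
    show "0 \<le> (\<Sum>x\<in>D. \<bar>B x\<bar>)" by (auto intro: sum_nonneg)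
    fix s assume s: "0 \<le> s" "s \<le> t"
    then obtain x where x: "x \<in> D" "s \<in> U x" using D(3) by force
    then have "norm (f s) \<le> \<bar>B x\<bar>" using U[of x] D(1) s by force
    also have "\<dots> \<le> (\<Sum>x\<in>D. \<bar>B x\<bar>)" using x D(2) by (intro member_le_sum) auto
    finally show "norm (f s) \<le> (\<Sum>x\<in>D. \<bar>B x\<bar>)" .
  qed
qed

lemma cadlag_continuous_compose:
  assumes "cadlag f" "continuous_on UNIV g"
  shows "cadlag (\<lambda>t. g (f t))"
proof -
  have c: "((\<lambda>x. g (f x)) \<longlongrightarrow> g l) F" if "(f \<longlongrightarrow> l) F" for l F
    by (rule continuous_on_tendsto_compose[OF assms(2) that]) auto
  show ?thesis using assms(1) unfolding cadlag_def by (blast intro: c)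
qed

lemma cadlag_borel_measurable:
  fixes f :: "real \<Rightarrow> 'b::metric_space"
  assumes "cadlag f"
  shows "(\<lambda>s. f (max 0 s)) \<in> borel_measurable borel"
proof -
  have "(\<lambda>(s, \<omega>::unit). f (max 0 s)) \<in> borel_measurable (borel \<Otimes>\<^sub>M count_space UNIV)"
    using assms by (intro right_continuous_jointly_measurable[where Y="\<lambda>t _. f t"]) (auto simp: cadlag_def)
  from measurable_compose[OF _ this, of "\<lambda>s. (s, ())" borel]
  show ?thesis by simp
qed

lemma cadlag_set_integrable:
  fixes f :: "real \<Rightarrow> real"
  assumes "cadlag f"
  shows "set_integrable lborel {0..t} f"
proof -
  obtain B where B: "0 \<le> B" "\<And>s. 0 \<le> s \<Longrightarrow> s \<le> t \<Longrightarrow> norm (f s) \<le> B"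
    using cadlag_bounded[OF assms, of t] by blast
  have "integrable lborel (\<lambda>s. indicator {0..t} s *\<^sub>R f (max 0 s))"
  proof (rule integrableI_bounded_set[of "{0..t}" _ _ B])
    show "(\<lambda>s. indicator {0..t} s *\<^sub>R f (max 0 s)) \<in> borel_measurable lborel"
      using cadlag_borel_measurable[OF assms] by (auto intro!: borel_measurable_scaleR)
  qed (use B in \<open>auto simp: emeasure_lborel_Icc_eq\<close>)
  then show ?thesis unfolding set_integrable_def
    by (rule back_subst[of "integrable lborel"]) (auto simp: indicator_def max_def intro!: ext)
qed

lemma counting_integral_zero:
  assumes "counting_path n" "n t = 0" "s \<le> t"
  shows "counting_integral h n s = 0"
proof -
  have "{u \<in> jump_times n. u \<le> s} = {}"
  proof -
    have False if u: "0 < u" "\<forall>s. 0 \<le> s \<longrightarrow> s < u \<longrightarrow> n s < n u" "u \<le> s" for u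
    proof -
      have "n 0 < n u" using u by auto
      moreover have "n u \<le> n t"
        using assms u by (intro mono_onD[of "{0..}" n]) (auto simp: counting_path_def)
      ultimately show False using assms(2) by simp
    qed
    then show ?thesis by (auto simp: jump_times_def)
  qed
  then show ?thesis unfolding counting_integral_def by (metis sum.empty)
qed

lemma set_integral_Icc_diff:
  fixes f :: "real \<Rightarrow> real"
  assumes "set_integrable lborel {0..u} f" "0 \<le> s" "s \<le> u"
  shows "(LBINT x:{0..u}. f x) - (LBINT x:{0..s}. f x) = (LBINT x:{s<..u}. f x)"
proof -
  have e: "{0..u} = {0..s} \<union> {s<..u}" using assms by auto
  have "(LBINT x:{0..u}. f x) = (LBINT x:{0..s}. f x) + (LBINT x:{s<..u}. f x)"
    unfolding e by (rule set_integral_Un) (use assms in \<open>auto intro: set_integrable_subset\<close>)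
  then show ?thesis by simp
qed

lemma cadlag_integral_right_continuous:
  fixes f :: "real \<Rightarrow> real"
  assumes f: "cadlag f" and t: "0 \<le> t"
  shows "((\<lambda>u. LBINT x:{0..u}. f x) \<longlongrightarrow> (LBINT x:{0..t}. f x)) (at_right t)"
proof -
  obtain B where B: "0 \<le> B" "\<And>s. 0 \<le> s \<Longrightarrow> s \<le> t + 1 \<Longrightarrow> norm (f s) \<le> B"
    using cadlag_bounded[OF f, of "t + 1"] by blast
  show ?thesis
  proof (rule LIM_zero_cancel)
    show "((\<lambda>u. (LBINT x:{0..u}. f x) - (LBINT x:{0..t}. f x)) \<longlongrightarrow> 0) (at_right t)"
    proof (rule Lim_null_comparison)
      have "\<forall>\<^sub>F u in at_right t. t < u \<and> u < t + 1"
        using eventually_at_right_real[of t "t + 1"] by auto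
      then show "\<forall>\<^sub>F u in at_right t. norm ((LBINT x:{0..u}. f x) - (LBINT x:{0..t}. f x)) \<le> B * (u - t)"
      proof eventually_elim
        case (elim u)
        have "norm (LBINT x:{t<..u}. f x) \<le> B * measure lborel {t<..u}"
        proof -
          have i: "set_integrable lborel {t<..u} f"
            by (rule set_integrable_subset[OF cadlag_set_integrable[OF f, of u]]) (use t in auto)
          have "norm (LBINT x:{t<..u}. f x) \<le> (LBINT x:{t<..u}. norm (f x))"
            by (rule set_integral_norm_bound[OF i])
          also have "\<dots> \<le> (LBINT x:{t<..u}. B)"
            using elim t by (intro set_integral_mono set_integrable_norm i B) (auto simp: set_integrable_def)
          finally show ?thesis by (simp add: set_lebesgue_integral_def mult.commute)
        qed
        then show ?case
          using elim t set_integral_Icc_diff[OF cadlag_set_integrable[OF f], of t u] by simp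
      qed
      have "((\<lambda>u. B * (u - t)) \<longlongrightarrow> B * (t - t)) (at_right t)" by (intro tendsto_intros)
      then show "((\<lambda>u. B * (u - t)) \<longlongrightarrow> 0) (at_right t)" by simp
    qed
  qed
qed

lemma right_continuous_min:
  fixes T :: real
  assumes rc: "\<And>s. 0 \<le> s \<Longrightarrow> (f \<longlongrightarrow> f s) (at_right s)" and s: "0 \<le> s"
  shows "((\<lambda>u. f (min u T)) \<longlongrightarrow> f (min s T)) (at_right s)"
proof (cases "s < T")
  case True
  then have "\<forall>\<^sub>F u in at_right s. f (min u T) = f u"
    using eventually_at_right_real[OF True] by (auto elim!: eventually_mono)
  with rc[OF s] True show ?thesis by (simp add: tendsto_cong)
next
  case False
  then have "\<forall>\<^sub>F u in at_right s. f (min u T) = f (min s T)"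
    by (auto simp: eventually_at_filter min_def intro!: always_eventually)
  then show ?thesis by (rule tendsto_eventually)
qed

section \<open>First passage times of counting paths\<close>

text \<open>The added point \<open>t\<close> caps the passage time and keeps the infimum meaningful
  when the level \<open>K\<close> is never reached.\<close>

definition first_passage :: "(real \<Rightarrow> nat) \<Rightarrow> nat \<Rightarrow> real \<Rightarrow> real" where
  "first_passage n K t = Inf ({s. 0 \<le> s \<and> K \<le> n s} \<union> {t})"

lemma first_passage_bounds:
  assumes "0 \<le> t" shows "0 \<le> first_passage n K t" "first_passage n K t \<le> t"
  using assms unfolding first_passage_def
  by (auto intro!: cInf_greatest cInf_lower bdd_belowI[of _ 0])

text \<open>Right continuity makes the infimum attained, so that the event up to time
  \<open>s\<close> is decided by \<open>n s\<close> alone, as for a stopping time. The cap forces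
  \<open>s < t\<close>: at \<open>s = t\<close> the left side always holds.\<close>

lemma first_passage_le_iff:
  assumes mono: "mono_on {0..} n" and rc: "\<And>s. 0 \<le> s \<Longrightarrow> \<forall>\<^sub>F u in at_right s. n u = n s"
    and s: "0 \<le> s" "s < t"
  shows "first_passage n K t \<le> s \<longleftrightarrow> K \<le> n s"
proof
  assume "K \<le> n s"
  then show "first_passage n K t \<le> s" using s unfolding first_passage_def
    by (intro cInf_lower bdd_belowI[of _ 0]) auto
next
  assume le: "first_passage n K t \<le> s"
  show "K \<le> n s"
  proof (rule ccontr)
    assume "\<not> K \<le> n s"
    obtain e where e: "s < e" "\<And>u. s < u \<Longrightarrow> u < e \<Longrightarrow> n u = n s"
      using rc[OF s(1)] unfolding eventually_at_right_field by blast
    have "min e t \<le> first_passage n K t" unfolding first_passage_def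
    proof (rule cInf_greatest)
      fix x assume x: "x \<in> {s. 0 \<le> s \<and> K \<le> n s} \<union> {t}"
      show "min e t \<le> x"
      proof (rule ccontr)
        assume "\<not> min e t \<le> x"
        then have x': "0 \<le> x" "K \<le> n x" "x < e" using x by auto
        show False
        proof (cases "x \<le> s")
          case True
          then have "n x \<le> n s" using x' by (intro mono_onD[OF mono]) auto
          then show False using x' \<open>\<not> K \<le> n s\<close> by simp
        next
          case False
          then show False using e(2)[of x] x' \<open>\<not> K \<le> n s\<close> by simp
        qed
      qed
    qed auto
    then show False using le e s by simp
  qed
qed

lemma first_passage_eq:
  assumes mono: "mono_on {0..} n" and t: "0 \<le> t" and K: "n t < K"
  shows "first_passage n K t = t"
proof (rule antisym[OF first_passage_bounds(2)[OF t]])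
  show "t \<le> first_passage n K t" unfolding first_passage_def
  proof (rule cInf_greatest)
    fix x assume x: "x \<in> {s. 0 \<le> s \<and> K \<le> n s} \<union> {t}"
    show "t \<le> x"
    proof (rule ccontr)
      assume "\<not> t \<le> x"
      then have "n x \<le> n t" "K \<le> n x" using x by (auto intro!: mono_onD[OF mono])
      then show False using K by simp
    qed
  qed auto
qed

section \<open>Time integrals of processes\<close>

lemma (in prob_space) path_nn_integral:
  fixes Y :: "real \<Rightarrow> 'a \<Rightarrow> real"
  assumes m: "(\<lambda>(s, \<omega>). Y (max 0 s) \<omega>) \<in> borel_measurable (borel \<Otimes>\<^sub>M M)"
  shows "(\<lambda>\<omega>. \<integral>\<^sup>+s\<in>{0..t}. ennreal (Y s \<omega>) \<partial>lborel) \<in> borel_measurable M"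
    "(\<integral>\<^sup>+\<omega>. (\<integral>\<^sup>+s\<in>{0..t}. ennreal (Y s \<omega>) \<partial>lborel) \<partial>M) = (\<integral>\<^sup>+s\<in>{0..t}. (\<integral>\<^sup>+\<omega>. ennreal (Y s \<omega>) \<partial>M) \<partial>lborel)"
proof -
  interpret pair_sigma_finite M lborel ..
  let ?g = "\<lambda>\<omega> s. ennreal (Y (max 0 s) \<omega>) * indicator {0..t} s"
  have "(\<lambda>(\<omega>, s). Y (max 0 s) \<omega>) \<in> borel_measurable (M \<Otimes>\<^sub>M lborel)"
    using measurable_compose[OF measurable_Pair[OF measurable_snd measurable_fst] m]
    by (simp add: case_prod_beta' cong: measurable_cong_sets)
  then have g: "(\<lambda>(\<omega>, s). ?g \<omega> s) \<in> borel_measurable (M \<Otimes>\<^sub>M lborel)"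
    by (simp add: case_prod_beta')
  have e: "(\<lambda>\<omega>. \<integral>\<^sup>+s\<in>{0..t}. ennreal (Y s \<omega>) \<partial>lborel) = (\<lambda>\<omega>. \<integral>\<^sup>+s. ?g \<omega> s \<partial>lborel)"
    by (intro ext nn_integral_cong) (auto simp: indicator_def max_def)
  show "(\<lambda>\<omega>. \<integral>\<^sup>+s\<in>{0..t}. ennreal (Y s \<omega>) \<partial>lborel) \<in> borel_measurable M"
    unfolding e by (rule lborel.borel_measurable_nn_integral[OF g])
  have "(\<integral>\<^sup>+\<omega>. (\<integral>\<^sup>+s. ?g \<omega> s \<partial>lborel) \<partial>M) = (\<integral>\<^sup>+s. (\<integral>\<^sup>+\<omega>. ?g \<omega> s \<partial>M) \<partial>lborel)"
    using Fubini'[OF g] by simp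
  also have "\<dots> = (\<integral>\<^sup>+s\<in>{0..t}. (\<integral>\<^sup>+\<omega>. ennreal (Y s \<omega>) \<partial>M) \<partial>lborel)"
    by (intro nn_integral_cong) (auto simp: indicator_def max_def)
  finally show "(\<integral>\<^sup>+\<omega>. (\<integral>\<^sup>+s\<in>{0..t}. ennreal (Y s \<omega>) \<partial>lborel) \<partial>M) = (\<integral>\<^sup>+s\<in>{0..t}. (\<integral>\<^sup>+\<omega>. ennreal (Y s \<omega>) \<partial>M) \<partial>lborel)"
    using fun_cong[OF e] by simp
qed

lemma (in prob_space) path_integral_measurable:
  fixes Y :: "real \<Rightarrow> 'a \<Rightarrow> real"
  assumes m: "(\<lambda>(s, \<omega>). Y (max 0 s) \<omega>) \<in> borel_measurable (borel \<Otimes>\<^sub>M M)"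
  shows "(\<lambda>\<omega>. LBINT s:{0..t}. Y s \<omega>) \<in> borel_measurable M"
proof -
  have "(\<lambda>(\<omega>, s). Y (max 0 s) \<omega>) \<in> borel_measurable (M \<Otimes>\<^sub>M lborel)"
    using measurable_compose[OF measurable_Pair[OF measurable_snd measurable_fst] m]
    by (simp add: case_prod_beta' cong: measurable_cong_sets)
  then have "(\<lambda>(\<omega>, s). indicator {0..t} s * Y (max 0 s) \<omega>) \<in> borel_measurable (M \<Otimes>\<^sub>M lborel)"
    by (simp add: case_prod_beta')
  then have "(\<lambda>\<omega>. LBINT s. indicator {0..t} s * Y (max 0 s) \<omega>) \<in> borel_measurable M"
    by (rule lborel.borel_measurable_lebesgue_integral)
  moreover have "(\<lambda>\<omega>. LBINT s:{0..t}. Y s \<omega>) = (\<lambda>\<omega>. LBINT s. indicator {0..t} s * Y (max 0 s) \<omega>)"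
    unfolding set_lebesgue_integral_def
    by (intro ext Bochner_Integration.integral_cong) (auto simp: indicator_def max_def)
  ultimately show ?thesis by simp
qed

lemma cadlag_diff:
  fixes f g :: "real \<Rightarrow> real"
  assumes "cadlag f" "cadlag g" shows "cadlag (\<lambda>t. f t - g t)"
  using assms unfolding cadlag_def by (blast intro: tendsto_diff)

lemma cadlag_const: "cadlag (\<lambda>t. k)"
  unfolding cadlag_def by (auto intro!: tendsto_const)

lemma cadlag_integral:
  fixes f :: "real \<Rightarrow> real"
  assumes f: "cadlag f"
  shows "cadlag (\<lambda>t. LBINT x:{0..t}. f x)"
  unfolding cadlag_def
proof (intro conjI allI impI)
  show "((\<lambda>u. LBINT x:{0..u}. f x) \<longlongrightarrow> (LBINT x:{0..t}. f x)) (at_right t)" if "0 \<le> t" for t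
    by (rule cadlag_integral_right_continuous[OF f that])
  fix t :: real assume t: "0 < t"
  obtain B where B: "0 \<le> B" "\<And>s. 0 \<le> s \<Longrightarrow> s \<le> t \<Longrightarrow> norm (f s) \<le> B"
    using cadlag_bounded[OF f, of t] by blast
  have "((\<lambda>u. LBINT x:{0..u}. f x) \<longlongrightarrow> (LBINT x:{0..t}. f x)) (at_left t)"
  proof (rule LIM_zero_cancel, rule Lim_null_comparison)
    have "\<forall>\<^sub>F u in at_left t. 0 < u \<and> u < t" using eventually_at_left_real[OF t] by auto
    then show "\<forall>\<^sub>F u in at_left t. norm ((LBINT x:{0..u}. f x) - (LBINT x:{0..t}. f x)) \<le> B * (t - u)"
    proof eventually_elim
      case (elim u)
      have i: "set_integrable lborel {u<..t} f"
        by (rule set_integrable_subset[OF cadlag_set_integrable[OF f, of t]]) (use elim in auto)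
      have "norm (LBINT x:{u<..t}. f x) \<le> (LBINT x:{u<..t}. norm (f x))"
        by (rule set_integral_norm_bound[OF i])
      also have "\<dots> \<le> (LBINT x:{u<..t}. B)"
        using elim by (intro set_integral_mono set_integrable_norm i B) (auto simp: set_integrable_def)
      finally have "norm (LBINT x:{u<..t}. f x) \<le> B * (t - u)"
        using elim by (simp add: set_lebesgue_integral_def mult.commute)
      then show ?case
        using elim set_integral_Icc_diff[OF cadlag_set_integrable[OF f], of u t] by (simp add: abs_minus_commute)
    qed
    have "((\<lambda>u. B * (t - u)) \<longlongrightarrow> B * (t - t)) (at_left t)" by (intro tendsto_intros)
    then show "((\<lambda>u. B * (t - u)) \<longlongrightarrow> 0) (at_left t)" by simp
  qed
  then show "\<exists>l. ((\<lambda>u. LBINT x:{0..u}. f x) \<longlongrightarrow> l) (at_left t)" by blast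
qed

lemma (in prob_space) integrable_of_nn_integral_le:
  fixes g :: "'a \<Rightarrow> real"
  assumes "g \<in> borel_measurable M" "\<And>\<omega>. \<omega> \<in> space M \<Longrightarrow> 0 \<le> g \<omega>" "(\<integral>\<^sup>+\<omega>. ennreal (g \<omega>) \<partial>M) \<le> ennreal k" "0 \<le> k"
  shows "integrable M g" "expectation g \<le> k"
proof -
  have "(\<integral>\<^sup>+\<omega>. ennreal (g \<omega>) \<partial>M) < \<infinity>" using assms(3) by (rule le_less_trans) simp
  then show i: "integrable M g" using assms by (intro integrableI_nonneg) auto
  have "(\<integral>\<^sup>+\<omega>. ennreal (g \<omega>) \<partial>M) = ennreal (expectation g)"
    using assms(2) by (intro nn_integral_eq_integral[OF i]) auto
  then show "expectation g \<le> k" using assms(3,4) by simp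
qed

section \<open>Optional stopping\<close>

lemma filtered_prob_spaceD:
  assumes "filtered_prob_space P F"
  shows "prob_space P" "space (F t) = space P" "sets (F t) \<subseteq> sets P"
    "s \<le> t \<Longrightarrow> sets (F s) \<subseteq> sets (F t)" "subalgebra P (F t)"
  using assms unfolding filtered_prob_space_def filtration_def subalgebra_def by auto

lemma filtered_measurable_mono:
  assumes "filtered_prob_space P F" "f \<in> measurable (F s) N" "s \<le> t"
  shows "f \<in> measurable (F t) N"
proof -
  note D = filtered_prob_spaceD[OF assms(1)]
  show ?thesis using assms(2) D(4)[OF assms(3)] D(2)[of s] D(2)[of t]
    unfolding measurable_def by auto
qed

lemma filtered_measurable_P:
  assumes "filtered_prob_space P F" "f \<in> measurable (F s) N"
  shows "f \<in> measurable P N"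
  using filtered_prob_spaceD(5)[OF assms(1)] assms(2) by (rule measurable_from_subalg)

lemma martingale_set_integral_eq:
  assumes fps: "filtered_prob_space P F" and Y: "martingale P F Y"
    and st: "0 \<le> s" "s \<le> t" and A: "A \<in> sets (F s)"
  shows "(\<integral>\<omega>. indicator A \<omega> * Y t \<omega> \<partial>P) = (\<integral>\<omega>. indicator A \<omega> * Y s \<omega> \<partial>P)"
proof -
  note D = filtered_prob_spaceD[OF fps]
  interpret prob_space P by (rule D(1))
  interpret finite_measure_subalgebra P "F s" by unfold_locales (rule D(5))
  have int: "integrable P (Y t)" "integrable P (Y s)" using Y st unfolding martingale_def by auto
  have AP: "A \<in> sets P" using A D(3) by auto
  have "(\<integral>\<omega>\<in>A. Y t \<omega> \<partial>P) = (\<integral>\<omega>\<in>A. real_cond_exp P (F s) (Y t) \<omega> \<partial>P)"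
    by (rule real_cond_exp_intA[OF int(1) A])
  also have "\<dots> = (\<integral>\<omega>\<in>A. Y s \<omega> \<partial>P)"
    unfolding set_lebesgue_integral_def
  proof (rule integral_cong_AE)
    show "AE \<omega> in P. indicator A \<omega> *\<^sub>R real_cond_exp P (F s) (Y t) \<omega> = indicator A \<omega> *\<^sub>R Y s \<omega>"
    proof -
      have "AE \<omega> in P. real_cond_exp P (F s) (Y t) \<omega> = Y s \<omega>"
        using Y st unfolding martingale_def by blast
      then show ?thesis by eventually_elim simp
    qed
  qed (use int AP in \<open>auto\<close>)
  finally show ?thesis by (simp add: set_lebesgue_integral_def)
qed

text \<open>The submartingale inequality for a convex function of \<open>Y\<close>. On the part of
  \<open>A\<close> where \<open>Y s < - R\<close> the positive part is linear in \<open>Y\<close>,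
  so the martingale identity applies there, and at time \<open>t\<close> the linear function lies
  below its positive part.\<close>

lemma martingale_lower_tail_mono:
  assumes fps: "filtered_prob_space P F" and Y: "martingale P F Y"
    and st: "0 \<le> s" "s \<le> t" and A: "A \<in> sets (F s)"
  shows "(\<integral>\<omega>. indicator A \<omega> * max (- Y s \<omega> - R) 0 \<partial>P) \<le> (\<integral>\<omega>. indicator A \<omega> * max (- Y t \<omega> - R) 0 \<partial>P)"
proof -
  note D = filtered_prob_spaceD[OF fps]
  interpret prob_space P by (rule D(1))
  have int: "integrable P (Y t)" "integrable P (Y s)" and m: "Y s \<in> borel_measurable (F s)"
    using Y st unfolding martingale_def by auto
  define B where "B = A \<inter> {\<omega>\<in>space P. Y s \<omega> < - R}"
  have B: "B \<in> sets (F s)"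
  proof -
    have "{\<omega>\<in>space (F s). Y s \<omega> < - R} \<in> sets (F s)" using m by measurable
    then show ?thesis using A D(2) unfolding B_def by auto
  qed
  have BP: "B \<in> sets P" and AP: "A \<in> sets P" using B A D(3) by auto
  have ib: "integrable P (\<lambda>\<omega>. indicator C \<omega> * f \<omega>)" if "C \<in> sets P" "integrable P f" for C and f :: "'a \<Rightarrow> real"
    using integrable_mult_indicator[OF that] by simp
  have "(\<integral>\<omega>. indicator A \<omega> * max (- Y s \<omega> - R) 0 \<partial>P) = (\<integral>\<omega>. indicator B \<omega> * (- Y s \<omega> - R) \<partial>P)"
    by (rule Bochner_Integration.integral_cong) (auto simp: B_def indicator_def)
  also have "\<dots> = - (\<integral>\<omega>. indicator B \<omega> * Y s \<omega> \<partial>P) - (\<integral>\<omega>. indicator B \<omega> * R \<partial>P)"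
    using ib[OF BP int(2)] ib[OF BP integrable_const[of R]]
    by (simp add: right_diff_distrib)
  also have "\<dots> = - (\<integral>\<omega>. indicator B \<omega> * Y t \<omega> \<partial>P) - (\<integral>\<omega>. indicator B \<omega> * R \<partial>P)"
    using martingale_set_integral_eq[OF fps Y st B] by simp
  also have "\<dots> = (\<integral>\<omega>. indicator B \<omega> * (- Y t \<omega> - R) \<partial>P)"
    using ib[OF BP int(1)] ib[OF BP integrable_const[of R]]
    by (simp add: right_diff_distrib)
  also have "\<dots> \<le> (\<integral>\<omega>. indicator A \<omega> * max (- Y t \<omega> - R) 0 \<partial>P)"
  proof (rule integral_mono)
    show "integrable P (\<lambda>\<omega>. indicator B \<omega> * (- Y t \<omega> - R))"
      "integrable P (\<lambda>\<omega>. indicator A \<omega> * max (- Y t \<omega> - R) 0)"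
      using int by (auto intro!: ib BP AP)
  qed (auto simp: B_def indicator_def)
  finally show ?thesis .
qed

text \<open>The stopped values \<open>Z n\<close> on grids approximating \<open>S\<close> from above have lower tails dominated by
  those of \<open>Y t\<close>; this uniform integrability from below is what Fatou's lemma needs.\<close>

lemma martingale_optional_stopping_le:
  assumes fps: "filtered_prob_space P F" and Y: "martingale P F Y"
    and rc: "\<And>\<omega> s. \<omega> \<in> space P \<Longrightarrow> 0 \<le> s \<Longrightarrow> ((\<lambda>u. Y u \<omega>) \<longlongrightarrow> Y s \<omega>) (at_right s)"
    and t: "0 \<le> t" and S: "\<And>\<omega>. \<omega> \<in> space P \<Longrightarrow> 0 \<le> S \<omega> \<and> S \<omega> \<le> t"
    and S_meas: "\<And>s. 0 \<le> s \<Longrightarrow> s < t \<Longrightarrow> {\<omega>\<in>space P. S \<omega> \<le> s} \<in> sets (F s)"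
    and lower: "AE \<omega> in P. - B \<le> Y (S \<omega>) \<omega>"
  shows "(\<lambda>\<omega>. Y (S \<omega>) \<omega>) \<in> borel_measurable P"
    and "(\<integral>\<^sup>+\<omega>. ennreal (Y (S \<omega>) \<omega> + B) \<partial>P) \<le> ennreal ((\<integral>\<omega>. Y 0 \<omega> \<partial>P) + B)"
proof -
  note D = filtered_prob_spaceD[OF fps]
  interpret prob_space P by (rule D(1))
  have int: "integrable P (Y u)" if "0 \<le> u" for u
    using Y that unfolding martingale_def by auto
  \<comment> \<open>The mesh is \<open>t / Suc n\<close>: the decision times \<open>u n k\<close>
    with \<open>k \<le> n\<close> lie strictly before \<open>t\<close>, where \<open>S_meas\<close>
    gives the measurability of \<open>{S \<le> u n k}\<close>. For \<open>t = 0\<close> the grid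
    degenerates and this event is the whole space.\<close>
  define u where "u n k = real k * t / real (Suc n)" for n k :: nat
  define G where "G n k = {\<omega>\<in>space P. S \<omega> \<le> u n k}" for n k
  \<comment> \<open>A martingale transform: an increment counts as long as \<open>S\<close> has not
    occurred by its left end. Hence \<open>Z n\<close> has the mean of \<open>Y 0\<close> and equals
    \<open>Y\<close> at the first grid time not before \<open>S\<close>.\<close>
  define Z where "Z n \<omega> = Y 0 \<omega> + (\<Sum>k\<le>n. indicator (space P - G n k) \<omega> * (Y (u n (Suc k)) \<omega> - Y (u n k) \<omega>))" for n \<omega>
  have u: "0 \<le> u n k" "u n k \<le> u n (Suc k)" "u n 0 = 0" "u n (Suc n) = t" for n k
    using t by (auto simp: u_def field_simps)
  have u_lt: "u n k < t \<or> t = 0" if "k \<le> n" for n k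
    using that t mult_strict_right_mono[of "real k" "real (Suc n)" t]
    by (auto simp: u_def divide_less_eq mult.commute)
  have G: "G n k \<in> sets (F (u n k))" if "k \<le> n" for n k
  proof (cases "t = 0")
    case True
    then have "G n k = space P" using S u(1)[of n k] unfolding G_def by fastforce
    then show ?thesis using D(2)[of "u n k"] by (metis sets.top)
  next
    case False
    then show ?thesis unfolding G_def using u_lt[OF that] u(1) by (intro S_meas) auto
  qed
  have GP: "G n k \<in> sets P" if "k \<le> n" for n k using G[OF that] D(3) by auto
  have ib: "integrable P (\<lambda>\<omega>. indicator C \<omega> * f \<omega>)" if "C \<in> sets P" "integrable P f" for C and f :: "'a \<Rightarrow> real"
    using integrable_mult_indicator[OF that] by simp
  have Z_int: "integrable P (Z n)" for n
    unfolding Z_def by (intro Bochner_Integration.integrable_add int Bochner_Integration.integrable_sum ib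
        Bochner_Integration.integrable_diff sets.Diff GP u) auto
  have Z_exp: "(\<integral>\<omega>. Z n \<omega> \<partial>P) = (\<integral>\<omega>. Y 0 \<omega> \<partial>P)" for n
  proof -
    have "(\<integral>\<omega>. indicator (space P - G n k) \<omega> * (Y (u n (Suc k)) \<omega> - Y (u n k) \<omega>) \<partial>P) = 0" if "k \<le> n" for k
    proof -
      have c: "space P - G n k \<in> sets (F (u n k))"
        using G[OF that] D(2)[of "u n k"] by (metis sets.compl_sets)
      have i: "integrable P (\<lambda>\<omega>. indicator (space P - G n k) \<omega> * Y (u n j) \<omega>)" for j
        using GP[OF that] u by (intro ib int) auto
      show ?thesis
        using martingale_set_integral_eq[OF fps Y u(1,2) c] i
        by (simp add: right_diff_distrib)
    qed
    then have z: "(\<Sum>k\<le>n. \<integral>\<omega>. indicator (space P - G n k) \<omega> * (Y (u n (Suc k)) \<omega> - Y (u n k) \<omega>) \<partial>P) = 0"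
      by (intro sum.neutral) simp
    have i: "integrable P (\<lambda>\<omega>. indicator (space P - G n k) \<omega> * (Y (u n (Suc k)) \<omega> - Y (u n k) \<omega>))" if "k \<le> n" for k
      by (intro ib Bochner_Integration.integrable_diff int sets.Diff GP that u sets.top)
    show ?thesis unfolding Z_def
      by (subst Bochner_Integration.integral_add[OF int[OF order_refl] Bochner_Integration.integrable_sum[OF i]], simp,
          subst Bochner_Integration.integral_sum[OF i]) (simp_all only: z, simp_all)
  qed
  define J where "J n \<omega> = (LEAST k. S \<omega> \<le> u n k)" for n \<omega>
  have J1: "S \<omega> \<le> u n (J n \<omega>)" and J2: "\<And>k. k < J n \<omega> \<Longrightarrow> u n k < S \<omega>" and J3: "J n \<omega> \<le> Suc n"
    if "\<omega> \<in> space P" for n \<omega>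
  proof -
    have a: "S \<omega> \<le> u n (Suc n)" using S[OF that] u(4) by simp
    show "S \<omega> \<le> u n (J n \<omega>)" unfolding J_def by (rule LeastI[of _ "Suc n"]) (rule a)
    show "J n \<omega> \<le> Suc n" unfolding J_def by (rule Least_le) (rule a)
    show "u n k < S \<omega>" if "k < J n \<omega>" for k
      using not_less_Least[of k "\<lambda>k. S \<omega> \<le> u n k"] that unfolding J_def by auto
  qed
  have u_mono: "u n i \<le> u n j" if "i \<le> j" for n i j
    using that t unfolding u_def by (intro divide_right_mono mult_right_mono) auto
  have ind: "indicator (G n k) \<omega> = (if J n \<omega> \<le> k then 1 else 0 :: real)" if "\<omega> \<in> space P" for n k \<omega>
    using J1[OF that, of n] J2[OF that, of k n] u_mono[of "J n \<omega>" k n] that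
    by (auto simp: G_def indicator_def not_le)
  have tele: "(\<Sum>k\<le>n. (if J n \<omega> \<le> k then 1 else 0) * (a (Suc k) - a k)) = a (Suc n) - a (J n \<omega>)"
    if "\<omega> \<in> space P" for n \<omega> and a :: "nat \<Rightarrow> real"
  proof -
    have "(\<Sum>k\<le>n. (if J n \<omega> \<le> k then 1 else 0) * (a (Suc k) - a k)) = (\<Sum>k\<in>{J n \<omega>..<Suc n}. a (Suc k) - a k)"
      by (rule sum.mono_neutral_cong_right) auto
    then show ?thesis using sum_Suc_diff'[OF J3[OF that], of a n] by simp
  qed
  have Z_eq: "Z n \<omega> = Y (u n (J n \<omega>)) \<omega>" if w: "\<omega> \<in> space P" for n \<omega>
  proof -
    have "Z n \<omega> = Y 0 \<omega> + (\<Sum>k\<le>n. (Y (u n (Suc k)) \<omega> - Y (u n k) \<omega>)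
        - (if J n \<omega> \<le> k then 1 else 0) * (Y (u n (Suc k)) \<omega> - Y (u n k) \<omega>))"
    proof -
      have c: "indicator (space P - G n k) \<omega> = 1 - (if J n \<omega> \<le> k then 1 else 0 :: real)" for k
        unfolding ind[OF w, symmetric] using w by (simp add: indicator_def)
      show ?thesis unfolding Z_def c by (simp only: left_diff_distrib mult_1)
    qed
    also have "\<dots> = Y 0 \<omega> + (\<Sum>k\<le>n. Y (u n (Suc k)) \<omega> - Y (u n k) \<omega>) - (Y (u n (Suc n)) \<omega> - Y (u n (J n \<omega>)) \<omega>)"
      unfolding sum_subtractf[of _ _ "{..n}"] tele[OF w, of n "\<lambda>k. Y (u n k) \<omega>", symmetric] by simp
    also have "\<dots> = Y (u n (J n \<omega>)) \<omega>"
      using sum_telescope[of "\<lambda>k. - Y (u n k) \<omega>" n] u(3) by (simp add: sum_negf[symmetric])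
    finally show ?thesis .
  qed
  \<comment> \<open>The difference of the two tails telescopes over the steps after
    \<open>S\<close>, and each summand has nonnegative mean by
    \<open>martingale_lower_tail_mono\<close> on the event \<open>G n k\<close>.\<close>
  have Z_tail: "(\<integral>\<omega>. max (- Z n \<omega> - R) 0 \<partial>P) \<le> (\<integral>\<omega>. max (- Y t \<omega> - R) 0 \<partial>P)" for n R
  proof -
    define g where "g k \<omega> = max (- Y (u n k) \<omega> - R) 0" for k \<omega>
    have gi: "integrable P (g k)" for k unfolding g_def using int[OF u(1)] by simp
    have zi: "integrable P (\<lambda>\<omega>. max (- Z n \<omega> - R) 0)" using Z_int by simp
    have "(\<integral>\<omega>. g (Suc n) \<omega> - max (- Z n \<omega> - R) 0 \<partial>P) = (\<integral>\<omega>. (\<Sum>k\<le>n. indicator (G n k) \<omega> * (g (Suc k) \<omega> - g k \<omega>)) \<partial>P)"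
    proof (rule Bochner_Integration.integral_cong[OF refl])
      fix \<omega> assume w: "\<omega> \<in> space P"
      show "g (Suc n) \<omega> - max (- Z n \<omega> - R) 0 = (\<Sum>k\<le>n. indicator (G n k) \<omega> * (g (Suc k) \<omega> - g k \<omega>))"
        using tele[OF w, of n "\<lambda>k. g k \<omega>"] unfolding ind[OF w] Z_eq[OF w] by (simp add: g_def)
    qed
    also have "\<dots> = (\<Sum>k\<le>n. \<integral>\<omega>. indicator (G n k) \<omega> * (g (Suc k) \<omega> - g k \<omega>) \<partial>P)"
      by (rule Bochner_Integration.integral_sum) (auto intro!: ib GP gi)
    also have "\<dots> \<ge> 0"
    proof (rule sum_nonneg)
      fix k assume "k \<in> {..n}"
      then have k: "k \<le> n" by simp
      have i: "integrable P (\<lambda>\<omega>. indicator (G n k) \<omega> * g j \<omega>)" for j by (rule ib[OF GP[OF k] gi])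
      show "0 \<le> (\<integral>\<omega>. indicator (G n k) \<omega> * (g (Suc k) \<omega> - g k \<omega>) \<partial>P)"
        using martingale_lower_tail_mono[OF fps Y u(1,2) G[OF k], of R] i
        by (simp add: right_diff_distrib g_def)
    qed
    finally show ?thesis
      unfolding Bochner_Integration.integral_diff[OF gi zi] unfolding g_def u(4) by simp
  qed
  have conv: "(\<lambda>n. Z n \<omega>) \<longlonglongrightarrow> Y (S \<omega>) \<omega>" if w: "\<omega> \<in> space P" for \<omega>
  proof -
    have b: "u n (J n \<omega>) \<le> S \<omega> + t / real (Suc n)" for n
    proof (cases "J n \<omega>")
      case 0
      then show ?thesis using u(3)[of n] S[OF w] t by simp
    next
      case (Suc k)
      then have "u n k < S \<omega>" using J2[OF w] by auto
      moreover have "u n (J n \<omega>) = u n k + t / real (Suc n)"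
        unfolding Suc u_def by (simp only: add_divide_distrib[symmetric]) (simp add: algebra_simps)
      ultimately show ?thesis by simp
    qed
    have l: "(\<lambda>n. u n (J n \<omega>)) \<longlonglongrightarrow> S \<omega>"
    proof (rule tendsto_sandwich[of "\<lambda>_. S \<omega>"])
      show "(\<lambda>n. S \<omega> + t / real (Suc n)) \<longlonglongrightarrow> S \<omega>"
        using tendsto_add[OF tendsto_const tendsto_mult_right_zero[OF LIMSEQ_inverse_real_of_nat], of "S \<omega>" t]
        by (simp add: divide_inverse)
    qed (use J1[OF w] b in \<open>auto intro!: always_eventually simp del: of_nat_Suc\<close>)
    have "((\<lambda>s. Y s \<omega>) \<longlongrightarrow> Y (S \<omega>) \<omega>) (at (S \<omega>) within {S \<omega>..})"
      using rc[OF w, of "S \<omega>"] S[OF w] at_within_Ici_at_right[of "S \<omega>"] by simp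
    then have "continuous (at (S \<omega>) within {S \<omega>..}) (\<lambda>s. Y s \<omega>)" by (simp add: continuous_within)
    then have "(\<lambda>n. Y (u n (J n \<omega>)) \<omega>) \<longlonglongrightarrow> Y (S \<omega>) \<omega>"
      using J1[OF w] l unfolding continuous_within_sequentially by (auto simp: comp_def)
    then show ?thesis using Z_eq[OF w] by simp
  qed
  show meas: "(\<lambda>\<omega>. Y (S \<omega>) \<omega>) \<in> borel_measurable P"
    by (rule borel_measurable_LIMSEQ_real[where u=Z]) (use conv Z_int in auto)
  define T where "T R = (\<integral>\<omega>. max (- Y t \<omega> - R) 0 \<partial>P)" for R
  have T0: "(\<lambda>n. T (real n)) \<longlonglongrightarrow> 0"
  proof -
    have "(\<lambda>n. T (real n)) \<longlonglongrightarrow> (\<integral>\<omega>. 0 \<partial>P)" unfolding T_def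
    proof (rule integral_dominated_convergence[where w="\<lambda>\<omega>. \<bar>Y t \<omega>\<bar>"])
      show "AE \<omega> in P. (\<lambda>n. max (- Y t \<omega> - real n) 0) \<longlonglongrightarrow> 0"
      proof (rule AE_I2, rule tendsto_eventually)
        fix \<omega>
        show "\<forall>\<^sub>F n in sequentially. max (- Y t \<omega> - real n) 0 = 0"
          using eventually_ge_at_top[of "nat \<lceil>- Y t \<omega>\<rceil>"] by eventually_elim linarith
      qed
    qed (use int[OF t] in \<open>auto\<close>)
    then show ?thesis by simp
  qed
  \<comment> \<open>\<open>Z n\<close> is clipped at \<open>- R\<close> and shifted by
    \<open>R\<close>, which makes Fatou's lemma applicable; the clipping costs at most the tail
    \<open>T R\<close>, uniformly in \<open>n\<close>.\<close>
  have main: "(\<integral>\<^sup>+\<omega>. ennreal (Y (S \<omega>) \<omega> + B) \<partial>P) + ennreal (R - B) \<le> ennreal ((\<integral>\<omega>. Y 0 \<omega> \<partial>P) + R + T R)"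
    if R: "B \<le> R" "0 \<le> R" for R
  proof -
    have "(\<integral>\<^sup>+\<omega>. ennreal (Y (S \<omega>) \<omega> + B) \<partial>P) + ennreal (R - B) = (\<integral>\<^sup>+\<omega>. ennreal (Y (S \<omega>) \<omega> + B) + ennreal (R - B) \<partial>P)"
      using meas by (subst nn_integral_add) (auto simp: emeasure_space_1)
    also have "\<dots> = (\<integral>\<^sup>+\<omega>. ennreal (max (Y (S \<omega>) \<omega>) (- R) + R) \<partial>P)"
    proof (rule nn_integral_cong_AE)
      show "AE \<omega> in P. ennreal (Y (S \<omega>) \<omega> + B) + ennreal (R - B) = ennreal (max (Y (S \<omega>) \<omega>) (- R) + R)"
        using lower by eventually_elim (use R in \<open>auto simp: ennreal_plus[symmetric] simp del: ennreal_plus\<close>)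
    qed
    also have "\<dots> = (\<integral>\<^sup>+\<omega>. liminf (\<lambda>n. ennreal (max (Z n \<omega>) (- R) + R)) \<partial>P)"
    proof (rule nn_integral_cong)
      fix \<omega> assume "\<omega> \<in> space P"
      then have "(\<lambda>n. ennreal (max (Z n \<omega>) (- R) + R)) \<longlonglongrightarrow> ennreal (max (Y (S \<omega>) \<omega>) (- R) + R)"
        by (intro tendsto_intros conv)
      then show "ennreal (max (Y (S \<omega>) \<omega>) (- R) + R) = liminf (\<lambda>n. ennreal (max (Z n \<omega>) (- R) + R))"
        by (simp add: lim_imp_Liminf)
    qed
    also have "\<dots> \<le> liminf (\<lambda>n. \<integral>\<^sup>+\<omega>. ennreal (max (Z n \<omega>) (- R) + R) \<partial>P)"
      by (rule nn_integral_liminf) (use Z_int in auto)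
    also have "\<dots> \<le> ennreal ((\<integral>\<omega>. Y 0 \<omega> \<partial>P) + R + T R)"
    proof (rule Liminf_le, simp, rule always_eventually, rule allI)
      fix n
      have zi: "integrable P (\<lambda>\<omega>. max (- Z n \<omega> - R) 0)" using Z_int by simp
      have "(\<integral>\<^sup>+\<omega>. ennreal (max (Z n \<omega>) (- R) + R) \<partial>P) = ennreal (\<integral>\<omega>. max (Z n \<omega>) (- R) + R \<partial>P)"
        by (rule nn_integral_eq_integral) (use Z_int in auto)
      also have "(\<integral>\<omega>. max (Z n \<omega>) (- R) + R \<partial>P) = (\<integral>\<omega>. Z n \<omega> + R + max (- Z n \<omega> - R) 0 \<partial>P)"
        by (rule Bochner_Integration.integral_cong) auto
      also have "\<dots> = (\<integral>\<omega>. Y 0 \<omega> \<partial>P) + R + (\<integral>\<omega>. max (- Z n \<omega> - R) 0 \<partial>P)"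
        using Z_int[of n] zi Z_exp[of n] by (simp add: prob_space)
      finally show "(\<integral>\<^sup>+\<omega>. ennreal (max (Z n \<omega>) (- R) + R) \<partial>P) \<le> ennreal ((\<integral>\<omega>. Y 0 \<omega> \<partial>P) + R + T R)"
        using Z_tail[of n R] by (auto simp: T_def intro!: ennreal_leI)
    qed
    finally show ?thesis .
  qed
  have fin: "(\<integral>\<^sup>+\<omega>. ennreal (Y (S \<omega>) \<omega> + B) \<partial>P) < \<infinity>"
    using main[of "max B 0"] by (auto simp: top.not_eq_extremum[symmetric] top_unique)
  define L where "L = enn2real (\<integral>\<^sup>+\<omega>. ennreal (Y (S \<omega>) \<omega> + B) \<partial>P)"
  have L: "(\<integral>\<^sup>+\<omega>. ennreal (Y (S \<omega>) \<omega> + B) \<partial>P) = ennreal L" "0 \<le> L"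
    using fin unfolding L_def by auto
  have *: "L \<le> (\<integral>\<omega>. Y 0 \<omega> \<partial>P) + B + T R" if R: "B < R" "0 \<le> R" for R
  proof -
    have "ennreal (L + (R - B)) = ennreal L + ennreal (R - B)" using L(2) R by (intro ennreal_plus) auto
    then have "ennreal (L + (R - B)) \<le> ennreal ((\<integral>\<omega>. Y 0 \<omega> \<partial>P) + R + T R)"
      using main[of R] L R by simp
    then show ?thesis using L(2) R by (auto simp: ennreal_le_iff2 simp del: ennreal_plus)
  qed
  have "\<forall>\<^sub>F n in sequentially. L \<le> (\<integral>\<omega>. Y 0 \<omega> \<partial>P) + B + T (real n)"
    using eventually_gt_at_top[of "nat \<lceil>B\<rceil>"]
    by eventually_elim (rule *, linarith+)
  then have "L \<le> (\<integral>\<omega>. Y 0 \<omega> \<partial>P) + B + 0"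
    by (intro tendsto_lowerbound[OF tendsto_add[OF tendsto_const T0]]) auto
  then show "(\<integral>\<^sup>+\<omega>. ennreal (Y (S \<omega>) \<omega> + B) \<partial>P) \<le> ennreal ((\<integral>\<omega>. Y 0 \<omega> \<partial>P) + B)"
    unfolding L by (auto intro: ennreal_leI)
qed

section \<open>Moments of the intensity\<close>

locale hawkes_start =
  fixes \<alpha> :: real and \<zeta> :: "real^'m" and c :: "real^'m^'m" and b \<sigma> a :: "real \<Rightarrow> real"
    and P :: "'w measure" and F :: "real \<Rightarrow> 'w measure"
    and N :: "'m \<Rightarrow> real \<Rightarrow> 'w \<Rightarrow> nat" and W X :: "real \<Rightarrow> 'w \<Rightarrow> real"
    and lam :: "real \<Rightarrow> 'w \<Rightarrow> real^'m" and z :: "real \<times> (real^'m)" and \<kappa> :: "real^'m" and r :: real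
  assumes dyn: "hawkes_jump_diffusion \<alpha> \<zeta> c b \<sigma> a P F N W X lam"
    and start: "AE \<omega> in P. (X 0 \<omega>, lam 0 \<omega>) = z"
    and \<alpha>_pos: "0 < \<alpha>" and \<zeta>_pos: "\<And>i. 0 < \<zeta> $ i" and \<kappa>_pos: "\<And>i. 0 < \<kappa> $ i"
    and r_pos: "0 < r" and r_less: "r < 1"
    and eig: "\<And>j. (\<Sum>i\<in>UNIV. \<kappa> $ i * c $ i $ j) = \<alpha> * r * \<kappa> $ j"
begin

definition V :: "real \<Rightarrow> 'w \<Rightarrow> real" where "V t \<omega> = (\<Sum>i\<in>UNIV. \<kappa> $ i * lam t \<omega> $ i)"
definition v :: real where "v = (\<Sum>i\<in>UNIV. \<kappa> $ i * snd z $ i)"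
definition C :: real where "C = \<alpha> * (\<Sum>i\<in>UNIV. \<kappa> $ i * \<zeta> $ i)"
definition \<Lambda> :: "'m \<Rightarrow> real \<Rightarrow> 'w \<Rightarrow> real" where "\<Lambda> j t \<omega> = (LBINT s:{0..t}. lam s \<omega> $ j)"
definition IV :: "real \<Rightarrow> 'w \<Rightarrow> real" where "IV t \<omega> = (\<Sum>j\<in>UNIV. \<kappa> $ j * \<Lambda> j t \<omega>)"
definition Nt :: "real \<Rightarrow> 'w \<Rightarrow> nat" where "Nt t \<omega> = (\<Sum>j\<in>UNIV. N j t \<omega>)"

section \<open>Measurability and path properties of intensity and counts\<close>

lemma fps: "filtered_prob_space P F"
  using dyn unfolding hawkes_jump_diffusion_def by blast

sublocale prob_space P using filtered_prob_spaceD(1)[OF fps] .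

lemma X_meas: "0 \<le> t \<Longrightarrow> X t \<in> borel_measurable (F t)"
  and lam_meas: "0 \<le> t \<Longrightarrow> lam t \<in> borel_measurable (F t)"
  and N_meas: "0 \<le> t \<Longrightarrow> N i t \<in> measurable (F t) (count_space UNIV)"
  using dyn unfolding hawkes_jump_diffusion_def by blast+

lemma X_cadlag: "\<omega> \<in> space P \<Longrightarrow> cadlag (\<lambda>t. X t \<omega>)"
  and lam_cadlag: "\<omega> \<in> space P \<Longrightarrow> cadlag (\<lambda>t. lam t \<omega>)"
  and N_path: "\<omega> \<in> space P \<Longrightarrow> counting_path (\<lambda>t. N i t \<omega>)"
  using dyn unfolding hawkes_jump_diffusion_def by blast+

lemma lam_nonneg: "0 \<le> t \<Longrightarrow> \<omega> \<in> space P \<Longrightarrow> 0 \<le> lam t \<omega> $ i"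
  and N_martingale: "local_martingale P F (\<lambda>t \<omega>. real (N i t \<omega>) - (LBINT s:{0..t}. lam s \<omega> $ i))"
  using dyn unfolding hawkes_jump_diffusion_def has_intensity_def by blast+

lemma N_mono: "\<omega> \<in> space P \<Longrightarrow> mono_on {0..} (\<lambda>t. N i t \<omega>)"
  and N_0: "\<omega> \<in> space P \<Longrightarrow> N i 0 \<omega> = 0"
  and N_rc: "\<omega> \<in> space P \<Longrightarrow> 0 \<le> t \<Longrightarrow> \<forall>\<^sub>F s in at_right t. N i s \<omega> = N i t \<omega>"
  using N_path unfolding counting_path_def by blast+

lemma lam_nth_meas: "0 \<le> t \<Longrightarrow> (\<lambda>\<omega>. lam t \<omega> $ i) \<in> borel_measurable (F t)"
  using measurable_compose[OF lam_meas borel_measurable_continuous_onI[of "\<lambda>x. x $ i"]]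
  by (simp add: continuous_on_component)

lemma lam_nth_cadlag: "\<omega> \<in> space P \<Longrightarrow> cadlag (\<lambda>t. lam t \<omega> $ i)"
  using cadlag_continuous_compose[OF lam_cadlag, of \<omega> "\<lambda>x. x $ i"] by (simp add: continuous_on_component)

lemma lam_joint: "(\<lambda>(s, \<omega>). lam (max 0 s) \<omega> $ i) \<in> borel_measurable (borel \<Otimes>\<^sub>M P)"
  using lam_nth_cadlag filtered_measurable_P[OF fps lam_nth_meas]
  by (intro right_continuous_jointly_measurable[where Y="\<lambda>s \<omega>. lam s \<omega> $ i"]) (auto simp: cadlag_def)

lemma \<Lambda>_meas: "\<Lambda> i t \<in> borel_measurable P"
  unfolding \<Lambda>_def[abs_def] by (rule path_integral_measurable[OF lam_joint])

lemma \<Lambda>_rc: "\<omega> \<in> space P \<Longrightarrow> 0 \<le> t \<Longrightarrow> ((\<lambda>u. \<Lambda> i u \<omega>) \<longlongrightarrow> \<Lambda> i t \<omega>) (at_right t)"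
  unfolding \<Lambda>_def by (rule cadlag_integral_right_continuous[OF lam_nth_cadlag])

lemma \<Lambda>_mono:
  assumes "\<omega> \<in> space P" "0 \<le> s" "s \<le> t"
  shows "\<Lambda> i s \<omega> \<le> \<Lambda> i t \<omega>"
proof -
  have "0 \<le> (LBINT x:{s<..t}. lam x \<omega> $ i)"
    unfolding set_lebesgue_integral_def
    using assms lam_nonneg by (intro Bochner_Integration.integral_nonneg) (auto simp: indicator_def)
  then show ?thesis
    using set_integral_Icc_diff[OF cadlag_set_integrable[OF lam_nth_cadlag[OF assms(1)]] assms(2,3), of i]
    unfolding \<Lambda>_def by simp
qed

lemma \<Lambda>_0: "\<Lambda> i 0 \<omega> = 0"
  unfolding \<Lambda>_def set_lebesgue_integral_def
proof (rule integral_eq_zero_AE)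
  have "AE s in lborel. s \<noteq> (0::real)" by (rule AE_lborel_singleton)
  then show "AE s in lborel. indicator {0..0} s *\<^sub>R lam s \<omega> $ i = 0"
    by eventually_elim (auto simp: indicator_def)
qed

lemma \<Lambda>_nonneg: "\<omega> \<in> space P \<Longrightarrow> 0 \<le> t \<Longrightarrow> 0 \<le> \<Lambda> i t \<omega>"
  using \<Lambda>_mono[of \<omega> 0 t i] by (simp add: \<Lambda>_0)

text \<open>Composition of the jointly measurable process with the graph map of
  \<open>\<tau>\<close>; it provides the measurability of all stopped values below.\<close>

lemma at_random_time:
  fixes Y :: "real \<Rightarrow> 'w \<Rightarrow> real"
  assumes "\<And>t. 0 \<le> t \<Longrightarrow> Y t \<in> borel_measurable P"
    and "\<And>\<omega> t. \<omega> \<in> space P \<Longrightarrow> 0 \<le> t \<Longrightarrow> ((\<lambda>u. Y u \<omega>) \<longlongrightarrow> Y t \<omega>) (at_right t)"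
    and \<tau>: "\<tau> \<in> borel_measurable P" "\<And>\<omega>. \<omega> \<in> space P \<Longrightarrow> 0 \<le> \<tau> \<omega>"
  shows "(\<lambda>\<omega>. Y (\<tau> \<omega>) \<omega>) \<in> borel_measurable P"
proof -
  have "(\<lambda>\<omega>. (\<tau> \<omega>, \<omega>)) \<in> measurable P (borel \<Otimes>\<^sub>M P)" using \<tau> by simp
  from measurable_compose[OF this right_continuous_jointly_measurable[OF assms(1,2)]]
  have "(\<lambda>\<omega>. Y (max 0 (\<tau> \<omega>)) \<omega>) \<in> borel_measurable P" by simp
  then show ?thesis by (rule measurable_cong[THEN iffD1, rotated]) (use \<tau> in \<open>simp add: max_def\<close>)
qed

lemma N_real_rc: "\<omega> \<in> space P \<Longrightarrow> 0 \<le> t \<Longrightarrow> ((\<lambda>u. real (N i u \<omega>)) \<longlongrightarrow> real (N i t \<omega>)) (at_right t)"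
  by (rule tendsto_eventually) (use N_rc[of \<omega> t i] in \<open>auto elim: eventually_mono\<close>)

lemma N_real_meas: "0 \<le> t \<Longrightarrow> (\<lambda>\<omega>. real (N i t \<omega>)) \<in> borel_measurable P"
  using filtered_measurable_P[OF fps N_meas[of t i]] by simp

section \<open>The Lyapunov equation and localisation by the number of jumps\<close>

lemma V_nonneg: "0 \<le> t \<Longrightarrow> \<omega> \<in> space P \<Longrightarrow> 0 \<le> V t \<omega>"
  unfolding V_def using \<kappa>_pos lam_nonneg by (intro sum_nonneg mult_nonneg_nonneg) (auto simp: less_imp_le)

lemma IV_nonneg: "0 \<le> t \<Longrightarrow> \<omega> \<in> space P \<Longrightarrow> 0 \<le> IV t \<omega>"
  unfolding IV_def using \<kappa>_pos \<Lambda>_nonneg by (intro sum_nonneg mult_nonneg_nonneg) (auto simp: less_imp_le)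

lemma IV_eq: "\<omega> \<in> space P \<Longrightarrow> IV t \<omega> = (LBINT s:{0..t}. V s \<omega>)"
proof -
  assume w: "\<omega> \<in> space P"
  have i: "integrable lborel (\<lambda>s. \<kappa> $ j * (indicator {0..t} s *\<^sub>R lam s \<omega> $ j))" for j
    using cadlag_set_integrable[OF lam_nth_cadlag[OF w], of t j] unfolding set_integrable_def by simp
  have "(LBINT s:{0..t}. V s \<omega>) = (LBINT s. \<Sum>j\<in>UNIV. \<kappa> $ j * (indicator {0..t} s *\<^sub>R lam s \<omega> $ j))"
    unfolding set_lebesgue_integral_def V_def
    by (intro Bochner_Integration.integral_cong) (auto simp: sum_distrib_left mult.left_commute)
  also have "\<dots> = IV t \<omega>"
    unfolding IV_def \<Lambda>_def set_lebesgue_integral_def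
    by (subst Bochner_Integration.integral_sum[OF i]) simp
  finally show ?thesis by simp
qed

lemma C_pos: "0 < C"
  unfolding C_def using \<kappa>_pos \<zeta>_pos \<alpha>_pos by (intro mult_pos_pos sum_pos) auto

text \<open>By \<open>eig\<close> the weights \<open>\<kappa>\<close> turn the excitation matrix
  \<open>c\<close> into the scalar \<open>\<alpha> * r\<close>. As the weighted count has
  compensator \<open>IV\<close>, the mean of \<open>V\<close> feels the net damping
  \<open>\<alpha> * (1 - r)\<close>.\<close>

lemma V_equation:
  "AE \<omega> in P. \<forall>t\<ge>0. V t \<omega> + \<alpha> * IV t \<omega> = v + C * t + \<alpha> * r * (\<Sum>j\<in>UNIV. \<kappa> $ j * real (N j t \<omega>))"
proof -
  have "AE \<omega> in P. \<forall>t\<ge>0. \<forall>i. lam t \<omega> $ i = lam 0 \<omega> $ i - \<alpha> * (LBINT s:{0..t}. lam s \<omega> $ i - \<zeta> $ i)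
           + (\<Sum>j\<in>UNIV. c $ i $ j * real (N j t \<omega>))"
    using dyn unfolding hawkes_jump_diffusion_def by blast
  with start AE_space show ?thesis
  proof eventually_elim
    case (elim \<omega>)
    show ?case
    proof (intro allI impI)
      fix t :: real assume t: "0 \<le> t"
      have i: "(LBINT s:{0..t}. lam s \<omega> $ i - \<zeta> $ i) = \<Lambda> i t \<omega> - \<zeta> $ i * t" for i
      proof -
        have "(LBINT s:{0..t}. lam s \<omega> $ i - \<zeta> $ i) = \<Lambda> i t \<omega> - (LBINT s:{0..t}. \<zeta> $ i)"
          unfolding \<Lambda>_def
          by (intro set_integral_diff(2)[OF cadlag_set_integrable[OF lam_nth_cadlag[OF elim(2)]]
                borel_integrable_atLeastAtMost']) auto
        also have "(LBINT s:{0..t}. \<zeta> $ i) = \<zeta> $ i * t"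
          using t by (simp add: set_lebesgue_integral_def)
        finally show ?thesis .
      qed
      have l0: "lam 0 \<omega> = snd z" using elim(1) by (metis snd_conv)
      have "V t \<omega> = (\<Sum>i\<in>UNIV. \<kappa> $ i * (snd z $ i - \<alpha> * (\<Lambda> i t \<omega> - \<zeta> $ i * t)
           + (\<Sum>j\<in>UNIV. c $ i $ j * real (N j t \<omega>))))"
        unfolding V_def using elim(3)[rule_format, OF t] unfolding i l0 by simp
      also have "\<dots> = v - \<alpha> * IV t \<omega> + C * t + (\<Sum>i\<in>UNIV. \<kappa> $ i * (\<Sum>j\<in>UNIV. c $ i $ j * real (N j t \<omega>)))"
        unfolding v_def IV_def C_def
        by (simp add: algebra_simps sum.distrib sum_subtractf sum_distrib_left sum_distrib_right)
      also have "(\<Sum>i\<in>UNIV. \<kappa> $ i * (\<Sum>j\<in>UNIV. c $ i $ j * real (N j t \<omega>)))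
          = (\<Sum>j\<in>UNIV. (\<Sum>i\<in>UNIV. \<kappa> $ i * c $ i $ j) * real (N j t \<omega>))"
        unfolding sum_distrib_left sum_distrib_right by (subst sum.swap) (simp add: mult.assoc)
      also have "\<dots> = \<alpha> * r * (\<Sum>j\<in>UNIV. \<kappa> $ j * real (N j t \<omega>))"
        unfolding eig by (simp add: sum_distrib_left mult.assoc)
      finally show "V t \<omega> + \<alpha> * IV t \<omega> = v + C * t + \<alpha> * r * (\<Sum>j\<in>UNIV. \<kappa> $ j * real (N j t \<omega>))" by simp
    qed
  qed
qed

lemma Nt_mono: "\<omega> \<in> space P \<Longrightarrow> mono_on {0..} (\<lambda>t. Nt t \<omega>)"
  unfolding Nt_def by (intro mono_onI sum_mono mono_onD[OF N_mono]) auto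

lemma Nt_rc: "\<omega> \<in> space P \<Longrightarrow> 0 \<le> t \<Longrightarrow> \<forall>\<^sub>F s in at_right t. Nt s \<omega> = Nt t \<omega>"
proof -
  assume "\<omega> \<in> space P" "0 \<le> t"
  then have "\<forall>\<^sub>F s in at_right t. \<forall>i\<in>UNIV. N i s \<omega> = N i t \<omega>"
    using N_rc by (intro eventually_ball_finite) auto
  then show ?thesis unfolding Nt_def by eventually_elim simp
qed

text \<open>Localisation by the total number of jumps: as long as fewer than \<open>K\<close> jumps
  have occurred, \<open>V_equation\<close> bounds the intensities pathwise. The localising times
  hidden in \<open>has_intensity\<close> carry no such bound.\<close>

definition S :: "nat \<Rightarrow> real \<Rightarrow> 'w \<Rightarrow> real" where "S K t \<omega> = first_passage (\<lambda>s. Nt s \<omega>) K t"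

lemma S_bounds: "0 \<le> t \<Longrightarrow> 0 \<le> S K t \<omega>" "0 \<le> t \<Longrightarrow> S K t \<omega> \<le> t"
  unfolding S_def using first_passage_bounds by auto

lemma S_le_iff: "\<omega> \<in> space P \<Longrightarrow> 0 \<le> s \<Longrightarrow> s < t \<Longrightarrow> S K t \<omega> \<le> s \<longleftrightarrow> K \<le> Nt s \<omega>"
  unfolding S_def using Nt_mono Nt_rc by (intro first_passage_le_iff) auto

lemma S_event:
  assumes "0 \<le> s" "s < t" shows "{\<omega>\<in>space P. S K t \<omega> \<le> s} \<in> sets (F s)"
proof -
  have "Nt s \<in> measurable (F s) (count_space UNIV)"
    unfolding Nt_def using N_meas[OF assms(1)] by measurable
  then have "{\<omega>\<in>space (F s). K \<le> Nt s \<omega>} \<in> sets (F s)" by measurable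
  moreover have "{\<omega>\<in>space (F s). K \<le> Nt s \<omega>} = {\<omega>\<in>space P. S K t \<omega> \<le> s}"
    using S_le_iff[OF _ assms] filtered_prob_spaceD(2)[OF fps] by auto
  ultimately show ?thesis by simp
qed

lemma S_meas: assumes t: "0 \<le> t" shows "S K t \<in> borel_measurable P"
proof (rule borel_measurableI_le)
  fix s
  consider "s < 0" | "0 \<le> s" "s < t" | "t \<le> s" by linarith
  then show "{\<omega>\<in>space P. S K t \<omega> \<le> s} \<in> sets P"
  proof cases
    case 1
    then have "{\<omega>\<in>space P. S K t \<omega> \<le> s} = {}" using S_bounds(1)[OF t] by (auto simp: not_le intro: less_le_trans)
    then show ?thesis by (metis sets.empty_sets)
  next
    case 2
    then show ?thesis using S_event filtered_prob_spaceD(3)[OF fps] by blast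
  next
    case 3
    then have "{\<omega>\<in>space P. S K t \<omega> \<le> s} = space P" using S_bounds(2)[OF t] by (auto intro: order_trans)
    then show ?thesis by simp
  qed
qed

text \<open>Strictly before \<open>S K t\<close> each component has made fewer than \<open>K\<close>
  jumps, so \<open>V_equation\<close> bounds \<open>V\<close> by \<open>R\<close>, hence each
  intensity by \<open>R / \<kappa> $ j\<close>. At \<open>S K t\<close> itself a jump may break the
  bound, but a single time is a null set.\<close>

lemma \<Lambda>_S_bounded:
  assumes t: "0 \<le> t"
  obtains B where "0 \<le> B" "AE \<omega> in P. \<Lambda> j (S K t \<omega>) \<omega> \<le> B"
proof
  define R where "R = \<bar>v\<bar> + C * t + \<alpha> * r * (\<Sum>j\<in>UNIV. \<kappa> $ j * real K)"
  have R: "0 \<le> R" unfolding R_def using C_pos t \<alpha>_pos r_pos \<kappa>_pos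
    by (intro add_nonneg_nonneg mult_nonneg_nonneg sum_nonneg) (auto simp: less_imp_le)
  then show "0 \<le> R / \<kappa> $ j * t" using t \<kappa>_pos[of j] by simp
  show "AE \<omega> in P. \<Lambda> j (S K t \<omega>) \<omega> \<le> R / \<kappa> $ j * t"
    using V_equation AE_space
  proof eventually_elim
    case (elim \<omega>)
    have Vb: "lam s \<omega> $ j \<le> R / \<kappa> $ j" if s: "0 \<le> s" "s < S K t \<omega>" for s
    proof -
      have st: "s < t" using s S_bounds(2)[OF t, of K \<omega>] by simp
      have "Nt s \<omega> < K" using S_le_iff[OF elim(2) s(1) st, of K] s(2) by auto
      moreover have "N i s \<omega> \<le> Nt s \<omega>" for i unfolding Nt_def by (rule member_le_sum) auto
      ultimately have NK: "N i s \<omega> \<le> K" for i by (meson le_trans less_imp_le)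
      have "V s \<omega> \<le> V s \<omega> + \<alpha> * IV s \<omega>" using IV_nonneg[OF s(1) elim(2)] \<alpha>_pos by simp
      also have "\<dots> = v + C * s + \<alpha> * r * (\<Sum>j\<in>UNIV. \<kappa> $ j * real (N j s \<omega>))" using elim(1) s by blast
      also have "\<dots> \<le> R" unfolding R_def
        using st C_pos \<alpha>_pos r_pos \<kappa>_pos NK
        by (intro add_mono mult_left_mono sum_mono) (auto simp: less_imp_le)
      finally have "V s \<omega> \<le> R" .
      moreover have "\<kappa> $ j * lam s \<omega> $ j \<le> V s \<omega>"
        unfolding V_def using lam_nonneg[OF s(1) elim(2)] \<kappa>_pos
        by (intro member_le_sum) (auto simp: less_imp_le)
      ultimately show ?thesis using \<kappa>_pos[of j] by (simp add: field_simps)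
    qed
    have "\<Lambda> j (S K t \<omega>) \<omega> \<le> (LBINT s:{0..S K t \<omega>}. R / \<kappa> $ j)"
      unfolding \<Lambda>_def
    proof (rule set_integral_mono_AE[OF cadlag_set_integrable[OF lam_nth_cadlag[OF elim(2)]]])
      show "set_integrable lborel {0..S K t \<omega>} (\<lambda>s. R / \<kappa> $ j)"
        by (intro borel_integrable_atLeastAtMost') auto
      have "AE s in lborel. s \<noteq> S K t \<omega>" by (rule AE_lborel_singleton)
      then show "AE s\<in>{0..S K t \<omega>} in lborel. lam s \<omega> $ j \<le> R / \<kappa> $ j"
        by eventually_elim (auto intro: Vb)
    qed
    also have "\<dots> = R / \<kappa> $ j * S K t \<omega>"
      using S_bounds(1)[OF t, of K \<omega>] by (simp add: set_lebesgue_integral_def)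
    also have "\<dots> \<le> R / \<kappa> $ j * t"
      using S_bounds(2)[OF t] R \<kappa>_pos[of j] by (intro mult_left_mono) auto
    finally show ?case .
  qed
qed

text \<open>Two localisations are combined. The compensated count is known to be a martingale only
  when stopped at the unknown times \<open>T n\<close>; it is stopped once more at
  \<open>S K t\<close>, where the compensator is bounded and one-sided optional stopping applies.
  Fatou's lemma then lets \<open>n\<close> tend to infinity.\<close>

lemma N_S_le:
  assumes t: "0 \<le> t"
  shows "(\<integral>\<^sup>+\<omega>. ennreal (real (N j (S K t \<omega>) \<omega>)) \<partial>P) \<le> (\<integral>\<^sup>+\<omega>. ennreal (\<Lambda> j (S K t \<omega>) \<omega>) \<partial>P)"
proof -
  obtain B where B: "0 \<le> B" "AE \<omega> in P. \<Lambda> j (S K t \<omega>) \<omega> \<le> B" using \<Lambda>_S_bounded[OF t] by blast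
  obtain T where T: "\<And>n. stopping_time F (T n)"
    "\<And>n \<omega>. \<omega> \<in> space P \<Longrightarrow> 0 \<le> T n \<omega> \<and> T n \<omega> \<le> T (Suc n) \<omega>"
    "AE \<omega> in P. filterlim (\<lambda>n. T n \<omega>) at_top sequentially"
    "\<And>n. martingale P F (\<lambda>t \<omega>. real (N j (min t (T n \<omega>)) \<omega>) - \<Lambda> j (min t (T n \<omega>)) \<omega>)"
    using N_martingale[of j] unfolding local_martingale_def \<Lambda>_def by blast
  define \<tau> where "\<tau> n \<omega> = min (S K t \<omega>) (T n \<omega>)" for n \<omega>
  have T_meas: "T n \<in> borel_measurable P" for n
  proof (rule borel_measurableI_le)
    fix s
    have "{\<omega>\<in>space (F s). T n \<omega> \<le> s} \<in> sets (F s)"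
      using stopping_timeD[OF T(1)] by (simp add: pred_def)
    then show "{\<omega>\<in>space P. T n \<omega> \<le> s} \<in> sets P"
      using filtered_prob_spaceD(2,3)[OF fps] by auto
  qed
  have \<tau>: "\<tau> n \<in> borel_measurable P" "\<And>\<omega>. \<omega> \<in> space P \<Longrightarrow> 0 \<le> \<tau> n \<omega>" "\<And>\<omega>. \<tau> n \<omega> \<le> S K t \<omega>" for n
    unfolding \<tau>_def using S_meas[OF t] T_meas T(2) S_bounds(1)[OF t] by auto
  have N\<tau>: "(\<lambda>\<omega>. real (N j (\<tau> n \<omega>) \<omega>)) \<in> borel_measurable P" for n
    by (rule at_random_time[OF N_real_meas N_real_rc \<tau>(1,2)])
  have \<Lambda>\<tau>: "(\<lambda>\<omega>. \<Lambda> j (\<tau> n \<omega>) \<omega>) \<in> borel_measurable P" for n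
    by (rule at_random_time[OF \<Lambda>_meas \<Lambda>_rc \<tau>(1,2)])
  have \<Lambda>B: "AE \<omega> in P. \<Lambda> j (\<tau> n \<omega>) \<omega> \<le> B \<and> 0 \<le> \<Lambda> j (\<tau> n \<omega>) \<omega> \<and> \<Lambda> j (\<tau> n \<omega>) \<omega> \<le> \<Lambda> j (S K t \<omega>) \<omega>" for n
    using B(2) AE_space
  proof eventually_elim
    case (elim \<omega>)
    have "\<Lambda> j (\<tau> n \<omega>) \<omega> \<le> \<Lambda> j (S K t \<omega>) \<omega>" by (rule \<Lambda>_mono[OF elim(2) \<tau>(2)[OF elim(2)] \<tau>(3)])
    then show ?case using elim \<Lambda>_nonneg[OF elim(2) \<tau>(2)[OF elim(2)]] by auto
  qed
  have le: "(\<integral>\<^sup>+\<omega>. ennreal (real (N j (\<tau> n \<omega>) \<omega>)) \<partial>P) \<le> (\<integral>\<^sup>+\<omega>. ennreal (\<Lambda> j (S K t \<omega>) \<omega>) \<partial>P)" for n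
  proof -
    define Y where "Y s \<omega> = real (N j (min s (T n \<omega>)) \<omega>) - \<Lambda> j (min s (T n \<omega>)) \<omega>" for s \<omega>
    have YS: "Y (S K t \<omega>) \<omega> = real (N j (\<tau> n \<omega>) \<omega>) - \<Lambda> j (\<tau> n \<omega>) \<omega>" for \<omega>
      by (simp add: Y_def \<tau>_def)
    have "(\<integral>\<^sup>+\<omega>. ennreal (Y (S K t \<omega>) \<omega> + B) \<partial>P) \<le> ennreal ((\<integral>\<omega>. Y 0 \<omega> \<partial>P) + B)"
    proof (rule martingale_optional_stopping_le(2)[OF fps _ _ t])
      show "martingale P F Y" unfolding Y_def[abs_def] by (rule T(4))
      show "((\<lambda>u. Y u \<omega>) \<longlongrightarrow> Y s \<omega>) (at_right s)" if "\<omega> \<in> space P" "0 \<le> s" for \<omega> s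
        unfolding Y_def using that
        by (intro right_continuous_min[where f="\<lambda>u. real (N j u \<omega>) - \<Lambda> j u \<omega>"] tendsto_diff N_real_rc \<Lambda>_rc)
      show "AE \<omega> in P. - B \<le> Y (S K t \<omega>) \<omega>"
        using \<Lambda>B[of n] by eventually_elim (simp add: YS)
    qed (use S_bounds[OF t] S_event in auto)
    also have "(\<integral>\<omega>. Y 0 \<omega> \<partial>P) = (\<integral>\<omega>. 0 \<partial>P)"
      using T(2) N_0 by (intro Bochner_Integration.integral_cong) (auto simp: Y_def min_absorb1 \<Lambda>_0)
    finally have 1: "(\<integral>\<^sup>+\<omega>. ennreal (Y (S K t \<omega>) \<omega> + B) \<partial>P) \<le> ennreal B" by simp
    have "(\<integral>\<^sup>+\<omega>. ennreal (Y (S K t \<omega>) \<omega> + B) \<partial>P)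
        = (\<integral>\<^sup>+\<omega>. ennreal (real (N j (\<tau> n \<omega>) \<omega>)) + ennreal (B - \<Lambda> j (\<tau> n \<omega>) \<omega>) \<partial>P)"
      by (rule nn_integral_cong_AE, use \<Lambda>B[of n] in eventually_elim)
        (auto simp: YS ennreal_plus[symmetric] algebra_simps simp del: ennreal_plus)
    also have "\<dots> = (\<integral>\<^sup>+\<omega>. ennreal (real (N j (\<tau> n \<omega>) \<omega>)) \<partial>P) + (\<integral>\<^sup>+\<omega>. ennreal (B - \<Lambda> j (\<tau> n \<omega>) \<omega>) \<partial>P)"
      using N\<tau> \<Lambda>\<tau> by (intro nn_integral_add) auto
    finally have 2: "(\<integral>\<^sup>+\<omega>. ennreal (real (N j (\<tau> n \<omega>) \<omega>)) \<partial>P) + (\<integral>\<^sup>+\<omega>. ennreal (B - \<Lambda> j (\<tau> n \<omega>) \<omega>) \<partial>P) \<le> ennreal B"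
      using 1 by simp
    have "(\<integral>\<^sup>+\<omega>. ennreal (\<Lambda> j (\<tau> n \<omega>) \<omega>) \<partial>P) + (\<integral>\<^sup>+\<omega>. ennreal (B - \<Lambda> j (\<tau> n \<omega>) \<omega>) \<partial>P)
        = (\<integral>\<^sup>+\<omega>. ennreal (\<Lambda> j (\<tau> n \<omega>) \<omega>) + ennreal (B - \<Lambda> j (\<tau> n \<omega>) \<omega>) \<partial>P)"
      using \<Lambda>\<tau> by (intro nn_integral_add[symmetric]) auto
    also have "\<dots> = (\<integral>\<^sup>+\<omega>. ennreal B \<partial>P)"
      by (rule nn_integral_cong_AE, use \<Lambda>B[of n] in eventually_elim)
        (auto simp: ennreal_plus[symmetric] simp del: ennreal_plus)
    also have "\<dots> = ennreal B" by (simp add: emeasure_space_1)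
    finally have 3: "(\<integral>\<^sup>+\<omega>. ennreal (\<Lambda> j (\<tau> n \<omega>) \<omega>) \<partial>P) + (\<integral>\<^sup>+\<omega>. ennreal (B - \<Lambda> j (\<tau> n \<omega>) \<omega>) \<partial>P) = ennreal B" .
    \<comment> \<open>The same finite complement \<open>B - \<Lambda>\<close> stands beside the
      count in \<open>2\<close> and beside the compensator in \<open>3\<close>, so it cancels
      without any subtraction of possibly infinite means.\<close>
    have fin: "(\<integral>\<^sup>+\<omega>. ennreal (B - \<Lambda> j (\<tau> n \<omega>) \<omega>) \<partial>P) \<noteq> top"
      using 3 by (metis ennreal_add_eq_top ennreal_neq_top)
    have "(\<integral>\<^sup>+\<omega>. ennreal (real (N j (\<tau> n \<omega>) \<omega>)) \<partial>P) \<le> (\<integral>\<^sup>+\<omega>. ennreal (\<Lambda> j (\<tau> n \<omega>) \<omega>) \<partial>P)"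
      using 2 fin unfolding 3[symmetric] add.commute[of _ "\<integral>\<^sup>+\<omega>. ennreal (B - \<Lambda> j (\<tau> n \<omega>) \<omega>) \<partial>P"]
      by (simp add: ennreal_add_left_cancel_le)
    also have "\<dots> \<le> (\<integral>\<^sup>+\<omega>. ennreal (\<Lambda> j (S K t \<omega>) \<omega>) \<partial>P)"
      by (rule nn_integral_mono_AE, use \<Lambda>B[of n] in eventually_elim) (auto intro: ennreal_leI)
    finally show ?thesis .
  qed
  have "(\<integral>\<^sup>+\<omega>. ennreal (real (N j (S K t \<omega>) \<omega>)) \<partial>P)
      = (\<integral>\<^sup>+\<omega>. liminf (\<lambda>n. ennreal (real (N j (\<tau> n \<omega>) \<omega>))) \<partial>P)"
  proof (rule nn_integral_cong_AE, use T(3) in eventually_elim)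
    case (elim \<omega>)
    have "\<forall>\<^sub>F n in sequentially. S K t \<omega> \<le> T n \<omega>"
      using elim by (auto simp: filterlim_at_top)
    then have "\<forall>\<^sub>F n in sequentially. ennreal (real (N j (\<tau> n \<omega>) \<omega>)) = ennreal (real (N j (S K t \<omega>) \<omega>))"
      by eventually_elim (simp add: \<tau>_def min_def)
    then show ?case by (intro lim_imp_Liminf[OF _ tendsto_eventually, symmetric]) simp_all
  qed
  also have "\<dots> \<le> liminf (\<lambda>n. \<integral>\<^sup>+\<omega>. ennreal (real (N j (\<tau> n \<omega>) \<omega>)) \<partial>P)"
    using N\<tau> by (intro nn_integral_liminf) auto
  also have "\<dots> \<le> (\<integral>\<^sup>+\<omega>. ennreal (\<Lambda> j (S K t \<omega>) \<omega>) \<partial>P)"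
    by (rule Liminf_le) (simp_all add: le)
  finally show ?thesis .
qed

lemma S_eventually:
  assumes "\<omega> \<in> space P" "0 \<le> t" shows "\<forall>\<^sub>F K in sequentially. S K t \<omega> = t"
  using eventually_gt_at_top[of "Nt t \<omega>"]
  by eventually_elim (auto simp: S_def intro!: first_passage_eq Nt_mono assms)

lemma v_nonneg: "0 \<le> v"
proof -
  have "AE \<omega> in P. 0 \<le> v"
    using start AE_space
  proof eventually_elim
    case (elim \<omega>)
    then have "lam 0 \<omega> = snd z" by auto
    then show ?case using V_nonneg[of 0 \<omega>] elim unfolding V_def v_def by simp
  qed
  then show ?thesis by simp
qed

lemma nn_integral_weighted_sum:
  assumes "\<And>j. f j \<in> borel_measurable P" "\<And>j \<omega>. \<omega> \<in> space P \<Longrightarrow> 0 \<le> f j \<omega>"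
  shows "(\<integral>\<^sup>+\<omega>. ennreal (\<Sum>j\<in>UNIV. \<kappa> $ j * f j \<omega>) \<partial>P) = (\<Sum>j\<in>UNIV. ennreal (\<kappa> $ j) * (\<integral>\<^sup>+\<omega>. ennreal (f j \<omega>) \<partial>P))"
proof -
  have "(\<integral>\<^sup>+\<omega>. ennreal (\<Sum>j\<in>UNIV. \<kappa> $ j * f j \<omega>) \<partial>P)
      = (\<integral>\<^sup>+\<omega>. (\<Sum>j\<in>UNIV. ennreal (\<kappa> $ j) * ennreal (f j \<omega>)) \<partial>P)"
    using assms(2) \<kappa>_pos by (intro nn_integral_cong) (simp add: sum_ennreal[symmetric] ennreal_mult less_imp_le)
  also have "\<dots> = (\<Sum>j\<in>UNIV. ennreal (\<kappa> $ j) * (\<integral>\<^sup>+\<omega>. ennreal (f j \<omega>) \<partial>P))"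
    using assms(1) by (subst nn_integral_sum) (auto simp: nn_integral_cmult)
  finally show ?thesis .
qed

text \<open>Taking means in \<open>V_equation\<close> and applying \<open>N_S_le\<close> leaves
  \<open>\<alpha> * r\<close> times the mean of \<open>IV\<close> on the right, against
  \<open>\<alpha>\<close> times it on the left. Stopping at \<open>S K t\<close> makes this mean
  finite, so that it can be subtracted.\<close>

lemma V_S_le:
  assumes t: "0 \<le> t"
  shows "(\<integral>\<^sup>+\<omega>. ennreal (V (S K t \<omega>) \<omega> + \<alpha> * (1 - r) * IV (S K t \<omega>) \<omega>) \<partial>P) \<le> ennreal (v + C * t)"
proof -
  let ?S = "S K t"
  note S = S_meas[OF t] S_bounds[OF t]
  have m\<Lambda>: "(\<lambda>\<omega>. \<Lambda> j (?S \<omega>) \<omega>) \<in> borel_measurable P" for j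
    by (rule at_random_time[OF \<Lambda>_meas \<Lambda>_rc]) (use S in auto)
  have mN: "(\<lambda>\<omega>. real (N j (?S \<omega>) \<omega>)) \<in> borel_measurable P" for j
    by (rule at_random_time[OF N_real_meas N_real_rc]) (use S in auto)
  have ml: "(\<lambda>\<omega>. lam (?S \<omega>) \<omega> $ j) \<in> borel_measurable P" for j
  proof (rule at_random_time[where Y="\<lambda>s \<omega>. lam s \<omega> $ j", OF _ _ S(1,2)])
    show "(\<lambda>\<omega>. lam s \<omega> $ j) \<in> borel_measurable P" if "0 \<le> s" for s
      by (rule filtered_measurable_P[OF fps lam_nth_meas[OF that]])
    show "((\<lambda>u. lam u \<omega> $ j) \<longlongrightarrow> lam s \<omega> $ j) (at_right s)" if "\<omega> \<in> space P" "0 \<le> s" for \<omega> s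
      using lam_nth_cadlag[OF that(1), of j] that(2) unfolding cadlag_def by blast
  qed
  have mV: "(\<lambda>\<omega>. V (?S \<omega>) \<omega>) \<in> borel_measurable P" unfolding V_def using ml by simp
  have mI: "(\<lambda>\<omega>. IV (?S \<omega>) \<omega>) \<in> borel_measurable P" unfolding IV_def using m\<Lambda> by simp
  define L where "L = (\<integral>\<^sup>+\<omega>. ennreal (IV (?S \<omega>) \<omega>) \<partial>P)"
  have L: "L = (\<Sum>j\<in>UNIV. ennreal (\<kappa> $ j) * (\<integral>\<^sup>+\<omega>. ennreal (\<Lambda> j (?S \<omega>) \<omega>) \<partial>P))"
    unfolding L_def IV_def using m\<Lambda> \<Lambda>_nonneg S by (intro nn_integral_weighted_sum) auto
  have "(\<integral>\<^sup>+\<omega>. ennreal (\<Lambda> j (?S \<omega>) \<omega>) \<partial>P) < top" for j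
  proof -
    obtain B where B: "0 \<le> B" "AE \<omega> in P. \<Lambda> j (?S \<omega>) \<omega> \<le> B" using \<Lambda>_S_bounded[OF t] by blast
    have "(\<integral>\<^sup>+\<omega>. ennreal (\<Lambda> j (?S \<omega>) \<omega>) \<partial>P) \<le> (\<integral>\<^sup>+\<omega>. ennreal B \<partial>P)"
      by (rule nn_integral_mono_AE, use B(2) in eventually_elim) (rule ennreal_leI)
    also have "\<dots> < top" by (simp add: emeasure_space_1)
    finally show ?thesis .
  qed
  then have Lfin: "L < top" unfolding L by (simp add: ennreal_mult_less_top)
  have "(\<integral>\<^sup>+\<omega>. ennreal (V (?S \<omega>) \<omega> + \<alpha> * (1 - r) * IV (?S \<omega>) \<omega>) \<partial>P) + ennreal (\<alpha> * r) * L
      = (\<integral>\<^sup>+\<omega>. ennreal (V (?S \<omega>) \<omega> + \<alpha> * (1 - r) * IV (?S \<omega>) \<omega>) + ennreal (\<alpha> * r) * ennreal (IV (?S \<omega>) \<omega>) \<partial>P)"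
    unfolding L_def using mV mI by (simp add: nn_integral_add nn_integral_cmult)
  also have "\<dots> = (\<integral>\<^sup>+\<omega>. ennreal (v + C * ?S \<omega>) + ennreal (\<alpha> * r) * ennreal (\<Sum>j\<in>UNIV. \<kappa> $ j * real (N j (?S \<omega>) \<omega>)) \<partial>P)"
  proof (rule nn_integral_cong_AE)
    show "AE \<omega> in P. ennreal (V (?S \<omega>) \<omega> + \<alpha> * (1 - r) * IV (?S \<omega>) \<omega>) + ennreal (\<alpha> * r) * ennreal (IV (?S \<omega>) \<omega>)
      = ennreal (v + C * ?S \<omega>) + ennreal (\<alpha> * r) * ennreal (\<Sum>j\<in>UNIV. \<kappa> $ j * real (N j (?S \<omega>) \<omega>))"
      using V_equation AE_space
    proof eventually_elim
      case (elim \<omega>)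
      have nn: "0 \<le> V (?S \<omega>) \<omega>" "0 \<le> IV (?S \<omega>) \<omega>" using V_nonneg IV_nonneg elim(2) S by auto
      have nn2: "0 \<le> (\<Sum>j\<in>UNIV. \<kappa> $ j * real (N j (?S \<omega>) \<omega>))"
        using \<kappa>_pos by (intro sum_nonneg) (auto simp: less_imp_le)
      have "ennreal (V (?S \<omega>) \<omega> + \<alpha> * (1 - r) * IV (?S \<omega>) \<omega>) + ennreal (\<alpha> * r) * ennreal (IV (?S \<omega>) \<omega>)
          = ennreal (V (?S \<omega>) \<omega> + \<alpha> * (1 - r) * IV (?S \<omega>) \<omega> + (\<alpha> * r) * IV (?S \<omega>) \<omega>)"
        using nn \<alpha>_pos r_pos r_less by (simp add: ennreal_mult[symmetric] ennreal_plus[symmetric] del: ennreal_plus)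
      also have "V (?S \<omega>) \<omega> + \<alpha> * (1 - r) * IV (?S \<omega>) \<omega> + (\<alpha> * r) * IV (?S \<omega>) \<omega> = V (?S \<omega>) \<omega> + \<alpha> * IV (?S \<omega>) \<omega>"
        by (simp add: algebra_simps)
      also have "\<dots> = v + C * ?S \<omega> + (\<alpha> * r) * (\<Sum>j\<in>UNIV. \<kappa> $ j * real (N j (?S \<omega>) \<omega>))"
        using elim(1) S by blast
      also have "ennreal \<dots> = ennreal (v + C * ?S \<omega>) + ennreal (\<alpha> * r) * ennreal (\<Sum>j\<in>UNIV. \<kappa> $ j * real (N j (?S \<omega>) \<omega>))"
        using nn2 \<alpha>_pos r_pos v_nonneg C_pos S by (simp add: ennreal_mult[symmetric] ennreal_plus[symmetric] del: ennreal_plus)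
      finally show ?case .
    qed
  qed
  also have "\<dots> = (\<integral>\<^sup>+\<omega>. ennreal (v + C * ?S \<omega>) \<partial>P)
      + ennreal (\<alpha> * r) * (\<integral>\<^sup>+\<omega>. ennreal (\<Sum>j\<in>UNIV. \<kappa> $ j * real (N j (?S \<omega>) \<omega>)) \<partial>P)"
    using mN S(1) by (simp add: nn_integral_add nn_integral_cmult)
  also have "\<dots> \<le> ennreal (v + C * t) + ennreal (\<alpha> * r) * L"
  proof (rule add_mono)
    have "(\<integral>\<^sup>+\<omega>. ennreal (v + C * ?S \<omega>) \<partial>P) \<le> (\<integral>\<^sup>+\<omega>. ennreal (v + C * t) \<partial>P)"
      using S C_pos by (intro nn_integral_mono ennreal_leI add_left_mono mult_left_mono) auto
    then show "(\<integral>\<^sup>+\<omega>. ennreal (v + C * ?S \<omega>) \<partial>P) \<le> ennreal (v + C * t)" by (simp add: emeasure_space_1)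
    show "ennreal (\<alpha> * r) * (\<integral>\<^sup>+\<omega>. ennreal (\<Sum>j\<in>UNIV. \<kappa> $ j * real (N j (?S \<omega>) \<omega>)) \<partial>P) \<le> ennreal (\<alpha> * r) * L"
      unfolding L
      by (subst nn_integral_weighted_sum[OF mN]) (simp_all add: mult_left_mono sum_mono N_S_le t)
  qed
  finally have "ennreal (\<alpha> * r) * L + (\<integral>\<^sup>+\<omega>. ennreal (V (?S \<omega>) \<omega> + \<alpha> * (1 - r) * IV (?S \<omega>) \<omega>) \<partial>P)
      \<le> ennreal (\<alpha> * r) * L + ennreal (v + C * t)" by (simp only: add.commute)
  then show ?thesis using Lfin unfolding ennreal_add_left_cancel_le
    by (auto simp: ennreal_mult_eq_top_iff)
qed

section \<open>Mean intensity and mean number of jumps without localisation\<close>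

text \<open>On each path \<open>S K t = t\<close> once \<open>K\<close> exceeds the number of jumps
  up to \<open>t\<close>, so Fatou's lemma removes the localisation.\<close>

lemma V_le:
  assumes t: "0 \<le> t"
  shows "(\<integral>\<^sup>+\<omega>. ennreal (V t \<omega> + \<alpha> * (1 - r) * IV t \<omega>) \<partial>P) \<le> ennreal (v + C * t)"
proof -
  let ?f = "\<lambda>s \<omega>. V s \<omega> + \<alpha> * (1 - r) * IV s \<omega>"
  have m: "(\<lambda>\<omega>. ?f (S K t \<omega>) \<omega>) \<in> borel_measurable P" for K
  proof (rule at_random_time[where Y="?f"])
    show "?f s \<in> borel_measurable P" if "0 \<le> s" for s
      unfolding V_def IV_def using filtered_measurable_P[OF fps lam_nth_meas[OF that]] \<Lambda>_meas by simp
    show "((\<lambda>u. ?f u \<omega>) \<longlongrightarrow> ?f s \<omega>) (at_right s)" if "\<omega> \<in> space P" "0 \<le> s" for \<omega> s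
      unfolding V_def IV_def using that lam_nth_cadlag[OF that(1)]
      by (intro tendsto_add tendsto_sum tendsto_mult tendsto_const \<Lambda>_rc) (auto simp: cadlag_def)
  qed (use S_meas S_bounds t in auto)
  have "(\<integral>\<^sup>+\<omega>. ennreal (?f t \<omega>) \<partial>P) = (\<integral>\<^sup>+\<omega>. liminf (\<lambda>K. ennreal (?f (S K t \<omega>) \<omega>)) \<partial>P)"
  proof (rule nn_integral_cong)
    fix \<omega> assume "\<omega> \<in> space P"
    from S_eventually[OF this t] have "\<forall>\<^sub>F K in sequentially. ennreal (?f (S K t \<omega>) \<omega>) = ennreal (?f t \<omega>)"
      by eventually_elim simp
    then show "ennreal (?f t \<omega>) = liminf (\<lambda>K. ennreal (?f (S K t \<omega>) \<omega>))"
      by (intro lim_imp_Liminf[OF _ tendsto_eventually, symmetric]) simp_all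
  qed
  also have "\<dots> \<le> liminf (\<lambda>K. \<integral>\<^sup>+\<omega>. ennreal (?f (S K t \<omega>) \<omega>) \<partial>P)"
    using m by (intro nn_integral_liminf) auto
  also have "\<dots> \<le> ennreal (v + C * t)"
    by (rule Liminf_le) (simp_all add: V_S_le t)
  finally show ?thesis .
qed

lemma V_mean_le:
  assumes t: "0 \<le> t" shows "(\<integral>\<^sup>+\<omega>. ennreal (V t \<omega>) \<partial>P) \<le> ennreal (v + C * t)"
proof -
  have "(\<integral>\<^sup>+\<omega>. ennreal (V t \<omega>) \<partial>P) \<le> (\<integral>\<^sup>+\<omega>. ennreal (V t \<omega> + \<alpha> * (1 - r) * IV t \<omega>) \<partial>P)"
    using IV_nonneg[OF t] \<alpha>_pos r_less by (intro nn_integral_mono ennreal_leI) auto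
  with V_le[OF t] show ?thesis by simp
qed

lemma N_le:
  assumes t: "0 \<le> t"
  shows "(\<integral>\<^sup>+\<omega>. ennreal (real (N j t \<omega>)) \<partial>P) \<le> (\<integral>\<^sup>+\<omega>. ennreal (\<Lambda> j t \<omega>) \<partial>P)"
proof -
  have m: "(\<lambda>\<omega>. real (N j (S K t \<omega>) \<omega>)) \<in> borel_measurable P" for K
    by (rule at_random_time[OF N_real_meas N_real_rc]) (use S_meas S_bounds t in auto)
  have "(\<integral>\<^sup>+\<omega>. ennreal (real (N j t \<omega>)) \<partial>P) = (\<integral>\<^sup>+\<omega>. liminf (\<lambda>K. ennreal (real (N j (S K t \<omega>) \<omega>))) \<partial>P)"
  proof (rule nn_integral_cong)
    fix \<omega> assume "\<omega> \<in> space P"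
    from S_eventually[OF this t] have "\<forall>\<^sub>F K in sequentially. ennreal (real (N j (S K t \<omega>) \<omega>)) = ennreal (real (N j t \<omega>))"
      by eventually_elim simp
    then show "ennreal (real (N j t \<omega>)) = liminf (\<lambda>K. ennreal (real (N j (S K t \<omega>) \<omega>)))"
      by (intro lim_imp_Liminf[OF _ tendsto_eventually, symmetric]) simp_all
  qed
  also have "\<dots> \<le> liminf (\<lambda>K. \<integral>\<^sup>+\<omega>. ennreal (real (N j (S K t \<omega>) \<omega>)) \<partial>P)"
    using m by (intro nn_integral_liminf) auto
  also have "\<dots> \<le> (\<integral>\<^sup>+\<omega>. ennreal (\<Lambda> j t \<omega>) \<partial>P)"
  proof (rule Liminf_le)
    have "(\<integral>\<^sup>+\<omega>. ennreal (real (N j (S K t \<omega>) \<omega>)) \<partial>P) \<le> (\<integral>\<^sup>+\<omega>. ennreal (\<Lambda> j t \<omega>) \<partial>P)" for K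
    proof -
      have "(\<integral>\<^sup>+\<omega>. ennreal (\<Lambda> j (S K t \<omega>) \<omega>) \<partial>P) \<le> (\<integral>\<^sup>+\<omega>. ennreal (\<Lambda> j t \<omega>) \<partial>P)"
        using S_bounds t by (intro nn_integral_mono ennreal_leI \<Lambda>_mono) auto
      then show ?thesis using N_S_le[OF t, of j K] by simp
    qed
    then show "\<forall>\<^sub>F K in sequentially. (\<integral>\<^sup>+\<omega>. ennreal (real (N j (S K t \<omega>) \<omega>)) \<partial>P) \<le> (\<integral>\<^sup>+\<omega>. ennreal (\<Lambda> j t \<omega>) \<partial>P)"
      by simp
  qed simp
  finally show ?thesis .
qed

text \<open>The intensity is at most \<open>V / \<kappa> $ j\<close>, whose mean is bounded on
  \<open>[0, t]\<close>. The factor \<open>t\<close> is what makes a jump improbable in short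
  time.\<close>

lemma N_mean_le:
  assumes t: "0 \<le> t"
  shows "(\<integral>\<^sup>+\<omega>. ennreal (real (N j t \<omega>)) \<partial>P) \<le> ennreal (t * ((v + C * t) / \<kappa> $ j))"
proof -
  let ?g = "\<lambda>\<omega> s. ennreal (lam s \<omega> $ j) * indicator {0..t} s"
  have "(\<integral>\<^sup>+\<omega>. ennreal (\<Lambda> j t \<omega>) \<partial>P) = (\<integral>\<^sup>+\<omega>. (\<integral>\<^sup>+s. ?g \<omega> s \<partial>lborel) \<partial>P)"
  proof (rule nn_integral_cong)
    fix \<omega> assume w: "\<omega> \<in> space P"
    have i: "integrable lborel (\<lambda>s. indicator {0..t} s *\<^sub>R lam s \<omega> $ j)"
      using cadlag_set_integrable[OF lam_nth_cadlag[OF w]] unfolding set_integrable_def by simp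
    have "ennreal (\<Lambda> j t \<omega>) = (\<integral>\<^sup>+s. ennreal (indicator {0..t} s *\<^sub>R lam s \<omega> $ j) \<partial>lborel)"
      unfolding \<Lambda>_def set_lebesgue_integral_def using lam_nonneg[OF _ w]
      by (intro nn_integral_eq_integral[OF i, symmetric]) (auto simp: indicator_def)
    also have "\<dots> = (\<integral>\<^sup>+s. ?g \<omega> s \<partial>lborel)"
      by (intro nn_integral_cong) (auto simp: indicator_def max_def)
    finally show "ennreal (\<Lambda> j t \<omega>) = (\<integral>\<^sup>+s. ?g \<omega> s \<partial>lborel)" .
  qed
  also have "\<dots> = (\<integral>\<^sup>+s. (\<integral>\<^sup>+\<omega>. ?g \<omega> s \<partial>P) \<partial>lborel)"
  proof -
    have "(\<lambda>s. (\<integral>\<^sup>+\<omega>. ?g \<omega> s \<partial>P)) = (\<lambda>s. (\<integral>\<^sup>+\<omega>. ennreal (lam s \<omega> $ j) \<partial>P) * indicator {0..t} s)"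
      by (auto simp: indicator_def)
    then show ?thesis using path_nn_integral(2)[OF lam_joint[of j], where t=t] by simp
  qed
  also have "\<dots> \<le> (\<integral>\<^sup>+s. ennreal ((v + C * t) / \<kappa> $ j) * indicator {0..t} s \<partial>lborel)"
  proof (rule nn_integral_mono)
    fix s :: real
    show "(\<integral>\<^sup>+\<omega>. ?g \<omega> s \<partial>P) \<le> ennreal ((v + C * t) / \<kappa> $ j) * indicator {0..t} s"
    proof (cases "s \<in> {0..t}")
      case True
      then have s: "0 \<le> s" "s \<le> t" by auto
      have "(\<integral>\<^sup>+\<omega>. ?g \<omega> s \<partial>P) \<le> (\<integral>\<^sup>+\<omega>. ennreal (1 / \<kappa> $ j) * ennreal (V s \<omega>) \<partial>P)"
      proof (rule nn_integral_mono)
        fix \<omega> assume w: "\<omega> \<in> space P"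
        have "\<kappa> $ j * lam s \<omega> $ j \<le> V s \<omega>"
          unfolding V_def using lam_nonneg[OF s(1) w] \<kappa>_pos
          by (intro member_le_sum) (auto simp: less_imp_le)
        then have "lam s \<omega> $ j \<le> 1 / \<kappa> $ j * V s \<omega>" using \<kappa>_pos[of j] by (simp add: field_simps)
        then have "ennreal (lam s \<omega> $ j) \<le> ennreal (1 / \<kappa> $ j) * ennreal (V s \<omega>)"
          using \<kappa>_pos[of j] V_nonneg[OF s(1) w] by (subst ennreal_mult[symmetric]) (auto intro: ennreal_leI)
        then show "?g \<omega> s \<le> ennreal (1 / \<kappa> $ j) * ennreal (V s \<omega>)" using True by simp
      qed
      also have "\<dots> = ennreal (1 / \<kappa> $ j) * (\<integral>\<^sup>+\<omega>. ennreal (V s \<omega>) \<partial>P)"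
        using filtered_measurable_P[OF fps lam_nth_meas[OF s(1)]] unfolding V_def
        by (intro nn_integral_cmult) simp
      also have "\<dots> \<le> ennreal (1 / \<kappa> $ j) * ennreal (v + C * t)"
        using V_mean_le[OF s(1)] s C_pos
        by (intro mult_left_mono order_trans[OF V_mean_le[OF s(1)]] ennreal_leI) auto
      also have "\<dots> = ennreal ((v + C * t) / \<kappa> $ j)"
        using \<kappa>_pos[of j] v_nonneg C_pos t by (subst ennreal_mult[symmetric]) auto
      finally show ?thesis using True by simp
    qed simp
  qed
  also have "\<dots> = ennreal (t * ((v + C * t) / \<kappa> $ j))"
    using t \<kappa>_pos[of j] v_nonneg C_pos
    by (subst nn_integral_cmult_indicator) (simp_all add: ennreal_mult[symmetric] mult.commute)
  finally show ?thesis using N_le[OF t, of j] by simp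
qed

text \<open>Only the damping lowers \<open>V\<close>, so
  \<open>V s \<ge> v - \<alpha> * IV 1\<close> throughout \<open>[0, 1]\<close>. Integrating over
  \<open>s\<close> gives \<open>IV 1 \<ge> v / (1 + \<alpha>)\<close>, and the term with
  \<open>IV\<close> in \<open>V_le\<close> becomes a loss proportional to \<open>v\<close>.\<close>

lemma V_contraction:
  "(\<integral>\<^sup>+\<omega>. ennreal (V 1 \<omega>) \<partial>P) \<le> ennreal ((1 - \<alpha> * (1 - r) / (1 + \<alpha>)) * v + C)"
proof -
  define d where "d = \<alpha> * (1 - r) / (1 + \<alpha>) * v"
  have "AE \<omega> in P. v / (1 + \<alpha>) \<le> IV 1 \<omega>"
    using V_equation AE_space
  proof eventually_elim
    case (elim \<omega>)
    have IVm: "IV s \<omega> \<le> IV 1 \<omega>" if "0 \<le> s" "s \<le> 1" for s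
      unfolding IV_def using \<kappa>_pos \<Lambda>_mono[OF elim(2) that]
      by (intro sum_mono mult_left_mono) (auto simp: less_imp_le)
    have Vl: "v - \<alpha> * IV 1 \<omega> \<le> V s \<omega>" if s: "0 \<le> s" "s \<le> 1" for s
    proof -
      have "0 \<le> (\<Sum>j\<in>UNIV. \<kappa> $ j * real (N j s \<omega>))"
        using \<kappa>_pos by (intro sum_nonneg) (auto simp: less_imp_le)
      then have "0 \<le> \<alpha> * r * (\<Sum>j\<in>UNIV. \<kappa> $ j * real (N j s \<omega>))"
        using \<alpha>_pos r_pos by (intro mult_nonneg_nonneg) auto
      moreover have "0 \<le> C * s" using C_pos s by simp
      moreover have "\<alpha> * IV s \<omega> \<le> \<alpha> * IV 1 \<omega>" using IVm[OF s] \<alpha>_pos by simp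
      moreover have "V s \<omega> + \<alpha> * IV s \<omega> = v + C * s + \<alpha> * r * (\<Sum>j\<in>UNIV. \<kappa> $ j * real (N j s \<omega>))"
        using elim(1) s by blast
      ultimately show ?thesis by linarith
    qed
    have iV: "set_integrable lborel {0..1} (\<lambda>s. V s \<omega>)"
    proof -
      have "cadlag (\<lambda>t. \<Sum>i\<in>UNIV. \<kappa> $ i * lam t \<omega> $ i)"
        by (rule cadlag_continuous_compose[OF lam_cadlag[OF elim(2)], of "\<lambda>x. \<Sum>i\<in>UNIV. \<kappa> $ i * x $ i"])
          (intro continuous_intros)
      then show ?thesis unfolding V_def by (rule cadlag_set_integrable)
    qed
    have "v - \<alpha> * IV 1 \<omega> = (LBINT s:{0..1::real}. v - \<alpha> * IV 1 \<omega>)"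
      by (simp add: set_lebesgue_integral_def)
    also have "\<dots> \<le> (LBINT s:{0..1}. V s \<omega>)"
      by (intro set_integral_mono borel_integrable_atLeastAtMost' iV Vl) auto
    also have "\<dots> = IV 1 \<omega>" using IV_eq[OF elim(2)] by simp
    finally show ?case using \<alpha>_pos by (simp add: field_simps)
  qed
  then have "AE \<omega> in P. ennreal (V 1 \<omega>) + ennreal d \<le> ennreal (V 1 \<omega> + \<alpha> * (1 - r) * IV 1 \<omega>)"
    using AE_space
  proof eventually_elim
    case (elim \<omega>)
    have "\<alpha> * (1 - r) * (v / (1 + \<alpha>)) \<le> \<alpha> * (1 - r) * IV 1 \<omega>"
      using elim(1) \<alpha>_pos r_less by (intro mult_left_mono) auto
    then have "V 1 \<omega> + d \<le> V 1 \<omega> + \<alpha> * (1 - r) * IV 1 \<omega>" by (simp add: d_def)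
    moreover have "0 \<le> d" unfolding d_def using \<alpha>_pos r_less v_nonneg by simp
    ultimately show ?case using ennreal_plus[of "V 1 \<omega>" d] V_nonneg[of 1 \<omega>] elim(2)
      by (metis ennreal_leI zero_le_one)
  qed
  then have "(\<integral>\<^sup>+\<omega>. ennreal (V 1 \<omega>) + ennreal d \<partial>P) \<le> ennreal (v + C * 1)"
    by (rule order_trans[OF nn_integral_mono_AE V_le]) simp
  moreover have "(\<integral>\<^sup>+\<omega>. ennreal (V 1 \<omega>) + ennreal d \<partial>P) = (\<integral>\<^sup>+\<omega>. ennreal (V 1 \<omega>) \<partial>P) + ennreal d"
    using filtered_measurable_P[OF fps lam_nth_meas, of 1] unfolding V_def
    by (subst nn_integral_add) (auto simp: emeasure_space_1)
  ultimately have "ennreal d + (\<integral>\<^sup>+\<omega>. ennreal (V 1 \<omega>) \<partial>P) \<le> ennreal (v + C)" by (simp add: add.commute)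
  also have "ennreal (v + C) = ennreal d + ennreal ((1 - \<alpha> * (1 - r) / (1 + \<alpha>)) * v + C)"
  proof -
    have le: "\<alpha> * (1 - r) / (1 + \<alpha>) \<le> 1"
      using \<alpha>_pos r_pos by (simp add: field_simps)
    have "0 \<le> d" unfolding d_def using \<alpha>_pos r_less v_nonneg by simp
    moreover have "0 \<le> (1 - \<alpha> * (1 - r) / (1 + \<alpha>)) * v + C"
      using le v_nonneg C_pos by (intro add_nonneg_nonneg mult_nonneg_nonneg) auto
    moreover have "d + ((1 - \<alpha> * (1 - r) / (1 + \<alpha>)) * v + C) = v + C"
      unfolding d_def by (simp add: left_diff_distrib)
    ultimately show ?thesis by (metis ennreal_plus)
  qed
  finally show ?thesis by (simp add: ennreal_add_left_cancel_le)
qed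

end

section \<open>Ito integrals with bounded integrands\<close>

lemma normal_moments:
  assumes "prob_space P" and d: "distributed P lborel X (normal_density 0 s)" and s: "0 < s"
  shows "integrable P (\<lambda>\<omega>. X \<omega> ^ j)" "(\<integral>\<omega>. X \<omega> \<partial>P) = 0" "(\<integral>\<omega>. X \<omega> ^ 2 \<partial>P) = s\<^sup>2"
    "(\<integral>\<omega>. X \<omega> ^ 3 \<partial>P) = 0" "(\<integral>\<omega>. X \<omega> ^ 4 \<partial>P) = 3 * s ^ 4"
proof -
  have i: "(\<integral>\<omega>. X \<omega> ^ j \<partial>P) = (LBINT x. normal_density 0 s x * (x - 0) ^ j)" for j
    using distributed_integral[OF d, of "\<lambda>x. x ^ j"] by simp
  show "integrable P (\<lambda>\<omega>. X \<omega> ^ j)"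
    using distributed_integrable[OF d, of "\<lambda>x. x ^ j"] integrable_normal_moment[OF s, of 0 j] by simp
  show "(\<integral>\<omega>. X \<omega> \<partial>P) = 0"
    using i[of 1] integral_normal_moment_odd[OF s, of 0 0] by simp
  show "(\<integral>\<omega>. X \<omega> ^ 2 \<partial>P) = s\<^sup>2"
    using i[of 2] integral_normal_moment_even[OF s, of 0 1] by simp
  show "(\<integral>\<omega>. X \<omega> ^ 3 \<partial>P) = 0"
    using i[of 3] integral_normal_moment_odd[OF s, of 0 1] by (simp add: numeral_3_eq_3)
  show "(\<integral>\<omega>. X \<omega> ^ 4 \<partial>P) = 3 * s ^ 4"
    using i[of 4] integral_normal_moment_even[OF s, of 0 2]
    by (simp add: fact_numeral power_divide flip: power_mult)
qed

section \<open>Discrete stochastic integrals\<close>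

locale discrete_ito =
  fixes P :: "'w measure" and F :: "real \<Rightarrow> 'w measure" and W :: "real \<Rightarrow> 'w \<Rightarrow> real"
    and m :: nat and u :: "nat \<Rightarrow> real" and \<xi> :: "nat \<Rightarrow> 'w \<Rightarrow> real" and B :: real
  assumes fps: "filtered_prob_space P F" and bm: "standard_brownian_motion P F W"
    and u0: "0 \<le> u 0" and u_step: "\<And>k. k < m \<Longrightarrow> u k \<le> u (Suc k)"
    and \<xi>_meas: "\<And>k. k < m \<Longrightarrow> \<xi> k \<in> borel_measurable (F (u k))"
    and \<xi>_bound: "\<And>k \<omega>. k < m \<Longrightarrow> \<omega> \<in> space P \<Longrightarrow> \<bar>\<xi> k \<omega>\<bar> \<le> B"
begin

sublocale prob_space P using filtered_prob_spaceD(1)[OF fps] .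

definition \<Delta> :: "nat \<Rightarrow> 'w \<Rightarrow> real" where "\<Delta> k \<omega> = W (u (Suc k)) \<omega> - W (u k) \<omega>"
definition M :: "nat \<Rightarrow> 'w \<Rightarrow> real" where "M k \<omega> = (\<Sum>i<k. \<xi> i \<omega> * \<Delta> i \<omega>)"

lemma u_mono: "i \<le> j \<Longrightarrow> j \<le> m \<Longrightarrow> u i \<le> u j"
proof (induction j)
  case (Suc j)
  then show ?case using u_step[of j] by (cases "i = Suc j") auto
qed simp

lemma u_nonneg: "k \<le> m \<Longrightarrow> 0 \<le> u k"
  using u_mono[of 0 k] u0 by simp

lemma M_meas: "k \<le> m \<Longrightarrow> M k \<in> borel_measurable (F (u k))"
  unfolding M_def \<Delta>_def
proof (intro borel_measurable_sum borel_measurable_times borel_measurable_diff)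
  fix i assume k: "k \<le> m" and i: "i \<in> {..<k}"
  have W: "W (u j) \<in> borel_measurable (F (u j))" if "j \<le> m" for j
    using bm u_nonneg[OF that] unfolding standard_brownian_motion_def by blast
  show "\<xi> i \<in> borel_measurable (F (u k))"
    using k i by (intro filtered_measurable_mono[OF fps \<xi>_meas] u_mono) auto
  show "W (u (Suc i)) \<in> borel_measurable (F (u k))" "W (u i) \<in> borel_measurable (F (u k))"
    using k i by (auto intro!: filtered_measurable_mono[OF fps W] u_mono)
qed

text \<open>The Brownian axioms concern \<open>s < t\<close> only, but grid points coincide after
  truncation at a fixed time; a step of length zero has zero increment and satisfies the same
  formulas.\<close>

lemma increment:
  assumes k: "k < m"
  shows "integrable P (\<lambda>\<omega>. \<Delta> k \<omega> ^ j)" "expectation (\<Delta> k) = 0"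
    "expectation (\<lambda>\<omega>. \<Delta> k \<omega> ^ 2) = u (Suc k) - u k" "expectation (\<lambda>\<omega>. \<Delta> k \<omega> ^ 3) = 0"
    "expectation (\<lambda>\<omega>. \<Delta> k \<omega> ^ 4) = 3 * (u (Suc k) - u k)\<^sup>2"
proof -
  let ?s = "sqrt (u (Suc k) - u k)"
  consider "u (Suc k) = u k" | "u k < u (Suc k)" using u_step[OF k] by linarith
  then have "integrable P (\<lambda>\<omega>. \<Delta> k \<omega> ^ j) \<and> expectation (\<Delta> k) = 0 \<and>
    expectation (\<lambda>\<omega>. \<Delta> k \<omega> ^ 2) = u (Suc k) - u k \<and> expectation (\<lambda>\<omega>. \<Delta> k \<omega> ^ 3) = 0 \<and>
    expectation (\<lambda>\<omega>. \<Delta> k \<omega> ^ 4) = 3 * (u (Suc k) - u k)\<^sup>2"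
  proof cases
    case 1
    then have "\<Delta> k = (\<lambda>\<omega>. 0)" by (simp add: \<Delta>_def fun_eq_iff)
    then show ?thesis using 1 by simp
  next
    case 2
    have d: "distributed P lborel (\<Delta> k) (normal_density 0 ?s)"
      using bm 2 u_nonneg[of k] k unfolding standard_brownian_motion_def \<Delta>_def[abs_def] by auto
    have "?s ^ 4 = (?s\<^sup>2)\<^sup>2" by simp
    then show ?thesis using normal_moments[OF prob_space_axioms d] 2 by simp
  qed
  then show "integrable P (\<lambda>\<omega>. \<Delta> k \<omega> ^ j)" "expectation (\<Delta> k) = 0"
    "expectation (\<lambda>\<omega>. \<Delta> k \<omega> ^ 2) = u (Suc k) - u k" "expectation (\<lambda>\<omega>. \<Delta> k \<omega> ^ 3) = 0"
    "expectation (\<lambda>\<omega>. \<Delta> k \<omega> ^ 4) = 3 * (u (Suc k) - u k)\<^sup>2" by blast+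
qed

lemma increment_indep:
  assumes k: "k < m" and U: "U \<in> borel_measurable (F (u k))" "integrable P U"
  shows "integrable P (\<lambda>\<omega>. U \<omega> * \<Delta> k \<omega> ^ j)"
    "expectation (\<lambda>\<omega>. U \<omega> * \<Delta> k \<omega> ^ j) = expectation U * expectation (\<lambda>\<omega>. \<Delta> k \<omega> ^ j)"
proof -
  consider "u (Suc k) = u k" | "u k < u (Suc k)" using u_step[OF k] by linarith
  then have "integrable P (\<lambda>\<omega>. U \<omega> * \<Delta> k \<omega> ^ j) \<and>
    expectation (\<lambda>\<omega>. U \<omega> * \<Delta> k \<omega> ^ j) = expectation U * expectation (\<lambda>\<omega>. \<Delta> k \<omega> ^ j)"
  proof cases
    case 1
    then have "\<Delta> k = (\<lambda>\<omega>. 0)" by (simp add: \<Delta>_def fun_eq_iff)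
    then show ?thesis using U by (cases "j = 0") (auto simp: prob_space)
  next
    case 2
    have dm: "\<Delta> k \<in> borel_measurable P" using increment(1)[OF k, of 1] by simp
    have i: "indep_set (sets (F (u k))) (sets (vimage_algebra (space P) (\<Delta> k) borel))"
      using bm 2 u_nonneg[of k] k unfolding standard_brownian_motion_def \<Delta>_def[abs_def] by auto
    have sp: "space (F (u k)) = space P" using filtered_prob_spaceD(2)[OF fps] .
    have "indep_set (sigma_sets (space P) {U -` A \<inter> space P |A. A \<in> sets borel})
        (sigma_sets (space P) {\<Delta> k -` A \<inter> space P |A. A \<in> sets borel})"
      unfolding indep_set_def
    proof (rule indep_sets_mono[OF i[unfolded indep_set_def] order_refl])
      fix b
      have "sigma_sets (space P) {U -` A \<inter> space P |A. A \<in> sets borel} \<subseteq> sets (F (u k))"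
        using measurable_sets[OF U(1)] unfolding sp
        by (subst sp[symmetric], intro sets.sigma_sets_subset) auto
      then show "case_bool (sigma_sets (space P) {U -` A \<inter> space P |A. A \<in> sets borel})
        (sigma_sets (space P) {\<Delta> k -` A \<inter> space P |A. A \<in> sets borel}) b
        \<subseteq> case_bool (sets (F (u k))) (sets (vimage_algebra (space P) (\<Delta> k) borel)) b"
        by (auto split: bool.split simp: sets_vimage_algebra)
    qed
    then have "indep_var borel U borel (\<Delta> k)"
      unfolding indep_var_eq using U(2) dm by auto
    from indep_var_compose[OF this, of "\<lambda>x. x" borel "\<lambda>x. x ^ j" borel]
    have "indep_var borel U borel (\<lambda>\<omega>. \<Delta> k \<omega> ^ j)" by (simp add: comp_def)
    then show ?thesis
      using indep_var_integrable indep_var_lebesgue_integral U(2) increment(1)[OF k] by blast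
  qed
  then show "integrable P (\<lambda>\<omega>. U \<omega> * \<Delta> k \<omega> ^ j)"
    "expectation (\<lambda>\<omega>. U \<omega> * \<Delta> k \<omega> ^ j) = expectation U * expectation (\<lambda>\<omega>. \<Delta> k \<omega> ^ j)" by blast+
qed

lemma power_le_one_plus_fourth: "i \<le> 4 \<Longrightarrow> \<bar>x\<bar> ^ i \<le> 1 + (x::real) ^ 4"
proof -
  assume i: "i \<le> 4"
  show ?thesis
  proof (cases "\<bar>x\<bar> \<le> 1")
    case True
    then have "\<bar>x\<bar> ^ i \<le> 1" by (intro power_le_one) auto
    also have "1 \<le> 1 + x ^ 4" by simp
    finally show ?thesis .
  next
    case False
    then have "\<bar>x\<bar> ^ i \<le> \<bar>x\<bar> ^ 4" using i by (intro power_increasing) auto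
    then show ?thesis by (simp add: power_even_abs_numeral)
  qed
qed

lemma mixed_integrable:
  assumes k: "k < m" and i: "i \<le> 4" and M4: "integrable P (\<lambda>\<omega>. M k \<omega> ^ 4)"
  shows "(\<lambda>\<omega>. M k \<omega> ^ i * \<xi> k \<omega> ^ l) \<in> borel_measurable (F (u k))"
    "integrable P (\<lambda>\<omega>. M k \<omega> ^ i * \<xi> k \<omega> ^ l)"
proof -
  show m: "(\<lambda>\<omega>. M k \<omega> ^ i * \<xi> k \<omega> ^ l) \<in> borel_measurable (F (u k))"
    using M_meas[of k] \<xi>_meas[OF k] k by (intro borel_measurable_times borel_measurable_power) auto
  show "integrable P (\<lambda>\<omega>. M k \<omega> ^ i * \<xi> k \<omega> ^ l)"
  proof (rule Bochner_Integration.integrable_bound[of P "\<lambda>\<omega>. B ^ l * (1 + M k \<omega> ^ 4)"])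
    show "integrable P (\<lambda>\<omega>. B ^ l * (1 + M k \<omega> ^ 4))" using M4 by auto
    show "(\<lambda>\<omega>. M k \<omega> ^ i * \<xi> k \<omega> ^ l) \<in> borel_measurable P"
      by (rule filtered_measurable_P[OF fps m])
    show "AE \<omega> in P. norm (M k \<omega> ^ i * \<xi> k \<omega> ^ l) \<le> norm (B ^ l * (1 + M k \<omega> ^ 4))"
    proof (rule AE_I2)
      fix \<omega> assume w: "\<omega> \<in> space P"
      have B: "0 \<le> B" using \<xi>_bound[OF k w] by linarith
      have "norm (M k \<omega> ^ i * \<xi> k \<omega> ^ l) = \<bar>\<xi> k \<omega>\<bar> ^ l * \<bar>M k \<omega>\<bar> ^ i"
        by (simp add: abs_mult power_abs mult.commute)
      also have "\<dots> \<le> B ^ l * (1 + M k \<omega> ^ 4)"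
        using \<xi>_bound[OF k w] B by (intro mult_mono power_mono power_le_one_plus_fourth i) auto
      finally show "norm (M k \<omega> ^ i * \<xi> k \<omega> ^ l) \<le> norm (B ^ l * (1 + M k \<omega> ^ 4))"
        using B by simp
    qed
  qed
qed

lemma step_expectation:
  assumes k: "k < m" and i: "i \<le> 4" and M4: "integrable P (\<lambda>\<omega>. M k \<omega> ^ 4)"
  shows "integrable P (\<lambda>\<omega>. M k \<omega> ^ i * \<xi> k \<omega> ^ l * \<Delta> k \<omega> ^ j)"
    "expectation (\<lambda>\<omega>. M k \<omega> ^ i * \<xi> k \<omega> ^ l * \<Delta> k \<omega> ^ j)
      = expectation (\<lambda>\<omega>. M k \<omega> ^ i * \<xi> k \<omega> ^ l) * expectation (\<lambda>\<omega>. \<Delta> k \<omega> ^ j)"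
  using increment_indep[OF k mixed_integrable[OF k i M4]] by auto

lemma M_Suc: "M (Suc k) \<omega> = M k \<omega> + \<xi> k \<omega> * \<Delta> k \<omega>"
  by (simp add: M_def)

text \<open>Zeroth and first powers are written out so that every term has the shape
  \<open>M ^ i * \<xi> ^ l * \<Delta> ^ j\<close> to which \<open>step_expectation\<close>
  applies.\<close>

lemma M_Suc_power4:
  "M (Suc k) \<omega> ^ 4 = M k \<omega> ^ 4 * \<xi> k \<omega> ^ 0 * \<Delta> k \<omega> ^ 0 + 4 * (M k \<omega> ^ 3 * \<xi> k \<omega> ^ 1 * \<Delta> k \<omega> ^ 1)
    + 6 * (M k \<omega> ^ 2 * \<xi> k \<omega> ^ 2 * \<Delta> k \<omega> ^ 2) + 4 * (M k \<omega> ^ 1 * \<xi> k \<omega> ^ 3 * \<Delta> k \<omega> ^ 3)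
    + M k \<omega> ^ 0 * \<xi> k \<omega> ^ 4 * \<Delta> k \<omega> ^ 4"
  unfolding M_Suc by (simp add: algebra_simps power4_eq_xxxx power2_eq_square power3_eq_cube)

lemma M_Suc_power2:
  "M (Suc k) \<omega> ^ 2 = M k \<omega> ^ 2 * \<xi> k \<omega> ^ 0 * \<Delta> k \<omega> ^ 0 + 2 * (M k \<omega> ^ 1 * \<xi> k \<omega> ^ 1 * \<Delta> k \<omega> ^ 1)
    + M k \<omega> ^ 0 * \<xi> k \<omega> ^ 2 * \<Delta> k \<omega> ^ 2"
  unfolding M_Suc by (simp add: algebra_simps power2_eq_square)

lemma M4_integrable: "k \<le> m \<Longrightarrow> integrable P (\<lambda>\<omega>. M k \<omega> ^ 4)"
proof (induction k)
  case 0
  then show ?case by (simp add: M_def)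
next
  case (Suc k)
  then have k: "k < m" and I: "integrable P (\<lambda>\<omega>. M k \<omega> ^ 4)" by auto
  show ?case unfolding M_Suc_power4
    by (intro Bochner_Integration.integrable_add integrable_mult_right step_expectation(1)[OF k _ I]) auto
qed

lemma M_integrable: assumes "k \<le> m" "i \<le> 4" shows "integrable P (\<lambda>\<omega>. M k \<omega> ^ i)"
proof (rule Bochner_Integration.integrable_bound[of P "\<lambda>\<omega>. 1 + M k \<omega> ^ 4"])
  show "integrable P (\<lambda>\<omega>. 1 + M k \<omega> ^ 4)" using M4_integrable[OF assms(1)] by auto
  show "(\<lambda>\<omega>. M k \<omega> ^ i) \<in> borel_measurable P"
    using filtered_measurable_P[OF fps M_meas[OF assms(1)]] by simp
  show "AE \<omega> in P. norm (M k \<omega> ^ i) \<le> norm (1 + M k \<omega> ^ 4)"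
    using power_le_one_plus_fourth[OF assms(2)] by (auto simp: power_abs)
qed

lemma M_mean: "k \<le> m \<Longrightarrow> expectation (M k) = 0"
proof (induction k)
  case 0
  then show ?case by (simp add: M_def)
next
  case (Suc k)
  then have k: "k < m" by auto
  note s = step_expectation[OF k _ M4_integrable]
  have "expectation (\<lambda>\<omega>. M k \<omega> ^ 1 + M k \<omega> ^ 0 * \<xi> k \<omega> ^ 1 * \<Delta> k \<omega> ^ 1) = 0"
    using k Suc s[of 0 1 1] increment(2)[OF k] M_integrable[of k 1]
    by (subst Bochner_Integration.integral_add) auto
  then show ?case by (simp add: M_Suc[abs_def])
qed

lemma M_second_moment:
  "k \<le> m \<Longrightarrow> expectation (\<lambda>\<omega>. (M k \<omega>)\<^sup>2) = (\<Sum>i<k. expectation (\<lambda>\<omega>. (\<xi> i \<omega>)\<^sup>2) * (u (Suc i) - u i))"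
proof (induction k)
  case 0
  then show ?case by (simp add: M_def)
next
  case (Suc k)
  then have k: "k < m" by auto
  note I = M4_integrable[OF less_imp_le[OF k]]
  show ?case unfolding M_Suc_power2
    apply (subst Bochner_Integration.integral_add)
      apply (intro Bochner_Integration.integrable_add integrable_mult_right step_expectation(1)[OF k _ I]; simp)
     apply (intro step_expectation(1)[OF k _ I]; simp)
    apply (subst Bochner_Integration.integral_add)
      apply (intro step_expectation(1)[OF k _ I]; simp)
     apply (intro integrable_mult_right step_expectation(1)[OF k _ I]; simp)
    apply (subst integral_mult_right_zero)
    apply (subst step_expectation(2)[OF k _ I], simp)+
    using Suc k increment[OF k] by (simp add: prob_space)
qed

lemma square_bound:
  assumes "k < m" shows "expectation (\<lambda>\<omega>. (\<xi> k \<omega>)\<^sup>2) \<le> B\<^sup>2"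
proof -
  have i: "integrable P (\<lambda>\<omega>. (\<xi> k \<omega>)\<^sup>2)"
    using mixed_integrable(2)[OF assms _ M4_integrable, of 0 2] assms by simp
  have "expectation (\<lambda>\<omega>. (\<xi> k \<omega>)\<^sup>2) \<le> expectation (\<lambda>\<omega>. B\<^sup>2)"
  proof (rule integral_mono[OF i])
    fix \<omega> assume "\<omega> \<in> space P"
    from \<xi>_bound[OF assms this] show "(\<xi> k \<omega>)\<^sup>2 \<le> B\<^sup>2" using power_mono[of "\<bar>\<xi> k \<omega>\<bar>" B 2] by simp
  qed simp
  then show ?thesis by (simp add: prob_space)
qed

lemma M_second_moment_le:
  assumes "k \<le> m" shows "expectation (\<lambda>\<omega>. (M k \<omega>)\<^sup>2) \<le> B\<^sup>2 * (u k - u 0)"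
proof -
  have "expectation (\<lambda>\<omega>. (M k \<omega>)\<^sup>2) \<le> (\<Sum>i<k. B\<^sup>2 * (u (Suc i) - u i))"
    unfolding M_second_moment[OF assms] using assms u_step square_bound
    by (intro sum_mono mult_right_mono) auto
  also have "\<dots> = B\<^sup>2 * (u k - u 0)" by (simp add: sum_distrib_left[symmetric] sum_lessThan_telescope)
  finally show ?thesis .
qed

text \<open>Terms with an odd power of the increment have mean zero. With
  \<open>q = u k - u 0\<close> and step \<open>d\<close> the rest is at most
  \<open>3 * B ^ 4 * (q\<^sup>2 + 2 * q * d + d\<^sup>2)\<close>, where the middle term comes from
  the second moment: the square closes up and the Gaussian constant \<open>3\<close>
  persists.\<close>

lemma M_fourth_moment_le: "k \<le> m \<Longrightarrow> expectation (\<lambda>\<omega>. M k \<omega> ^ 4) \<le> 3 * B ^ 4 * (u k - u 0)\<^sup>2"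
proof (induction k)
  case 0
  then show ?case by (simp add: M_def)
next
  case (Suc k)
  then have k: "k < m" by auto
  note I = M4_integrable[OF less_imp_le[OF k]]
  let ?d = "u (Suc k) - u k"
  have d: "0 \<le> ?d" using u_step[OF k] by simp
  have e: "expectation (\<lambda>\<omega>. M (Suc k) \<omega> ^ 4) = expectation (\<lambda>\<omega>. M k \<omega> ^ 4)
      + 6 * (expectation (\<lambda>\<omega>. M k \<omega> ^ 2 * \<xi> k \<omega> ^ 2) * ?d) + expectation (\<lambda>\<omega>. \<xi> k \<omega> ^ 4) * (3 * ?d\<^sup>2)"
    unfolding M_Suc_power4
    apply (subst Bochner_Integration.integral_add)
      apply (intro Bochner_Integration.integrable_add integrable_mult_right step_expectation(1)[OF k _ I]; simp)
     apply (intro step_expectation(1)[OF k _ I]; simp)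
    apply (subst Bochner_Integration.integral_add)
      apply (intro Bochner_Integration.integrable_add integrable_mult_right step_expectation(1)[OF k _ I]; simp)
     apply (intro integrable_mult_right step_expectation(1)[OF k _ I]; simp)
    apply (subst Bochner_Integration.integral_add)
      apply (intro Bochner_Integration.integrable_add integrable_mult_right step_expectation(1)[OF k _ I]; simp)
     apply (intro integrable_mult_right step_expectation(1)[OF k _ I]; simp)
    apply (subst Bochner_Integration.integral_add)
      apply (intro step_expectation(1)[OF k _ I]; simp)
     apply (intro integrable_mult_right step_expectation(1)[OF k _ I]; simp)
    unfolding integral_mult_right_zero
    apply (subst step_expectation(2)[OF k _ I], simp)+
    using increment[OF k] by (simp add: prob_space)
  have b2: "(\<xi> k \<omega>)\<^sup>2 \<le> B\<^sup>2" and b4: "\<xi> k \<omega> ^ 4 \<le> B ^ 4" if "\<omega> \<in> space P" for \<omega>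
    using power_mono[OF \<xi>_bound[OF k that], of 2] power_mono[OF \<xi>_bound[OF k that], of 4]
    by (auto simp: power_even_abs_numeral)
  have "expectation (\<lambda>\<omega>. M k \<omega> ^ 2 * \<xi> k \<omega> ^ 2) \<le> expectation (\<lambda>\<omega>. B\<^sup>2 * (M k \<omega>)\<^sup>2)"
    using b2 M_integrable[of k 2] k
    by (intro integral_mono mixed_integrable(2)[OF k _ I]) (auto simp: mult.commute intro!: mult_right_mono)
  also have "\<dots> \<le> B\<^sup>2 * (B\<^sup>2 * (u k - u 0))"
    using mult_left_mono[OF M_second_moment_le[of k], of "B\<^sup>2"] k by simp
  finally have e2: "expectation (\<lambda>\<omega>. M k \<omega> ^ 2 * \<xi> k \<omega> ^ 2) \<le> B ^ 4 * (u k - u 0)"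
    by (simp add: power4_eq_xxxx power2_eq_square mult.assoc)
  have "expectation (\<lambda>\<omega>. \<xi> k \<omega> ^ 4) \<le> expectation (\<lambda>\<omega>. B ^ 4)"
    using b4 mixed_integrable(2)[OF k _ I, of 0 4] by (intro integral_mono) auto
  then have e4: "expectation (\<lambda>\<omega>. \<xi> k \<omega> ^ 4) \<le> B ^ 4" by (simp add: prob_space)
  have "expectation (\<lambda>\<omega>. M (Suc k) \<omega> ^ 4) \<le> 3 * B ^ 4 * (u k - u 0)\<^sup>2
      + 6 * (B ^ 4 * (u k - u 0) * ?d) + B ^ 4 * (3 * ?d\<^sup>2)"
    unfolding e using Suc.IH k d e2 e4
    by (intro add_mono mult_left_mono mult_right_mono) auto
  also have "\<dots> = 3 * B ^ 4 * (u (Suc k) - u 0)\<^sup>2"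
    by (simp add: power2_eq_square algebra_simps)
  finally show ?case .
qed

text \<open>Lenglart's inequality, by killing the integrand as soon as its quadratic variation exceeds \<open>d\<close>.\<close>

lemma M_prob_le:
  assumes e: "0 < e" and d: "0 < d"
  shows "prob {\<omega>\<in>space P. e < \<bar>M m \<omega>\<bar>}
    \<le> d / e\<^sup>2 + prob {\<omega>\<in>space P. d < (\<Sum>k<m. (\<xi> k \<omega>)\<^sup>2 * (u (Suc k) - u k))}"
proof -
  define Q where "Q k \<omega> = (\<Sum>i<k. (\<xi> i \<omega>)\<^sup>2 * (u (Suc i) - u i))" for k \<omega>
  \<comment> \<open>\<open>Q (Suc k)\<close> already contains the contribution of step
    \<open>k\<close>, so the killed integrand never exceeds the budget \<open>d\<close>. The grid is
    deterministic and \<open>\<xi> k\<close> is known at \<open>u k\<close>, hence the decision is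
    still adapted.\<close>
  define \<eta> where "\<eta> k \<omega> = (if Q (Suc k) \<omega> \<le> d then \<xi> k \<omega> else 0)" for k \<omega>
  have Q_meas: "Q (Suc k) \<in> borel_measurable (F (u k))" if "k < m" for k
    unfolding Q_def
  proof (intro borel_measurable_sum borel_measurable_times borel_measurable_power borel_measurable_const)
    fix i assume "i \<in> {..<Suc k}"
    then show "\<xi> i \<in> borel_measurable (F (u k))"
      using that by (intro filtered_measurable_mono[OF fps \<xi>_meas] u_mono) auto
  qed
  have Q_mono: "Q i \<omega> \<le> Q j \<omega>" if "i \<le> j" "j \<le> m" for i j \<omega>
    unfolding Q_def using that u_step by (intro sum_mono2) auto
  interpret K: discrete_ito P F W m u \<eta> B
  proof
    show "\<eta> k \<in> borel_measurable (F (u k))" if "k < m" for k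
      unfolding \<eta>_def using Q_meas[OF that] \<xi>_meas[OF that] by measurable
    show "\<bar>\<eta> k \<omega>\<bar> \<le> B" if "k < m" "\<omega> \<in> space P" for k \<omega>
      unfolding \<eta>_def using \<xi>_bound[OF that] by auto
  qed (use fps bm u0 u_step in auto)
  have Qk: "(\<Sum>i<k. (\<eta> i \<omega>)\<^sup>2 * (u (Suc i) - u i)) \<le> d" if "k \<le> m" for k \<omega>
    using that
  proof (induction k)
    case (Suc k)
    show ?case
    proof (cases "Q (Suc k) \<omega> \<le> d")
      case True
      have "(\<Sum>i<Suc k. (\<eta> i \<omega>)\<^sup>2 * (u (Suc i) - u i)) \<le> Q (Suc k) \<omega>"
        unfolding Q_def \<eta>_def using Suc.prems u_step by (intro sum_mono mult_right_mono) auto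
      then show ?thesis using True by simp
    next
      case False
      then show ?thesis using Suc by (simp add: \<eta>_def)
    qed
  qed (use d in simp)
  have \<eta>2: "integrable P (\<lambda>\<omega>. (\<eta> i \<omega>)\<^sup>2)" if "i < m" for i
    using K.mixed_integrable(2)[OF that _ K.M4_integrable, of 0 2] that by simp
  have "expectation (\<lambda>\<omega>. (K.M m \<omega>)\<^sup>2) = expectation (\<lambda>\<omega>. \<Sum>i<m. (\<eta> i \<omega>)\<^sup>2 * (u (Suc i) - u i))"
    unfolding K.M_second_moment[OF order_refl]
    by (subst Bochner_Integration.integral_sum) (use \<eta>2 in auto)
  also have "\<dots> \<le> expectation (\<lambda>\<omega>. d)"
    by (intro integral_mono Bochner_Integration.integrable_sum integrable_mult_left \<eta>2 Qk) auto
  finally have E: "expectation (\<lambda>\<omega>. (K.M m \<omega>)\<^sup>2) \<le> d" by (simp add: prob_space)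
  have mM: "M m \<in> borel_measurable P" "K.M m \<in> borel_measurable P"
    by (rule filtered_measurable_P[OF fps M_meas[OF order_refl]],
        rule filtered_measurable_P[OF fps K.M_meas[OF order_refl]])
  have mQ: "Q m \<in> borel_measurable P" unfolding Q_def
    using filtered_measurable_P[OF fps \<xi>_meas] by (intro borel_measurable_sum) auto
  have "prob {\<omega>\<in>space P. e < \<bar>M m \<omega>\<bar>} \<le> prob ({\<omega>\<in>space P. e\<^sup>2 \<le> (K.M m \<omega>)\<^sup>2} \<union> {\<omega>\<in>space P. d < Q m \<omega>})"
  proof (rule finite_measure_mono)
    show "{\<omega>\<in>space P. e < \<bar>M m \<omega>\<bar>} \<subseteq> {\<omega>\<in>space P. e\<^sup>2 \<le> (K.M m \<omega>)\<^sup>2} \<union> {\<omega>\<in>space P. d < Q m \<omega>}"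
    proof safe
      fix \<omega> assume w: "\<omega> \<in> space P" "e < \<bar>M m \<omega>\<bar>" "\<not> d < Q m \<omega>"
      have "\<eta> i \<omega> = \<xi> i \<omega>" if "i < m" for i
        using Q_mono[of "Suc i" m \<omega>] that w(3) by (auto simp: \<eta>_def)
      then have "K.M m \<omega> = M m \<omega>" by (simp add: K.M_def M_def K.\<Delta>_def \<Delta>_def)
      then show "e\<^sup>2 \<le> (K.M m \<omega>)\<^sup>2" using w(2) e power_mono[of e "\<bar>M m \<omega>\<bar>" 2] by simp
    qed
  qed (use mM mQ in measurable)
  also have "\<dots> \<le> prob {\<omega>\<in>space P. e\<^sup>2 \<le> (K.M m \<omega>)\<^sup>2} + prob {\<omega>\<in>space P. d < Q m \<omega>}"
    by (rule measure_Un_le) (use mM mQ in measurable)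
  also have "prob {\<omega>\<in>space P. e\<^sup>2 \<le> (K.M m \<omega>)\<^sup>2} \<le> expectation (\<lambda>\<omega>. (K.M m \<omega>)\<^sup>2) / e\<^sup>2"
    using e by (intro integral_Markov_inequality_measure[where A="{}"] K.M_integrable) auto
  also have "\<dots> \<le> d / e\<^sup>2" using E by (simp add: divide_right_mono)
  finally show ?thesis unfolding Q_def by simp
qed

end

section \<open>From simple processes to the Ito integral\<close>

text \<open>The half-open intervals are disjoint, so at most one term is nonzero;
  \<open>\<phi> 0 = 0\<close> covers the case that none is.\<close>

lemma step_function_map:
  fixes \<tau> :: "nat \<Rightarrow> real" and \<phi> :: "real \<Rightarrow> real"
  assumes mono: "\<And>k. k < m \<Longrightarrow> \<tau> k \<le> \<tau> (Suc k)" and \<phi>: "\<phi> 0 = 0"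
  shows "\<phi> (\<Sum>k<m. y k * indicator {\<tau> k<..\<tau> (Suc k)} s) = (\<Sum>k<m. \<phi> (y k) * indicator {\<tau> k<..\<tau> (Suc k)} s)"
  using mono
proof (induction m)
  case (Suc m)
  have le: "\<tau> (Suc k) \<le> \<tau> m" if "k < m" for k
    using that Suc.prems by (induction m) (auto simp: less_Suc_eq intro: order_trans)
  show ?case
  proof (cases "\<tau> m < s")
    case True
    then have z: "indicator {\<tau> k<..\<tau> (Suc k)} s = (0::real)" if "k < m" for k
      using le[OF that] by (auto simp: indicator_def)
    have "(\<Sum>k<m. g k * indicator {\<tau> k<..\<tau> (Suc k)} s) = 0" for g :: "nat \<Rightarrow> real"
      by (intro sum.neutral) (simp add: z)
    then show ?thesis using \<phi> by (simp add: indicator_def del: sum_mult_of_bool_eq sum_of_bool_mult_eq)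
  next
    case False
    then show ?thesis using Suc by simp
  qed
qed (simp add: \<phi>)

lemma step_function_square_integral:
  fixes \<tau> :: "nat \<Rightarrow> real"
  assumes mono: "\<And>k. k < m \<Longrightarrow> \<tau> k \<le> \<tau> (Suc k)" and \<tau>0: "0 \<le> \<tau> 0"
  shows "(\<integral>\<^sup>+s\<in>{0..t}. ennreal ((\<Sum>k<m. y k * indicator {\<tau> k<..\<tau> (Suc k)} s)\<^sup>2) \<partial>lborel)
    = ennreal (\<Sum>k<m. (y k)\<^sup>2 * (min t (\<tau> (Suc k)) - min t (\<tau> k)))"
proof -
  have nn: "0 \<le> \<tau> k" if "k \<le> m" for k
    using that
  proof (induction k)
    case (Suc k) then show ?case using mono[of k] by simp
  qed (rule \<tau>0)
  have "(\<integral>\<^sup>+s\<in>{0..t}. ennreal ((\<Sum>k<m. y k * indicator {\<tau> k<..\<tau> (Suc k)} s)\<^sup>2) \<partial>lborel)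
    = (\<integral>\<^sup>+s. (\<Sum>k<m. ennreal ((y k)\<^sup>2) * indicator ({\<tau> k<..\<tau> (Suc k)} \<inter> {0..t}) s) \<partial>lborel)"
  proof (rule nn_integral_cong)
    fix s
    have "ennreal ((\<Sum>k<m. y k * indicator {\<tau> k<..\<tau> (Suc k)} s)\<^sup>2)
        = (\<Sum>k<m. ennreal ((y k)\<^sup>2 * indicator {\<tau> k<..\<tau> (Suc k)} s))"
      using step_function_map[of m \<tau> "\<lambda>x. x\<^sup>2" y s, OF mono] by (simp add: sum_ennreal)
    then show "ennreal ((\<Sum>k<m. y k * indicator {\<tau> k<..\<tau> (Suc k)} s)\<^sup>2) * indicator {0..t} s
        = (\<Sum>k<m. ennreal ((y k)\<^sup>2) * indicator ({\<tau> k<..\<tau> (Suc k)} \<inter> {0..t}) s)"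
      by (auto simp: sum_distrib_right indicator_def intro!: sum.cong)
  qed
  also have "\<dots> = (\<Sum>k<m. ennreal ((y k)\<^sup>2) * emeasure lborel ({\<tau> k<..\<tau> (Suc k)} \<inter> {0..t}))"
    by (subst nn_integral_sum) (auto simp: nn_integral_cmult_indicator)
  also have "\<dots> = (\<Sum>k<m. ennreal ((y k)\<^sup>2 * (min t (\<tau> (Suc k)) - min t (\<tau> k))))"
  proof (rule sum.cong[OF refl])
    fix k assume "k \<in> {..<m}"
    then have k: "\<tau> k \<le> \<tau> (Suc k)" "0 \<le> \<tau> k" using mono nn by auto
    have "emeasure lborel ({\<tau> k<..\<tau> (Suc k)} \<inter> {0..t}) = ennreal (min t (\<tau> (Suc k)) - min t (\<tau> k))"
    proof (cases "\<tau> k \<le> t")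
      case True
      have "{\<tau> k<..\<tau> (Suc k)} \<inter> {0..t} = {\<tau> k<..min t (\<tau> (Suc k))}" using k by auto
      then show ?thesis using True k by simp
    next
      case False
      then have "{\<tau> k<..\<tau> (Suc k)} \<inter> {0..t} = {}" by auto
      then show ?thesis using False k by (simp add: min_def)
    qed
    then show "ennreal ((y k)\<^sup>2) * emeasure lborel ({\<tau> k<..\<tau> (Suc k)} \<inter> {0..t})
        = ennreal ((y k)\<^sup>2 * (min t (\<tau> (Suc k)) - min t (\<tau> k)))"
      using k by (simp add: ennreal_mult)
  qed
  also have "\<dots> = ennreal (\<Sum>k<m. (y k)\<^sup>2 * (min t (\<tau> (Suc k)) - min t (\<tau> k)))"
    using mono by (intro sum_ennreal mult_nonneg_nonneg diff_ge_0_iff_ge[THEN iffD2] min.mono) auto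
  finally show ?thesis .
qed

definition clamp_abs :: "real \<Rightarrow> real \<Rightarrow> real" where "clamp_abs B x = max (- B) (min B x)"

lemma clamp_abs_bound: "0 \<le> B \<Longrightarrow> \<bar>clamp_abs B x\<bar> \<le> B"
  by (auto simp: clamp_abs_def)

text \<open>Projection onto an interval that contains \<open>h\<close> moves no point away from
  \<open>h\<close>, and moves a point by no more than its distance to \<open>h\<close>.\<close>

lemma clamp_abs_dist: "\<bar>h\<bar> \<le> B \<Longrightarrow> \<bar>clamp_abs B x - h\<bar> \<le> \<bar>x - h\<bar>" "\<bar>h\<bar> \<le> B \<Longrightarrow> \<bar>x - clamp_abs B x\<bar> \<le> \<bar>x - h\<bar>"
  by (auto simp: clamp_abs_def)

lemma clamp_abs_0: "0 \<le> B \<Longrightarrow> clamp_abs B 0 = 0"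
  by (auto simp: clamp_abs_def)

lemma clamp_abs_measurable [measurable]: "clamp_abs B \<in> borel_measurable borel"
  unfolding clamp_abs_def[abs_def] by measurable

text \<open>A coefficient with \<open>\<tau> k \<ge> t\<close> is measurable for
  \<open>F (\<tau> k)\<close>, which may be larger than \<open>F t\<close>. Its increment vanishes
  after truncation at \<open>t\<close>, so it may be replaced by zero.\<close>

lemma (in prob_space) simple_process_discrete_ito:
  assumes fps: "filtered_prob_space M F" and bm: "standard_brownian_motion M F W" and t: "0 \<le> t"
    and sp: "simple_process M F m \<tau> \<xi>" and g: "g \<in> borel_measurable borel"
    and bd: "\<And>k \<omega>. k < m \<Longrightarrow> \<omega> \<in> space M \<Longrightarrow> \<bar>g (\<xi> k \<omega>)\<bar> \<le> B" and B: "0 \<le> B"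
  shows "discrete_ito M F W m (\<lambda>k. min t (\<tau> k)) (\<lambda>k \<omega>. if \<tau> k < t then g (\<xi> k \<omega>) else 0) B"
proof
  fix k assume k: "k < m"
  show "min t (\<tau> k) \<le> min t (\<tau> (Suc k))" using sp k unfolding simple_process_def by (auto simp: min_def)
  show "(\<lambda>\<omega>. if \<tau> k < t then g (\<xi> k \<omega>) else 0) \<in> borel_measurable (F (min t (\<tau> k)))"
    using sp k g unfolding simple_process_def by (cases "\<tau> k < t") (auto simp: min_def)
  show "\<bar>if \<tau> k < t then g (\<xi> k \<omega>) else 0\<bar> \<le> B" if "\<omega> \<in> space M" for \<omega>
    using bd[OF k that] B by auto
qed (use fps bm t sp in \<open>auto simp: simple_process_def\<close>)

text \<open>The approximating simple integrands have no common bound, so their integrals need not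
  have uniformly bounded moments. Clamping to \<open>[-B, B]\<close> brings them no further from
  \<open>H\<close>; the removed parts have quadratic variation tending to zero in probability, and
  so do their integrals by \<open>M_prob_le\<close>. The clamped integrals \<open>Z n\<close>
  therefore still converge to \<open>I\<close>. The last property holds since the clamped error is
  bounded by \<open>4 * B\<^sup>2 * t\<close> and thus tends to zero also in mean.\<close>

lemma bounded_ito_approximation:
  assumes fps: "filtered_prob_space P F" and bm: "standard_brownian_motion P F W" and t: "0 \<le> t"
    and ito: "has_ito_integral P F W H t I"
    and H_meas: "(\<lambda>(s, \<omega>). H (max 0 s) \<omega>) \<in> borel_measurable (borel \<Otimes>\<^sub>M P)"
    and H_bound: "\<And>s \<omega>. 0 \<le> s \<Longrightarrow> \<omega> \<in> space P \<Longrightarrow> \<bar>H s \<omega>\<bar> \<le> B" and B: "0 \<le> B"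
  obtains Z :: "nat \<Rightarrow> 'w \<Rightarrow> real"
  where "\<And>n. Z n \<in> borel_measurable P" "\<And>n i. i \<le> 4 \<Longrightarrow> integrable P (\<lambda>\<omega>. Z n \<omega> ^ i)"
    "\<And>n. (\<integral>\<omega>. Z n \<omega> \<partial>P) = 0" "\<And>n. (\<integral>\<omega>. (Z n \<omega>)\<^sup>2 \<partial>P) \<le> B\<^sup>2 * t" "\<And>n. (\<integral>\<omega>. Z n \<omega> ^ 4 \<partial>P) \<le> 3 * B ^ 4 * t\<^sup>2"
    "\<And>e. 0 < e \<Longrightarrow> (\<lambda>n. measure P {\<omega>\<in>space P. e < \<bar>Z n \<omega> - I \<omega>\<bar>}) \<longlonglongrightarrow> 0"
    "\<And>e. 0 < e \<Longrightarrow> \<forall>\<^sub>F n in sequentially.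
       (\<integral>\<^sup>+\<omega>. (\<integral>\<^sup>+s\<in>{0..t}. ennreal ((H s \<omega>)\<^sup>2) \<partial>lborel) \<partial>P) \<le> ennreal (2 * (\<integral>\<omega>. (Z n \<omega>)\<^sup>2 \<partial>P) + e)"
proof -
  interpret prob_space P using filtered_prob_spaceD(1)[OF fps] .
  obtain m \<tau> \<xi> where sp: "\<And>n. simple_process P F (m n) (\<tau> n) (\<xi> n)"
    and n1: "null_in_probability P (\<lambda>n \<omega>. \<integral>\<^sup>+s\<in>{0..t}. ennreal ((simple_value (m n) (\<tau> n) (\<xi> n) s \<omega> - H s \<omega>)\<^sup>2) \<partial>lborel)"
    and n2: "null_in_probability P (\<lambda>n \<omega>. ennreal \<bar>simple_integral_upto W (m n) (\<tau> n) (\<xi> n) t \<omega> - I \<omega>\<bar>)"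
    and I_meas: "I \<in> borel_measurable P"
    using ito unfolding has_ito_integral_def by blast
  define x where "x n k \<omega> = (if \<tau> n k < t then \<xi> n k \<omega> else 0)" for n k \<omega>
  define xc where "xc n k \<omega> = (if \<tau> n k < t then clamp_abs B (\<xi> n k \<omega>) else 0)" for n k \<omega>
  define xd where "xd n k \<omega> = (if \<tau> n k < t then \<xi> n k \<omega> - clamp_abs B (\<xi> n k \<omega>) else 0)" for n k \<omega>
  define u where "u n k = min t (\<tau> n k)" for n k
  obtain D where D: "\<And>n k \<omega>. k < m n \<Longrightarrow> \<omega> \<in> space P \<Longrightarrow> \<bar>\<xi> n k \<omega>\<bar> \<le> D n"
    using sp unfolding simple_process_def by metis
  have \<tau>_mono: "\<tau> n k \<le> \<tau> n (Suc k)" if "k < m n" for n k using sp[of n] that unfolding simple_process_def by auto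
  have \<tau>0: "0 \<le> \<tau> n 0" for n using sp[of n] unfolding simple_process_def by auto
  have \<xi>_meas: "\<xi> n k \<in> borel_measurable P" if "k < m n" for n k
    using sp[of n] that filtered_measurable_P[OF fps] unfolding simple_process_def by blast
  interpret Kc: discrete_ito P F W "m n" "u n" "xc n" B for n
    unfolding u_def xc_def
    by (rule simple_process_discrete_ito[OF fps bm t sp]) (use clamp_abs_bound B in auto)
  interpret Kd: discrete_ito P F W "m n" "u n" "xd n" "\<bar>D n\<bar> + B" for n
    unfolding u_def xd_def
  proof (rule simple_process_discrete_ito[OF fps bm t sp, of "\<lambda>x. x - clamp_abs B x"])
    fix k \<omega> assume "k < m n" "\<omega> \<in> space P"
    from D[OF this] clamp_abs_bound[OF B, of "\<xi> n k \<omega>"]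
    show "\<bar>\<xi> n k \<omega> - clamp_abs B (\<xi> n k \<omega>)\<bar> \<le> \<bar>D n\<bar> + B" by linarith
  qed (use B in auto)
  define Z where "Z n = Kc.M n (m n)" for n
  define Zd where "Zd n = Kd.M n (m n)" for n
  define q where "q n \<omega> = (\<integral>\<^sup>+s\<in>{0..t}. ennreal ((simple_value (m n) (\<tau> n) (\<xi> n) s \<omega> - H s \<omega>)\<^sup>2) \<partial>lborel)" for n \<omega>
  have SI: "simple_integral_upto W (m n) (\<tau> n) (\<xi> n) t \<omega> = Z n \<omega> + Zd n \<omega>" for n \<omega>
    unfolding simple_integral_upto_def Z_def Zd_def Kc.M_def Kd.M_def Kc.\<Delta>_def Kd.\<Delta>_def sum.distrib[symmetric]
  proof (rule sum.cong[OF refl])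
    fix k assume "k \<in> {..<m n}"
    then have "\<tau> n k \<le> \<tau> n (Suc k)" using \<tau>_mono by auto
    then have "u n (Suc k) = u n k" if "\<not> \<tau> n k < t" using that unfolding u_def by (simp add: min_def)
    then show "\<xi> n k \<omega> * (W (min t (\<tau> n (Suc k))) \<omega> - W (min t (\<tau> n k)) \<omega>) =
        xc n k \<omega> * (W (u n (Suc k)) \<omega> - W (u n k) \<omega>) + xd n k \<omega> * (W (u n (Suc k)) \<omega> - W (u n k) \<omega>)"
      by (cases "\<tau> n k < t") (auto simp: xc_def xd_def algebra_simps simp flip: u_def)
  qed
  have u_diff: "(if \<tau> n k < t then y else 0)\<^sup>2 * (u n (Suc k) - u n k) = y\<^sup>2 * (u n (Suc k) - u n k)" if "k < m n" for n k y
    using \<tau>_mono[OF that] by (auto simp: u_def)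
  have q_sq: "ennreal (\<Sum>k<m n. (if \<tau> n k < t then \<phi> (\<xi> n k \<omega>) else 0)\<^sup>2 * (u n (Suc k) - u n k))
      = (\<integral>\<^sup>+s\<in>{0..t}. ennreal ((\<phi> (simple_value (m n) (\<tau> n) (\<xi> n) s \<omega>))\<^sup>2) \<partial>lborel)" if "\<phi> 0 = 0" for \<phi> n \<omega>
  proof -
    have "\<phi> (simple_value (m n) (\<tau> n) (\<xi> n) s \<omega>) = (\<Sum>k<m n. \<phi> (\<xi> n k \<omega>) * indicator {\<tau> n k<..\<tau> n (Suc k)} s)" for s
      unfolding simple_value_def
      by (rule step_function_map[where \<phi>=\<phi> and m="m n" and \<tau>="\<tau> n", OF \<tau>_mono that])
    moreover have "(\<Sum>k<m n. (if \<tau> n k < t then \<phi> (\<xi> n k \<omega>) else 0)\<^sup>2 * (u n (Suc k) - u n k))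
        = (\<Sum>k<m n. (\<phi> (\<xi> n k \<omega>))\<^sup>2 * (u n (Suc k) - u n k))"
      by (rule sum.cong) (simp_all only: u_diff lessThan_iff)
    ultimately show ?thesis
      using step_function_square_integral[where m="m n" and \<tau>="\<tau> n" and t=t and y="\<lambda>k. \<phi> (\<xi> n k \<omega>)", OF \<tau>_mono \<tau>0]
      by (simp only: u_def)
  qed
  have lm: "(\<lambda>x. simple_value (m n) (\<tau> n) (\<xi> n) (snd x) (fst x)) \<in> borel_measurable (P \<Otimes>\<^sub>M lborel)" for n
    unfolding simple_value_def
  proof (intro borel_measurable_sum borel_measurable_times)
    fix k assume "k \<in> {..<m n}"
    then show "(\<lambda>x. \<xi> n k (fst x)) \<in> borel_measurable (P \<Otimes>\<^sub>M lborel)"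
      using \<xi>_meas[of k n] by simp
  qed simp
  have Hm: "(\<lambda>x. H (max 0 (snd x)) (fst x)) \<in> borel_measurable (P \<Otimes>\<^sub>M lborel)"
    using measurable_compose[OF measurable_Pair[OF measurable_snd measurable_fst] H_meas]
    by (simp cong: measurable_cong_sets)
  have q_meas: "(\<lambda>\<omega>. \<integral>\<^sup>+s\<in>{0..t}. ennreal ((\<phi> (simple_value (m n) (\<tau> n) (\<xi> n) s \<omega>) - H s \<omega>)\<^sup>2) \<partial>lborel) \<in> borel_measurable P"
    if "\<phi> \<in> borel_measurable borel" for \<phi> n
  proof -
    have "(\<lambda>x. \<phi> (simple_value (m n) (\<tau> n) (\<xi> n) (snd x) (fst x))) \<in> borel_measurable (P \<Otimes>\<^sub>M lborel)"
      by (rule measurable_compose[OF lm that])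
    then have "(\<lambda>(\<omega>, s). ennreal ((\<phi> (simple_value (m n) (\<tau> n) (\<xi> n) s \<omega>) - H (max 0 s) \<omega>)\<^sup>2) * indicator {0..t} s) \<in> borel_measurable (P \<Otimes>\<^sub>M lborel)"
      using Hm by (simp add: case_prod_beta')
    from lborel.borel_measurable_nn_integral[OF this] show ?thesis
      by (rule back_subst[of "\<lambda>f. f \<in> borel_measurable P"])
        (intro ext nn_integral_cong, auto simp: indicator_def max_def)
  qed
  have q1: "q n \<in> borel_measurable P" for n unfolding q_def using q_meas[of "\<lambda>x. x"] by simp
  define qc where "qc n \<omega> = (\<integral>\<^sup>+s\<in>{0..t}. ennreal ((clamp_abs B (simple_value (m n) (\<tau> n) (\<xi> n) s \<omega>) - H s \<omega>)\<^sup>2) \<partial>lborel)" for n \<omega>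
  have qc_meas: "qc n \<in> borel_measurable P" for n unfolding qc_def using q_meas[of "clamp_abs B"] by simp
  have q_le: "qc n \<omega> \<le> q n \<omega>" "ennreal (\<Sum>k<m n. (xd n k \<omega>)\<^sup>2 * (u n (Suc k) - u n k)) \<le> q n \<omega>" if w: "\<omega> \<in> space P" for n \<omega>
  proof -
    show "qc n \<omega> \<le> q n \<omega>" unfolding q_def qc_def
    proof (rule nn_integral_mono)
      fix s
      have "(clamp_abs B y - H s \<omega>)\<^sup>2 \<le> (y - H s \<omega>)\<^sup>2" if "0 \<le> s" for y
        using clamp_abs_dist(1)[OF H_bound[OF that w]] by (simp add: abs_le_square_iff[symmetric])
      then show "ennreal ((clamp_abs B (simple_value (m n) (\<tau> n) (\<xi> n) s \<omega>) - H s \<omega>)\<^sup>2) * indicator {0..t} s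
        \<le> ennreal ((simple_value (m n) (\<tau> n) (\<xi> n) s \<omega> - H s \<omega>)\<^sup>2) * indicator {0..t} s"
        by (auto simp: indicator_def intro: ennreal_leI)
    qed
    have e: "ennreal (\<Sum>k<m n. (xd n k \<omega>)\<^sup>2 * (u n (Suc k) - u n k)) =
      (\<integral>\<^sup>+s\<in>{0..t}. ennreal ((simple_value (m n) (\<tau> n) (\<xi> n) s \<omega> - clamp_abs B (simple_value (m n) (\<tau> n) (\<xi> n) s \<omega>))\<^sup>2) \<partial>lborel)"
      unfolding xd_def by (rule q_sq[of "\<lambda>x. x - clamp_abs B x"]) (simp add: clamp_abs_0 B)
    show "ennreal (\<Sum>k<m n. (xd n k \<omega>)\<^sup>2 * (u n (Suc k) - u n k)) \<le> q n \<omega>" unfolding q_def e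
    proof (rule nn_integral_mono)
      fix s
      have "(y - clamp_abs B y)\<^sup>2 \<le> (y - H s \<omega>)\<^sup>2" if "0 \<le> s" for y
        using clamp_abs_dist(2)[OF H_bound[OF that w]] by (simp add: abs_le_square_iff[symmetric])
      then show "ennreal ((simple_value (m n) (\<tau> n) (\<xi> n) s \<omega> - clamp_abs B (simple_value (m n) (\<tau> n) (\<xi> n) s \<omega>))\<^sup>2) * indicator {0..t} s
        \<le> ennreal ((simple_value (m n) (\<tau> n) (\<xi> n) s \<omega> - H s \<omega>)\<^sup>2) * indicator {0..t} s"
        by (auto simp: indicator_def intro: ennreal_leI)
    qed
  qed
  have n1': "(\<lambda>n. prob {\<omega>\<in>space P. ennreal e < q n \<omega>}) \<longlonglongrightarrow> 0" if "0 < e" for e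
    using n1 that unfolding null_in_probability_def q_def by blast
  have Z_meas: "Z n \<in> borel_measurable P" "Zd n \<in> borel_measurable P" for n
    unfolding Z_def Zd_def
    by (rule filtered_measurable_P[OF fps Kc.M_meas[OF order_refl]], rule filtered_measurable_P[OF fps Kd.M_meas[OF order_refl]])
  have u_diff_t: "u n (m n) - u n 0 \<le> t" "0 \<le> u n (m n) - u n 0" for n
    using Kc.u0[of n] Kc.u_mono[of 0 "m n" n] by (auto simp: u_def)
  have Zd_null: "(\<lambda>n. prob {\<omega>\<in>space P. e < \<bar>Zd n \<omega>\<bar>}) \<longlonglongrightarrow> 0" if e: "0 < e" for e
  proof (rule LIMSEQ_I)
    fix g :: real assume g: "0 < g"
    \<comment> \<open>Chosen so that \<open>d / e\<^sup>2\<close> uses up half of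
      \<open>g\<close>.\<close>
    define d where "d = g * e\<^sup>2 / 2"
    have d: "0 < d" using e g by (simp add: d_def)
    have "\<forall>\<^sub>F n in sequentially. prob {\<omega>\<in>space P. ennreal d < q n \<omega>} < g / 2"
      using order_tendstoD(2)[OF n1'[OF d], of "g / 2"] g by simp
    then have "\<forall>\<^sub>F n in sequentially. prob {\<omega>\<in>space P. e < \<bar>Zd n \<omega>\<bar>} < g"
    proof eventually_elim
      case (elim n)
      have "prob {\<omega>\<in>space P. e < \<bar>Zd n \<omega>\<bar>} \<le> d / e\<^sup>2 + prob {\<omega>\<in>space P. d < (\<Sum>k<m n. (xd n k \<omega>)\<^sup>2 * (u n (Suc k) - u n k))}"
        unfolding Zd_def by (rule Kd.M_prob_le[OF e d])
      also have "prob {\<omega>\<in>space P. d < (\<Sum>k<m n. (xd n k \<omega>)\<^sup>2 * (u n (Suc k) - u n k))} \<le> prob {\<omega>\<in>space P. ennreal d < q n \<omega>}"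
      proof (rule finite_measure_mono)
        show "{\<omega>\<in>space P. d < (\<Sum>k<m n. (xd n k \<omega>)\<^sup>2 * (u n (Suc k) - u n k))} \<subseteq> {\<omega>\<in>space P. ennreal d < q n \<omega>}"
        proof safe
          fix \<omega> assume w: "\<omega> \<in> space P" "d < (\<Sum>k<m n. (xd n k \<omega>)\<^sup>2 * (u n (Suc k) - u n k))"
          have "ennreal d < ennreal (\<Sum>k<m n. (xd n k \<omega>)\<^sup>2 * (u n (Suc k) - u n k))"
            using w(2) d by (simp add: ennreal_less_iff)
          also have "\<dots> \<le> q n \<omega>" by (rule q_le(2)[OF w(1)])
          finally show "ennreal d < q n \<omega>" .
        qed
        show "{\<omega>\<in>space P. ennreal d < q n \<omega>} \<in> sets P" using q1 by measurable
      qed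
      finally show ?case using elim e by (simp add: d_def)
    qed
    then show "\<exists>no. \<forall>n\<ge>no. norm (prob {\<omega>\<in>space P. e < \<bar>Zd n \<omega>\<bar>} - 0) < g"
      by (simp add: eventually_sequentially)
  qed
  show ?thesis
  proof (rule that[of Z])
    show "Z n \<in> borel_measurable P" for n by (rule Z_meas)
    show "integrable P (\<lambda>\<omega>. Z n \<omega> ^ i)" if "i \<le> 4" for n i
      unfolding Z_def by (rule Kc.M_integrable[OF order_refl that])
    show "(\<integral>\<omega>. Z n \<omega> \<partial>P) = 0" for n unfolding Z_def by (rule Kc.M_mean[OF order_refl])
    show "(\<integral>\<omega>. (Z n \<omega>)\<^sup>2 \<partial>P) \<le> B\<^sup>2 * t" for n
      using Kc.M_second_moment_le[OF order_refl, of n] mult_left_mono[OF u_diff_t(1)[of n], of "B\<^sup>2"]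
      unfolding Z_def by simp
    show "(\<integral>\<omega>. Z n \<omega> ^ 4 \<partial>P) \<le> 3 * B ^ 4 * t\<^sup>2" for n
    proof -
      have "(u n (m n) - u n 0)\<^sup>2 \<le> t\<^sup>2" using u_diff_t[of n] by (intro power_mono) auto
      then have "3 * B ^ 4 * (u n (m n) - u n 0)\<^sup>2 \<le> 3 * B ^ 4 * t\<^sup>2" using B by (intro mult_left_mono) auto
      then show ?thesis using Kc.M_fourth_moment_le[OF order_refl, of n] unfolding Z_def by simp
    qed
    show "(\<lambda>n. measure P {\<omega>\<in>space P. e < \<bar>Z n \<omega> - I \<omega>\<bar>}) \<longlonglongrightarrow> 0" if e: "0 < e" for e
    proof (rule tendsto_sandwich[OF _ _ tendsto_const])
      have "(\<lambda>n. prob {\<omega>\<in>space P. e / 2 < \<bar>Zd n \<omega>\<bar>} + prob {\<omega>\<in>space P. ennreal (e / 2) < ennreal \<bar>simple_integral_upto W (m n) (\<tau> n) (\<xi> n) t \<omega> - I \<omega>\<bar>}) \<longlonglongrightarrow> 0 + 0"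
        using n2 e unfolding null_in_probability_def by (intro tendsto_add Zd_null) auto
      then show "(\<lambda>n. prob {\<omega>\<in>space P. e / 2 < \<bar>Zd n \<omega>\<bar>} + prob {\<omega>\<in>space P. e / 2 < \<bar>Z n \<omega> + Zd n \<omega> - I \<omega>\<bar>}) \<longlonglongrightarrow> 0"
        using e by (simp add: SI ennreal_less_iff)
      have "prob {\<omega>\<in>space P. e < \<bar>Z n \<omega> - I \<omega>\<bar>} \<le> prob {\<omega>\<in>space P. e / 2 < \<bar>Zd n \<omega>\<bar>} + prob {\<omega>\<in>space P. e / 2 < \<bar>Z n \<omega> + Zd n \<omega> - I \<omega>\<bar>}" for n
      proof -
        have m: "{\<omega>\<in>space P. e / 2 < \<bar>Zd n \<omega>\<bar>} \<in> sets P" "{\<omega>\<in>space P. e / 2 < \<bar>Z n \<omega> + Zd n \<omega> - I \<omega>\<bar>} \<in> sets P"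
          using Z_meas I_meas by measurable
        have "{\<omega>\<in>space P. e < \<bar>Z n \<omega> - I \<omega>\<bar>} \<subseteq> {\<omega>\<in>space P. e / 2 < \<bar>Zd n \<omega>\<bar>} \<union> {\<omega>\<in>space P. e / 2 < \<bar>Z n \<omega> + Zd n \<omega> - I \<omega>\<bar>}"
        proof safe
          fix \<omega> assume "e < \<bar>Z n \<omega> - I \<omega>\<bar>" "\<not> e / 2 < \<bar>Z n \<omega> + Zd n \<omega> - I \<omega>\<bar>"
          then show "e / 2 < \<bar>Zd n \<omega>\<bar>" by linarith
        qed
        then have "prob {\<omega>\<in>space P. e < \<bar>Z n \<omega> - I \<omega>\<bar>} \<le> prob ({\<omega>\<in>space P. e / 2 < \<bar>Zd n \<omega>\<bar>} \<union> {\<omega>\<in>space P. e / 2 < \<bar>Z n \<omega> + Zd n \<omega> - I \<omega>\<bar>})"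
          using m by (intro finite_measure_mono) auto
        also note measure_Un_le[OF m]
        finally show ?thesis .
      qed
      then show "\<forall>\<^sub>F n in sequentially. prob {\<omega>\<in>space P. e < \<bar>Z n \<omega> - I \<omega>\<bar>} \<le> prob {\<omega>\<in>space P. e / 2 < \<bar>Zd n \<omega>\<bar>} + prob {\<omega>\<in>space P. e / 2 < \<bar>Z n \<omega> + Zd n \<omega> - I \<omega>\<bar>}"
        by simp
    qed auto
    show "\<forall>\<^sub>F n in sequentially. (\<integral>\<^sup>+\<omega>. (\<integral>\<^sup>+s\<in>{0..t}. ennreal ((H s \<omega>)\<^sup>2) \<partial>lborel) \<partial>P) \<le> ennreal (2 * (\<integral>\<omega>. (Z n \<omega>)\<^sup>2 \<partial>P) + e)"
      if e: "0 < e" for e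
    proof -
      \<comment> \<open>\<open>G\<close> bounds the clamped error \<open>qc\<close> everywhere, and
        \<open>qc\<close> is at most \<open>e1\<close> off an event of probability below
        \<open>e1\<close>; the choice gives \<open>e1 + G * e1 = e / 2\<close>.\<close>
      define G where "G = 4 * B\<^sup>2 * t"
      define e1 where "e1 = e / (2 * (1 + G))"
      have G: "0 \<le> G" using t by (simp add: G_def)
      have e1: "0 < e1" using e G by (simp add: e1_def)
      have "\<forall>\<^sub>F n in sequentially. prob {\<omega>\<in>space P. ennreal e1 < q n \<omega>} < e1"
        using order_tendstoD(2)[OF n1'[OF e1] e1] .
      then show ?thesis
      proof eventually_elim
        case (elim n)
        let ?A = "{\<omega>\<in>space P. ennreal e1 < q n \<omega>}"
        let ?sv = "\<lambda>s \<omega>. clamp_abs B (simple_value (m n) (\<tau> n) (\<xi> n) s \<omega>)"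
        have A: "?A \<in> sets P" using q1 by measurable
        have qc_b: "qc n \<omega> \<le> ennreal e1 + ennreal G * indicator ?A \<omega>" if w: "\<omega> \<in> space P" for \<omega>
        proof (cases "\<omega> \<in> ?A")
          case True
          have "qc n \<omega> \<le> (\<integral>\<^sup>+s. ennreal (4 * B\<^sup>2) * indicator {0..t} s \<partial>lborel)" unfolding qc_def
          proof (rule nn_integral_mono)
            fix s
            have "(clamp_abs B y - H s \<omega>)\<^sup>2 \<le> 4 * B\<^sup>2" if "0 \<le> s" for y
            proof -
              have "\<bar>clamp_abs B y - H s \<omega>\<bar> \<le> 2 * B"
                using clamp_abs_bound[OF B, of y] H_bound[OF that w] by linarith
              from power_mono[OF this, of 2] show ?thesis by (simp add: power_mult_distrib)
            qed
            then show "ennreal ((?sv s \<omega> - H s \<omega>)\<^sup>2) * indicator {0..t} s \<le> ennreal (4 * B\<^sup>2) * indicator {0..t} s"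
              by (auto simp: indicator_def intro: ennreal_leI)
          qed
          also have "\<dots> = ennreal G"
            using t by (subst nn_integral_cmult_indicator) (simp_all add: G_def ennreal_mult)
          finally show ?thesis using True by (simp add: add_increasing)
        next
          case False
          then show ?thesis using q_le(1)[OF w, of n] w by (auto simp: not_less)
        qed
        have "(\<integral>\<^sup>+\<omega>. qc n \<omega> \<partial>P) \<le> (\<integral>\<^sup>+\<omega>. ennreal e1 + ennreal G * indicator ?A \<omega> \<partial>P)"
          by (rule nn_integral_mono[OF qc_b])
        also have "\<dots> = ennreal e1 + ennreal G * emeasure P ?A"
          using A by (simp add: nn_integral_add nn_integral_cmult_indicator emeasure_space_1)
        also have "\<dots> = ennreal (e1 + G * prob ?A)"
          using e1 G by (simp add: emeasure_eq_measure ennreal_mult)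
        also have "\<dots> \<le> ennreal (e1 + G * e1)"
          using elim G by (intro ennreal_leI add_left_mono mult_left_mono) auto
        also have "e1 + G * e1 = e / 2"
        proof -
          have "e1 + G * e1 = (1 + G) * e1" by (simp add: algebra_simps)
          also have "\<dots> = e / 2" using G unfolding e1_def by (simp add: divide_simps)
          finally show ?thesis .
        qed
        finally have qcE: "(\<integral>\<^sup>+\<omega>. qc n \<omega> \<partial>P) \<le> ennreal (e / 2)" .
        \<comment> \<open>\<open>R\<close> is the quadratic variation of \<open>Z n\<close>, so its
          mean is the second moment of \<open>Z n\<close>. Comparing \<open>H\<close> with the
          clamped integrand by a crude inequality for squares costs a factor 2, which resurfaces as
          \<open>h / 4\<close> instead of \<open>h / 2\<close> in the expansion.\<close>
        define R where "R \<omega> = (\<Sum>k<m n. (xc n k \<omega>)\<^sup>2 * (u n (Suc k) - u n k))" for \<omega>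
        have xc2: "integrable P (\<lambda>\<omega>. (xc n k \<omega>)\<^sup>2)" if "k < m n" for k
          using Kc.mixed_integrable(2)[OF that _ Kc.M4_integrable, of 0 2] that by simp
        have Ri: "integrable P R" unfolding R_def
          by (intro Bochner_Integration.integrable_sum integrable_mult_left xc2) auto
        have R0: "0 \<le> R \<omega>" for \<omega> unfolding R_def using Kc.u_step[of _ n]
          by (intro sum_nonneg mult_nonneg_nonneg) auto
        have RE: "expectation R = expectation (\<lambda>\<omega>. (Z n \<omega>)\<^sup>2)"
          unfolding Z_def Kc.M_second_moment[OF order_refl] R_def
          by (subst Bochner_Integration.integral_sum) (use xc2 in auto)
        have Rq: "ennreal (R \<omega>) = (\<integral>\<^sup>+s\<in>{0..t}. ennreal ((?sv s \<omega>)\<^sup>2) \<partial>lborel)" for \<omega>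
          unfolding R_def xc_def by (rule q_sq) (rule clamp_abs_0[OF B])
        have "(\<integral>\<^sup>+s\<in>{0..t}. ennreal ((H s \<omega>)\<^sup>2) \<partial>lborel) \<le> 2 * ennreal (R \<omega>) + 2 * qc n \<omega>" if w: "\<omega> \<in> space P" for \<omega>
        proof -
          have msv: "(\<lambda>s. ?sv s \<omega>) \<in> borel_measurable lborel" unfolding simple_value_def by measurable
          have mH: "(\<lambda>s. H (max 0 s) \<omega>) \<in> borel_measurable lborel"
            using measurable_compose[OF measurable_Pair1'[OF w] Hm] by simp
          have "(\<integral>\<^sup>+s\<in>{0..t}. ennreal ((H s \<omega>)\<^sup>2) \<partial>lborel) \<le>
             (\<integral>\<^sup>+s. 2 * (ennreal ((?sv s \<omega>)\<^sup>2) * indicator {0..t} s) + 2 * (ennreal ((?sv s \<omega> - H (max 0 s) \<omega>)\<^sup>2) * indicator {0..t} s) \<partial>lborel)"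
          proof (rule nn_integral_mono)
            fix s
            have "h\<^sup>2 \<le> 2 * y\<^sup>2 + 2 * (y - h)\<^sup>2" for h y :: real
              using zero_le_power2[of "h - 2 * y"] by (simp add: power2_eq_square algebra_simps)
            then have "ennreal (h\<^sup>2) \<le> 2 * ennreal (y\<^sup>2) + 2 * ennreal ((y - h)\<^sup>2)" for h y :: real
              using ennreal_leI[of "h\<^sup>2" "2 * y\<^sup>2 + 2 * (y - h)\<^sup>2"] by (simp add: ennreal_mult)
            then show "ennreal ((H s \<omega>)\<^sup>2) * indicator {0..t} s \<le> 2 * (ennreal ((?sv s \<omega>)\<^sup>2) * indicator {0..t} s) + 2 * (ennreal ((?sv s \<omega> - H (max 0 s) \<omega>)\<^sup>2) * indicator {0..t} s)"
              by (auto simp: indicator_def max_def)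
          qed
          also have "\<dots> = 2 * ennreal (R \<omega>) + 2 * qc n \<omega>"
          proof -
            have "qc n \<omega> = (\<integral>\<^sup>+s\<in>{0..t}. ennreal ((?sv s \<omega> - H (max 0 s) \<omega>)\<^sup>2) \<partial>lborel)"
              unfolding qc_def by (rule nn_integral_cong) (auto simp: indicator_def max_def)
            then show ?thesis unfolding Rq using msv mH by (simp add: nn_integral_add nn_integral_cmult)
          qed
          finally show ?thesis .
        qed
        then have "(\<integral>\<^sup>+\<omega>. (\<integral>\<^sup>+s\<in>{0..t}. ennreal ((H s \<omega>)\<^sup>2) \<partial>lborel) \<partial>P) \<le> (\<integral>\<^sup>+\<omega>. 2 * ennreal (R \<omega>) + 2 * qc n \<omega> \<partial>P)"
          by (rule nn_integral_mono)
        also have "\<dots> = 2 * (\<integral>\<^sup>+\<omega>. ennreal (R \<omega>) \<partial>P) + 2 * (\<integral>\<^sup>+\<omega>. qc n \<omega> \<partial>P)"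
          using Ri qc_meas by (simp add: nn_integral_add nn_integral_cmult)
        also have "\<dots> \<le> 2 * ennreal (expectation R) + 2 * ennreal (e / 2)"
          using qcE Ri R0 by (intro add_mono mult_left_mono) (auto simp: nn_integral_eq_integral)
        also have "\<dots> = ennreal (2 * expectation (\<lambda>\<omega>. (Z n \<omega>)\<^sup>2) + e)"
          using e R0 unfolding RE[symmetric] by (simp add: ennreal_mult[symmetric] ennreal_plus[symmetric] Bochner_Integration.integral_nonneg del: ennreal_plus flip: ennreal_numeral)
        finally show ?case .
      qed
    qed
  qed
qed

section \<open>Moments and expansion of the limit integral\<close>

lemma (in prob_space) expectation_lipschitz_limit:
  fixes Z :: "nat \<Rightarrow> 'a \<Rightarrow> real"
  assumes Z: "\<And>n. Z n \<in> borel_measurable M" and I: "I \<in> borel_measurable M"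
    and conv: "\<And>e. 0 < e \<Longrightarrow> (\<lambda>n. prob {\<omega>\<in>space M. e < \<bar>Z n \<omega> - I \<omega>\<bar>}) \<longlonglongrightarrow> 0"
    and g: "continuous_on UNIV g" "\<And>x. \<bar>g x\<bar> \<le> G" "\<And>x y. \<bar>g x - g y\<bar> \<le> L * \<bar>x - y\<bar>"
  shows "(\<lambda>n. expectation (\<lambda>\<omega>. g (Z n \<omega>))) \<longlonglongrightarrow> expectation (\<lambda>\<omega>. g (I \<omega>))"
proof (rule LIMSEQ_I)
  fix r :: real assume r: "0 < r"
  have G: "0 \<le> G" using g(2)[of 0] by linarith
  have L: "0 \<le> L" using g(3)[of 0 1] by simp
  have gm: "g \<in> borel_measurable borel" using g(1) by (rule borel_measurable_continuous_onI)
  have int: "integrable M (\<lambda>\<omega>. g (Y \<omega>))" if "Y \<in> borel_measurable M" for Y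
    by (rule integrable_const_bound[where B=G]) (use g(2) measurable_compose[OF that gm] in auto)
  \<comment> \<open>The radius makes \<open>L * e\<close> at most half of \<open>r\<close>, and
    \<open>q\<close> below is a probability for which the exceptional event takes less than the
    remainder. The added ones avoid division by zero.\<close>
  define e where "e = r / (2 * (L + 1))"
  have e: "0 < e" using r L by (simp add: e_def)
  have "L * e < r"
  proof -
    have "L * e \<le> (L + 1) * e" using e by simp
    also have "\<dots> = r / 2" using L by (simp add: e_def divide_simps)
    finally show ?thesis using r by simp
  qed
  note e = e this
  define q where "q = (r - L * e) / (2 * G + 1)"
  have q: "0 < q" using e G by (simp add: q_def)
  have "\<forall>\<^sub>F n in sequentially. prob {\<omega>\<in>space M. e < \<bar>Z n \<omega> - I \<omega>\<bar>} < q"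
    using order_tendstoD(2)[OF conv[OF e(1)] q] .
  then have "\<forall>\<^sub>F n in sequentially. norm (expectation (\<lambda>\<omega>. g (Z n \<omega>)) - expectation (\<lambda>\<omega>. g (I \<omega>))) < r"
  proof eventually_elim
    case (elim n)
    let ?A = "{\<omega>\<in>space M. e < \<bar>Z n \<omega> - I \<omega>\<bar>}"
    have A: "?A \<in> sets M" using Z I by measurable
    have iA: "integrable M (\<lambda>\<omega>. 2 * G * indicator ?A \<omega>)"
      using A by (intro integrable_mult_right integrable_real_indicator) (auto simp: less_top[symmetric])
    have "norm (expectation (\<lambda>\<omega>. g (Z n \<omega>)) - expectation (\<lambda>\<omega>. g (I \<omega>))) = norm (expectation (\<lambda>\<omega>. g (Z n \<omega>) - g (I \<omega>)))"
      using int[OF Z] int[OF I] by simp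
    also have "\<dots> \<le> expectation (\<lambda>\<omega>. norm (g (Z n \<omega>) - g (I \<omega>)))"
      by (rule integral_norm_bound)
    also have "\<dots> \<le> expectation (\<lambda>\<omega>. L * e + 2 * G * indicator ?A \<omega>)"
    proof (rule integral_mono)
      fix \<omega> assume w: "\<omega> \<in> space M"
      show "norm (g (Z n \<omega>) - g (I \<omega>)) \<le> L * e + 2 * G * indicator ?A \<omega>"
      proof (cases "\<omega> \<in> ?A")
        case True
        have "norm (g (Z n \<omega>) - g (I \<omega>)) \<le> 2 * G" using g(2)[of "Z n \<omega>"] g(2)[of "I \<omega>"] by simp
        moreover have "0 \<le> L * e" using L e(1) by simp
        ultimately show ?thesis using True by simp
      next
        case False
        then have "L * \<bar>Z n \<omega> - I \<omega>\<bar> \<le> L * e" using w L by (intro mult_left_mono) auto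
        then show ?thesis using False g(3)[of "Z n \<omega>" "I \<omega>"] by simp
      qed
    next
      show "integrable M (\<lambda>\<omega>. L * e + 2 * G * indicator ?A \<omega>)"
        using iA by simp
    qed (use int[OF Z] int[OF I] in auto)
    also have "\<dots> = L * e + 2 * G * prob ?A"
    proof -
      have "expectation (\<lambda>\<omega>. 2 * G * indicator ?A \<omega>) = 2 * G * prob ?A"
        using A by (subst integral_mult_right_zero) (simp add: Int_absorb2 sets.sets_into_space)
      then show ?thesis using iA by (simp only: Bochner_Integration.integral_add[OF integrable_const iA])
        (simp add: prob_space)
    qed
    also have "\<dots> \<le> L * e + 2 * G * q" using elim G by (intro add_left_mono mult_left_mono) auto
    also have "\<dots> < L * e + (2 * G + 1) * q" using q by (simp add: algebra_simps)
    also have "\<dots> = r" using G by (simp add: q_def divide_simps)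
    finally show ?case .
  qed
  then show "\<exists>no. \<forall>n\<ge>no. norm (expectation (\<lambda>\<omega>. g (Z n \<omega>)) - expectation (\<lambda>\<omega>. g (I \<omega>))) < r"
    by (simp add: eventually_sequentially)
qed

lemma min_abs_square_lipschitz:
  assumes "0 \<le> (K::real)"
  shows "\<bar>(min \<bar>x\<bar> K)\<^sup>2 - (min \<bar>y\<bar> K)\<^sup>2\<bar> \<le> 2 * K * \<bar>x - y\<bar>"
proof -
  let ?a = "min \<bar>x\<bar> K" and ?b = "min \<bar>y\<bar> K"
  have "\<bar>?a\<^sup>2 - ?b\<^sup>2\<bar> = (?a + ?b) * \<bar>?a - ?b\<bar>"
    using assms unfolding square_diff_square_factored power2_eq_square abs_mult by simp
  also have "\<dots> \<le> (2 * K) * \<bar>x - y\<bar>"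
    using assms by (intro mult_mono) auto
  finally show ?thesis .
qed

text \<open>Squares cut off at level \<open>K\<close> are bounded Lipschitz functions, through which
  the bound passes to the limit in probability; Fatou's lemma then removes the cutoff.\<close>

lemma bounded_ito_second_moment:
  assumes fps: "filtered_prob_space P F" and bm: "standard_brownian_motion P F W" and t: "0 \<le> t"
    and ito: "has_ito_integral P F W H t I"
    and H_meas: "(\<lambda>(s, \<omega>). H (max 0 s) \<omega>) \<in> borel_measurable (borel \<Otimes>\<^sub>M P)"
    and H_bound: "\<And>s \<omega>. 0 \<le> s \<Longrightarrow> \<omega> \<in> space P \<Longrightarrow> \<bar>H s \<omega>\<bar> \<le> B" and B: "0 \<le> B"
  shows "(\<integral>\<^sup>+\<omega>. ennreal ((I \<omega>)\<^sup>2) \<partial>P) \<le> ennreal (B\<^sup>2 * t)"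
proof -
  interpret prob_space P using filtered_prob_spaceD(1)[OF fps] .
  have I: "I \<in> borel_measurable P" using ito unfolding has_ito_integral_def by blast
  obtain Z where Z: "\<And>n. Z n \<in> borel_measurable P" "\<And>n i. i \<le> 4 \<Longrightarrow> integrable P (\<lambda>\<omega>. Z n \<omega> ^ i)"
    "\<And>n. (\<integral>\<omega>. (Z n \<omega>)\<^sup>2 \<partial>P) \<le> B\<^sup>2 * t"
    "\<And>e. 0 < e \<Longrightarrow> (\<lambda>n. measure P {\<omega>\<in>space P. e < \<bar>Z n \<omega> - I \<omega>\<bar>}) \<longlonglongrightarrow> 0"
    by (rule bounded_ito_approximation[OF fps bm t ito H_meas H_bound B]) blast+
  have le: "expectation (\<lambda>\<omega>. (min \<bar>I \<omega>\<bar> (real K))\<^sup>2) \<le> B\<^sup>2 * t" for K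
  proof (rule tendsto_upperbound)
    show "(\<lambda>n. expectation (\<lambda>\<omega>. (min \<bar>Z n \<omega>\<bar> (real K))\<^sup>2)) \<longlonglongrightarrow> expectation (\<lambda>\<omega>. (min \<bar>I \<omega>\<bar> (real K))\<^sup>2)"
      by (rule expectation_lipschitz_limit[OF Z(1) I Z(4), where G="(real K)\<^sup>2" and L="2 * real K"])
        (auto intro!: min_abs_square_lipschitz power_mono continuous_intros)
    have "expectation (\<lambda>\<omega>. (min \<bar>Z n \<omega>\<bar> (real K))\<^sup>2) \<le> expectation (\<lambda>\<omega>. (Z n \<omega>)\<^sup>2)" for n
    proof (rule integral_mono)
      show "integrable P (\<lambda>\<omega>. (min \<bar>Z n \<omega>\<bar> (real K))\<^sup>2)"
        by (rule integrable_const_bound[where B="(real K)\<^sup>2"]) (use Z(1) in \<open>auto intro!: power_mono\<close>)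
      show "(min \<bar>Z n \<omega>\<bar> (real K))\<^sup>2 \<le> (Z n \<omega>)\<^sup>2" for \<omega>
        using power_mono[of "min \<bar>Z n \<omega>\<bar> (real K)" "\<bar>Z n \<omega>\<bar>" 2] by simp
    qed (use Z(2)[of 2] in simp)
    then show "\<forall>\<^sub>F n in sequentially. expectation (\<lambda>\<omega>. (min \<bar>Z n \<omega>\<bar> (real K))\<^sup>2) \<le> B\<^sup>2 * t"
      using Z(3) order_trans by (intro always_eventually allI) blast
  qed simp
  have "(\<integral>\<^sup>+\<omega>. ennreal ((I \<omega>)\<^sup>2) \<partial>P) = (\<integral>\<^sup>+\<omega>. liminf (\<lambda>K. ennreal ((min \<bar>I \<omega>\<bar> (real K))\<^sup>2)) \<partial>P)"
  proof (rule nn_integral_cong)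
    fix \<omega>
    have "\<forall>\<^sub>F K in sequentially. ennreal ((min \<bar>I \<omega>\<bar> (real K))\<^sup>2) = ennreal ((I \<omega>)\<^sup>2)"
      using eventually_ge_at_top[of "nat \<lceil>\<bar>I \<omega>\<bar>\<rceil>"]
    proof eventually_elim
      case (elim K)
      then have "\<bar>I \<omega>\<bar> \<le> real K" by linarith
      then show ?case by (simp add: min_absorb1)
    qed
    then show "ennreal ((I \<omega>)\<^sup>2) = liminf (\<lambda>K. ennreal ((min \<bar>I \<omega>\<bar> (real K))\<^sup>2))"
      by (intro lim_imp_Liminf[OF _ tendsto_eventually, symmetric]) simp_all
  qed
  also have "\<dots> \<le> liminf (\<lambda>K. \<integral>\<^sup>+\<omega>. ennreal ((min \<bar>I \<omega>\<bar> (real K))\<^sup>2) \<partial>P)"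
    using I by (intro nn_integral_liminf) auto
  also have "\<dots> \<le> ennreal (B\<^sup>2 * t)"
  proof (rule Liminf_le)
    have "(\<integral>\<^sup>+\<omega>. ennreal ((min \<bar>I \<omega>\<bar> (real K))\<^sup>2) \<partial>P) = ennreal (expectation (\<lambda>\<omega>. (min \<bar>I \<omega>\<bar> (real K))\<^sup>2))" for K
      by (intro nn_integral_eq_integral integrable_const_bound[where B="(real K)\<^sup>2"])
        (use I in \<open>auto intro!: power_mono\<close>)
    then show "\<forall>\<^sub>F K in sequentially. (\<integral>\<^sup>+\<omega>. ennreal ((min \<bar>I \<omega>\<bar> (real K))\<^sup>2) \<partial>P) \<le> ennreal (B\<^sup>2 * t)"
      using le by (simp add: ennreal_leI)
  qed simp
  finally show ?thesis .
qed

text \<open>The inequality of arithmetic and geometric means. With \<open>s = sqrt t\<close> it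
  balances a second moment of order \<open>t\<close> against a fourth moment of order
  \<open>t\<^sup>2\<close> and gives the third absolute moment the order
  \<open>t * sqrt t\<close>.\<close>

lemma abs_cube_le:
  fixes x :: real assumes "0 < s"
  shows "\<bar>x\<bar> ^ 3 \<le> (s * x\<^sup>2 + x ^ 4 / s) / 2"
proof -
  have "0 \<le> x\<^sup>2 * (s - \<bar>x\<bar>)\<^sup>2 / s" using assms by simp
  also have "\<dots> = s * x\<^sup>2 + x ^ 4 / s - 2 * \<bar>x\<bar> ^ 3"
    using assms by (simp add: field_simps power2_eq_square power3_eq_cube power4_eq_xxxx)
  finally show ?thesis by simp
qed

text \<open>The first-order term drops out because \<open>Z n\<close> has mean zero. The curvature
  is split as \<open>h - w\<close>: for \<open>h\<close> the second moment of \<open>Z n\<close> is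
  bounded below through \<open>Q\<close>, for \<open>w\<close> it is bounded above by
  \<open>B\<^sup>2 * t\<close>. The cubic remainder is handled by \<open>abs_cube_le\<close>, and
  the limit in \<open>n\<close> is taken for the bounded Lipschitz function
  \<open>f\<close>.\<close>

lemma bounded_ito_expansion:
  assumes fps: "filtered_prob_space P F" and bm: "standard_brownian_motion P F W" and t: "0 < t"
    and ito: "has_ito_integral P F W H t I"
    and H_meas: "(\<lambda>(s, \<omega>). H (max 0 s) \<omega>) \<in> borel_measurable (borel \<Otimes>\<^sub>M P)"
    and H_bound: "\<And>s \<omega>. 0 \<le> s \<Longrightarrow> \<omega> \<in> space P \<Longrightarrow> \<bar>H s \<omega>\<bar> \<le> B" and B: "0 \<le> B"
    and f: "continuous_on UNIV f" "\<And>x. \<bar>f x\<bar> \<le> Fb" "\<And>x y. \<bar>f x - f y\<bar> \<le> Fl * \<bar>x - y\<bar>"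
    and taylor: "\<And>y. \<bar>f (x + y) - f x - f1 * y - (h - w) / 2 * y\<^sup>2\<bar> \<le> L * \<bar>y\<bar> ^ 3"
    and h: "0 \<le> h" and w: "0 \<le> w" and L: "0 \<le> L"
    and Q: "0 \<le> Q" "ennreal Q \<le> (\<integral>\<^sup>+\<omega>. (\<integral>\<^sup>+s\<in>{0..t}. ennreal ((H s \<omega>)\<^sup>2) \<partial>lborel) \<partial>P)"
  shows "f x + h / 4 * Q - w / 2 * (B\<^sup>2 * t) - L * ((B\<^sup>2 + 3 * B ^ 4) / 2 * (t * sqrt t)) \<le> (\<integral>\<omega>. f (x + I \<omega>) \<partial>P)"
proof -
  interpret prob_space P using filtered_prob_spaceD(1)[OF fps] .
  have I: "I \<in> borel_measurable P" using ito unfolding has_ito_integral_def by blast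
  obtain Z where Z: "\<And>n. Z n \<in> borel_measurable P" "\<And>n i. i \<le> 4 \<Longrightarrow> integrable P (\<lambda>\<omega>. Z n \<omega> ^ i)"
    "\<And>n. (\<integral>\<omega>. Z n \<omega> \<partial>P) = 0" "\<And>n. (\<integral>\<omega>. (Z n \<omega>)\<^sup>2 \<partial>P) \<le> B\<^sup>2 * t" "\<And>n. (\<integral>\<omega>. Z n \<omega> ^ 4 \<partial>P) \<le> 3 * B ^ 4 * t\<^sup>2"
    "\<And>e. 0 < e \<Longrightarrow> (\<lambda>n. measure P {\<omega>\<in>space P. e < \<bar>Z n \<omega> - I \<omega>\<bar>}) \<longlonglongrightarrow> 0"
    "\<And>e. 0 < e \<Longrightarrow> \<forall>\<^sub>F n in sequentially.
       (\<integral>\<^sup>+\<omega>. (\<integral>\<^sup>+s\<in>{0..t}. ennreal ((H s \<omega>)\<^sup>2) \<partial>lborel) \<partial>P) \<le> ennreal (2 * (\<integral>\<omega>. (Z n \<omega>)\<^sup>2 \<partial>P) + e)"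
    by (rule bounded_ito_approximation[OF fps bm less_imp_le[OF t] ito H_meas H_bound B]) blast+
  let ?R = "L * ((B\<^sup>2 + 3 * B ^ 4) / 2 * (t * sqrt t))"
  have lim: "(\<lambda>n. expectation (\<lambda>\<omega>. f (x + Z n \<omega>))) \<longlonglongrightarrow> expectation (\<lambda>\<omega>. f (x + I \<omega>))"
  proof (rule expectation_lipschitz_limit[OF Z(1) I Z(6), where G=Fb and L=Fl])
    show "continuous_on UNIV (\<lambda>y. f (x + y))"
      by (rule continuous_on_compose2[OF f(1)]) (auto intro!: continuous_intros)
    show "\<bar>f (x + y) - f (x + y')\<bar> \<le> Fl * \<bar>y - y'\<bar>" for y y'
      using f(3)[of "x + y" "x + y'"] by simp
  qed (use f(2) in auto)
  have lower: "f x + (h - w) / 2 * expectation (\<lambda>\<omega>. (Z n \<omega>)\<^sup>2) - ?R \<le> expectation (\<lambda>\<omega>. f (x + Z n \<omega>))" for n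
  proof -
    let ?s = "sqrt t"
    have s: "0 < ?s" "?s * ?s = t" using t by auto
    have i1: "integrable P (Z n)" and i2: "integrable P (\<lambda>\<omega>. (Z n \<omega>)\<^sup>2)" and i4: "integrable P (\<lambda>\<omega>. Z n \<omega> ^ 4)"
      using Z(2)[of 1 n] Z(2)[of 2 n] Z(2)[of 4 n] by auto
    have fm: "f \<in> borel_measurable borel" using f(1) by (rule borel_measurable_continuous_onI)
    have "(\<lambda>\<omega>. f (x + Z n \<omega>)) \<in> borel_measurable P"
      by (rule measurable_compose[OF _ fm]) (use Z(1) in simp)
    then have fi: "integrable P (\<lambda>\<omega>. f (x + Z n \<omega>))"
      by (intro integrable_const_bound[where B=Fb]) (use f(2) in auto)
    have "expectation (\<lambda>\<omega>. f x + f1 * Z n \<omega> + (h - w) / 2 * (Z n \<omega>)\<^sup>2 - L * ((?s * (Z n \<omega>)\<^sup>2 + Z n \<omega> ^ 4 / ?s) / 2))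
        \<le> expectation (\<lambda>\<omega>. f (x + Z n \<omega>))"
    proof (rule integral_mono[OF _ fi])
      fix \<omega>
      have "L * \<bar>Z n \<omega>\<bar> ^ 3 \<le> L * ((?s * (Z n \<omega>)\<^sup>2 + Z n \<omega> ^ 4 / ?s) / 2)"
        using abs_cube_le[OF s(1)] L by (rule mult_left_mono)
      then show "f x + f1 * Z n \<omega> + (h - w) / 2 * (Z n \<omega>)\<^sup>2 - L * ((?s * (Z n \<omega>)\<^sup>2 + Z n \<omega> ^ 4 / ?s) / 2) \<le> f (x + Z n \<omega>)"
        using taylor[of "Z n \<omega>"] by linarith
    qed (use i1 i2 i4 in simp)
    moreover have "expectation (\<lambda>\<omega>. f x + f1 * Z n \<omega> + (h - w) / 2 * (Z n \<omega>)\<^sup>2 - L * ((?s * (Z n \<omega>)\<^sup>2 + Z n \<omega> ^ 4 / ?s) / 2))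
        = f x + (h - w) / 2 * expectation (\<lambda>\<omega>. (Z n \<omega>)\<^sup>2) - L * ((?s * expectation (\<lambda>\<omega>. (Z n \<omega>)\<^sup>2) + expectation (\<lambda>\<omega>. Z n \<omega> ^ 4) / ?s) / 2)"
      using i1 i2 i4 Z(3)[of n] by (simp add: prob_space)
    moreover have "L * ((?s * expectation (\<lambda>\<omega>. (Z n \<omega>)\<^sup>2) + expectation (\<lambda>\<omega>. Z n \<omega> ^ 4) / ?s) / 2) \<le> ?R"
    proof (rule mult_left_mono[OF _ L])
      have "?s * expectation (\<lambda>\<omega>. (Z n \<omega>)\<^sup>2) + expectation (\<lambda>\<omega>. Z n \<omega> ^ 4) / ?s \<le> ?s * (B\<^sup>2 * t) + 3 * B ^ 4 * t\<^sup>2 / ?s"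
        using Z(4,5)[of n] s by (intro add_mono mult_left_mono divide_right_mono) auto
      also have "\<dots> = (B\<^sup>2 + 3 * B ^ 4) * (t * ?s)"
      proof -
        have "t\<^sup>2 / ?s = t * ?s" using s by (simp add: power2_eq_square divide_simps)
        then have "3 * B ^ 4 * t\<^sup>2 / ?s = 3 * B ^ 4 * (t * ?s)" by (metis times_divide_eq_right)
        then show ?thesis by (simp only:) (simp add: algebra_simps)
      qed
      finally show "(?s * expectation (\<lambda>\<omega>. (Z n \<omega>)\<^sup>2) + expectation (\<lambda>\<omega>. Z n \<omega> ^ 4) / ?s) / 2 \<le> (B\<^sup>2 + 3 * B ^ 4) / 2 * (t * ?s)"
        unfolding times_divide_eq_left by (rule divide_right_mono) simp
    qed
    ultimately show ?thesis by linarith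
  qed
  have "f x + h / 4 * (Q - e) - w / 2 * (B\<^sup>2 * t) - ?R \<le> expectation (\<lambda>\<omega>. f (x + I \<omega>))" if e: "0 < e" for e
  proof (rule tendsto_lowerbound[OF lim])
    show "\<forall>\<^sub>F n in sequentially. f x + h / 4 * (Q - e) - w / 2 * (B\<^sup>2 * t) - ?R \<le> expectation (\<lambda>\<omega>. f (x + Z n \<omega>))"
      using Z(7)[OF e]
    proof eventually_elim
      case (elim n)
      let ?E = "expectation (\<lambda>\<omega>. (Z n \<omega>)\<^sup>2)"
      have E0: "0 \<le> ?E" by (rule Bochner_Integration.integral_nonneg) simp
      have "ennreal Q \<le> ennreal (2 * ?E + e)" using Q(2) elim by (rule order_trans)
      then have "Q \<le> 2 * ?E + e" using E0 e by (simp add: ennreal_le_iff del: ennreal_plus)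
      then have "h / 4 * (Q - e) \<le> h / 4 * (2 * ?E)" using h by (intro mult_left_mono) auto
      moreover have "w / 2 * ?E \<le> w / 2 * (B\<^sup>2 * t)" using Z(4)[of n] w by (intro mult_left_mono) auto
      moreover have "(h - w) / 2 * ?E = h / 4 * (2 * ?E) - w / 2 * ?E" by (simp add: field_simps)
      ultimately show ?case using lower[of n] by linarith
    qed
  qed simp
  then have "\<forall>\<^sub>F e in at_right 0. f x + h / 4 * (Q - e) - w / 2 * (B\<^sup>2 * t) - ?R \<le> expectation (\<lambda>\<omega>. f (x + I \<omega>))"
    by (simp add: eventually_at_filter)
  moreover have "((\<lambda>e. f x + h / 4 * (Q - e) - w / 2 * (B\<^sup>2 * t) - ?R) \<longlongrightarrow> f x + h / 4 * (Q - 0) - w / 2 * (B\<^sup>2 * t) - ?R) (at_right 0)"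
    by (intro tendsto_intros)
  ultimately show ?thesis by (intro tendsto_upperbound[of _ _ "at_right (0::real)"]) auto
qed

section \<open>Short-time expansion\<close>

text \<open>For a short time this replaces Gronwall's lemma: the drift is controlled by the initial value and
  the time integral of the driving noise \<open>g\<close>.\<close>

lemma drift_path_bound:
  fixes y :: "real \<Rightarrow> real"
  assumes y: "cadlag y" and b: "continuous_on UNIV b" "\<And>x. \<bar>b x\<bar> \<le> K * (1 + \<bar>x\<bar>)" and K: "0 < K"
    and t: "0 \<le> t" "K * t \<le> 1 / 2"
    and g: "\<And>s. g s = y s - x - (LBINT u:{0..s}. b (y u))"
  shows "\<bar>LBINT u:{0..t}. b (y u)\<bar> \<le> 2 * K * (t + t * \<bar>x\<bar> + (LBINT s:{0..t}. \<bar>g s\<bar>))"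
proof -
  have by_cad: "cadlag (\<lambda>s. b (y s))" by (rule cadlag_continuous_compose[OF y b(1)])
  have abs_cad: "cadlag (\<lambda>s. \<bar>f s\<bar>)" if "cadlag f" for f :: "real \<Rightarrow> real"
    using cadlag_continuous_compose[OF that, of abs] by (simp add: continuous_on_rabs continuous_on_id)
  have g_cad: "cadlag g"
    unfolding g by (intro cadlag_diff y cadlag_const cadlag_integral by_cad)
  note iy = cadlag_set_integrable[OF abs_cad[OF y]]
  note ib = cadlag_set_integrable[OF by_cad]
  note ig = cadlag_set_integrable[OF abs_cad[OF g_cad], of t]
  have ic: "set_integrable lborel {0..s} (\<lambda>_. k)" for s k :: real
    by (rule borel_integrable_atLeastAtMost') auto
  define A where "A = (LBINT s:{0..t}. \<bar>y s\<bar>)"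
  define D where "D = (LBINT s:{0..t}. \<bar>g s\<bar>)"
  have B: "\<bar>LBINT u:{0..s}. b (y u)\<bar> \<le> K * (t + A)" if s: "0 \<le> s" "s \<le> t" for s
  proof -
    have "\<bar>LBINT u:{0..s}. b (y u)\<bar> \<le> (LBINT u:{0..s}. \<bar>b (y u)\<bar>)"
      using set_integral_norm_bound[OF ib[of s]] by simp
    also have "\<dots> \<le> (LBINT u:{0..s}. K * (1 + \<bar>y u\<bar>))"
      by (rule set_integral_mono) (use ib iy ic b(2) in \<open>auto intro!: cadlag_set_integrable abs_cad by_cad set_integrable_mult_right set_integral_add\<close>)
    also have "\<dots> = K * (s + (LBINT u:{0..s}. \<bar>y u\<bar>))"
      using s iy[of s] ic[of s 1] by (simp add: set_integral_add) (simp add: set_lebesgue_integral_def)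
    also have "\<dots> \<le> K * (t + A)"
    proof -
      have "0 \<le> (LBINT u:{s<..t}. \<bar>y u\<bar>)" unfolding set_lebesgue_integral_def
        by (intro Bochner_Integration.integral_nonneg) (auto simp: indicator_def)
      then have "(LBINT u:{0..s}. \<bar>y u\<bar>) \<le> A"
        using set_integral_Icc_diff[OF iy s] unfolding A_def by simp
      then show ?thesis using K s by (intro mult_left_mono) auto
    qed
    finally show ?thesis .
  qed
  have "A \<le> (LBINT s:{0..t}. (\<bar>x\<bar> + K * (t + A)) + \<bar>g s\<bar>)" unfolding A_def
  proof (rule set_integral_mono[OF iy])
    show "set_integrable lborel {0..t} (\<lambda>s. (\<bar>x\<bar> + K * (t + (LBINT s:{0..t}. \<bar>y s\<bar>))) + \<bar>g s\<bar>)"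
      by (intro set_integral_add ic ig)
    fix s assume "s \<in> {0..t}"
    then show "\<bar>y s\<bar> \<le> (\<bar>x\<bar> + K * (t + (LBINT s:{0..t}. \<bar>y s\<bar>))) + \<bar>g s\<bar>"
      using B[of s] g[of s] unfolding A_def by auto
  qed
  also have "\<dots> = t * (\<bar>x\<bar> + K * (t + A)) + D"
    unfolding D_def using set_integral_add(2)[OF ic ig, of "\<bar>x\<bar> + K * (t + A)"] t
    by (simp add: set_lebesgue_integral_def)
  finally have A1: "A \<le> t * \<bar>x\<bar> + (K * t) * t + (K * t) * A + D" by (simp add: algebra_simps)
  have A0: "0 \<le> A" unfolding A_def set_lebesgue_integral_def
    by (intro Bochner_Integration.integral_nonneg) (auto simp: indicator_def)
  \<comment> \<open>The integral \<open>A\<close> of \<open>\<bar>y\<bar>\<close> occurs on both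
    sides of \<open>A1\<close>; with \<open>K * t \<le> 1 / 2\<close> half of it is absorbed on the
    left.\<close>
  have "(K * t) * A \<le> 1 / 2 * A" "(K * t) * t \<le> 1 / 2 * t" using t A0 by (intro mult_right_mono; simp)+
  then have "A \<le> 2 * t * \<bar>x\<bar> + t + 2 * D" using A1 by linarith
  then have "K * (t + A) \<le> K * (2 * (t + t * \<bar>x\<bar> + D))" using K by (intro mult_left_mono) auto
  then show ?thesis using B[of t] t unfolding D_def by (simp add: mult.assoc mult.left_commute)
qed

locale hawkes_small_time = hawkes_start \<alpha> \<zeta> c b \<sigma> a P F N W X lam z \<kappa> r
  for \<alpha> :: real and \<zeta> :: "real^'m" and c :: "real^'m^'m" and b \<sigma> a :: "real \<Rightarrow> real"
    and P :: "'w measure" and F :: "real \<Rightarrow> 'w measure"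
    and N :: "'m \<Rightarrow> real \<Rightarrow> 'w \<Rightarrow> nat" and W X :: "real \<Rightarrow> 'w \<Rightarrow> real"
    and lam :: "real \<Rightarrow> 'w \<Rightarrow> real^'m" and z :: "real \<times> (real^'m)" and \<kappa> :: "real^'m" and r :: real +
  fixes Kb s\<^sub>1 :: real
  assumes b_cont: "continuous_on UNIV b" and b_lin: "\<And>y. \<bar>b y\<bar> \<le> Kb * (1 + \<bar>y\<bar>)" and Kb: "0 < Kb"
    and \<sigma>_cont: "continuous_on UNIV \<sigma>" and \<sigma>_bound: "\<And>y. \<bar>\<sigma> y\<bar> \<le> s\<^sub>1" and s\<^sub>1: "0 < s\<^sub>1"
begin

section \<open>The process before its first jump\<close>

definition x0 :: real where "x0 = fst z"

text \<open>\<open>hawkes_jump_diffusion\<close> asserts only that suitable versions of the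
  integrals exist; one family of versions is fixed here.\<close>

definition I :: "real \<Rightarrow> 'w \<Rightarrow> real" where
  "I = (SOME I. (\<forall>t\<ge>0. has_ito_integral P F W (\<lambda>s \<omega>. \<sigma> (X s \<omega>)) t (I t))
        \<and> (AE \<omega> in P. \<forall>t\<ge>0.
             X t \<omega> = X 0 \<omega> + (LBINT s:{0..t}. b (X s \<omega>)) + I t \<omega>
               + (\<Sum>j\<in>UNIV. counting_integral
                     (\<lambda>s. a (left_limit (\<lambda>u. X u \<omega>) s)) (\<lambda>u. N j u \<omega>) t)))"

lemma I_props:
  "(\<forall>t\<ge>0. has_ito_integral P F W (\<lambda>s \<omega>. \<sigma> (X s \<omega>)) t (I t))
        \<and> (AE \<omega> in P. \<forall>t\<ge>0.
             X t \<omega> = X 0 \<omega> + (LBINT s:{0..t}. b (X s \<omega>)) + I t \<omega>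
               + (\<Sum>j\<in>UNIV. counting_integral
                     (\<lambda>s. a (left_limit (\<lambda>u. X u \<omega>) s)) (\<lambda>u. N j u \<omega>) t))"
proof -
  have "\<exists>I. (\<forall>t\<ge>0. has_ito_integral P F W (\<lambda>s \<omega>. \<sigma> (X s \<omega>)) t (I t))
        \<and> (AE \<omega> in P. \<forall>t\<ge>0.
             X t \<omega> = X 0 \<omega> + (LBINT s:{0..t}. b (X s \<omega>)) + I t \<omega>
               + (\<Sum>j\<in>UNIV. counting_integral
                     (\<lambda>s. a (left_limit (\<lambda>u. X u \<omega>) s)) (\<lambda>u. N j u \<omega>) t))"
    using dyn unfolding hawkes_jump_diffusion_def by blast
  from someI_ex[OF this] show ?thesis unfolding I_def[symmetric] .
qed

lemma bm: "standard_brownian_motion P F W"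
  using dyn unfolding hawkes_jump_diffusion_def by blast

lemma I_ito: "0 \<le> t \<Longrightarrow> has_ito_integral P F W (\<lambda>s \<omega>. \<sigma> (X s \<omega>)) t (I t)"
  using I_props by blast

lemma I_meas: "0 \<le> t \<Longrightarrow> I t \<in> borel_measurable P"
  using I_ito unfolding has_ito_integral_def by blast

lemma X_meas_P: "0 \<le> t \<Longrightarrow> X t \<in> borel_measurable P"
  by (rule filtered_measurable_P[OF fps X_meas])

lemma X_joint: "(\<lambda>(s, \<omega>). X (max 0 s) \<omega>) \<in> borel_measurable (borel \<Otimes>\<^sub>M P)"
  using X_cadlag X_meas_P by (intro right_continuous_jointly_measurable) (auto simp: cadlag_def)

lemma X_compose_joint:
  assumes "g \<in> borel_measurable borel"
  shows "(\<lambda>(s, \<omega>). g (X (max 0 s) \<omega>)) \<in> borel_measurable (borel \<Otimes>\<^sub>M P)"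
  using measurable_compose[OF X_joint assms] by (simp add: case_prod_beta')

lemma \<sigma>_joint: "(\<lambda>(s, \<omega>). \<sigma> (X (max 0 s) \<omega>)) \<in> borel_measurable (borel \<Otimes>\<^sub>M P)"
  by (rule X_compose_joint[OF borel_measurable_continuous_onI[OF \<sigma>_cont]])

lemma I_second_moment: "0 \<le> t \<Longrightarrow> (\<integral>\<^sup>+\<omega>. ennreal ((I t \<omega>)\<^sup>2) \<partial>P) \<le> ennreal (s\<^sub>1\<^sup>2 * t)"
  using bounded_ito_second_moment[OF fps bm _ I_ito \<sigma>_joint] \<sigma>_bound s\<^sub>1 by (simp add: less_imp_le)

definition nojump :: "real \<Rightarrow> 'w set" where "nojump t = {\<omega>\<in>space P. Nt t \<omega> = 0}"

lemma nojump_sets: "0 \<le> t \<Longrightarrow> nojump t \<in> sets P"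
proof -
  assume t: "0 \<le> t"
  have "Nt t \<in> measurable P (count_space UNIV)"
    unfolding Nt_def using filtered_measurable_P[OF fps N_meas[OF t]] by measurable
  then show ?thesis unfolding nojump_def by measurable
qed

text \<open>On \<open>nojump t\<close> this agrees with \<open>I\<close> almost surely. Unlike
  \<open>I\<close>, which is an arbitrary version at each time, it has cadlag paths and so joint
  measurability in time and outcome, as the exchange of integrals requires.\<close>

definition G :: "real \<Rightarrow> 'w \<Rightarrow> real" where "G s \<omega> = X s \<omega> - x0 - (LBINT u:{0..s}. b (X u \<omega>))"

lemma nojump_equation:
  "AE \<omega> in P. \<forall>t s. \<omega> \<in> nojump t \<longrightarrow> 0 \<le> s \<longrightarrow> s \<le> t \<longrightarrow> G s \<omega> = I s \<omega>"
  using conjunct2[OF I_props] start AE_space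
proof eventually_elim
  case (elim \<omega>)
  show ?case
  proof (intro allI impI)
    fix t s assume n: "\<omega> \<in> nojump t" and s: "0 \<le> s" "s \<le> t"
    have "N j t \<omega> = 0" for j using n unfolding nojump_def Nt_def by simp
    then have c: "counting_integral h (\<lambda>u. N j u \<omega>) s = 0" for h j
      by (intro counting_integral_zero[OF N_path[OF elim(3)] _ s(2)])
    have "X 0 \<omega> = x0" using elim(2) unfolding x0_def by (metis fst_conv)
    then show "G s \<omega> = I s \<omega>" using elim(1)[rule_format, OF s(1)] unfolding G_def by (simp add: c)
  qed
qed

lemma G_cadlag: "\<omega> \<in> space P \<Longrightarrow> cadlag (\<lambda>s. G s \<omega>)"
  unfolding G_def
  by (intro cadlag_diff cadlag_const cadlag_integral cadlag_continuous_compose[OF X_cadlag b_cont] X_cadlag)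

lemma G_meas: "0 \<le> t \<Longrightarrow> G t \<in> borel_measurable P"
  unfolding G_def
  using path_integral_measurable[OF X_compose_joint[OF borel_measurable_continuous_onI[OF b_cont]]] X_meas_P
  by simp

lemma abs_G_joint: "(\<lambda>(s, \<omega>). \<bar>G (max 0 s) \<omega>\<bar>) \<in> borel_measurable (borel \<Otimes>\<^sub>M P)"
  using G_cadlag G_meas
  by (intro right_continuous_jointly_measurable[where Y="\<lambda>s \<omega>. \<bar>G s \<omega>\<bar>"] tendsto_rabs) (auto simp: cadlag_def)

lemma I_abs: "0 \<le> s \<Longrightarrow> s \<le> 1 \<Longrightarrow> (\<integral>\<^sup>+\<omega>. ennreal \<bar>I s \<omega>\<bar> \<partial>P) \<le> ennreal s\<^sub>1"
proof -
  assume s: "0 \<le> s" "s \<le> 1"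
  have "(\<integral>\<^sup>+\<omega>. ennreal \<bar>I s \<omega>\<bar> \<partial>P) \<le> (\<integral>\<^sup>+\<omega>. ennreal (1 / (2 * s\<^sub>1)) * ennreal ((I s \<omega>)\<^sup>2) + ennreal (s\<^sub>1 / 2) \<partial>P)"
  proof (rule nn_integral_mono)
    fix \<omega>
    have "0 \<le> (\<bar>I s \<omega>\<bar> - s\<^sub>1)\<^sup>2" by simp
    then have "\<bar>I s \<omega>\<bar> \<le> 1 / (2 * s\<^sub>1) * (I s \<omega>)\<^sup>2 + s\<^sub>1 / 2"
      using s\<^sub>1 by (simp add: field_simps power2_eq_square)
    then have "ennreal \<bar>I s \<omega>\<bar> \<le> ennreal (1 / (2 * s\<^sub>1) * (I s \<omega>)\<^sup>2 + s\<^sub>1 / 2)" by (rule ennreal_leI)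
    then show "ennreal \<bar>I s \<omega>\<bar> \<le> ennreal (1 / (2 * s\<^sub>1)) * ennreal ((I s \<omega>)\<^sup>2) + ennreal (s\<^sub>1 / 2)"
      using s\<^sub>1 by (simp add: ennreal_mult[symmetric])
  qed
  also have "\<dots> = ennreal (1 / (2 * s\<^sub>1)) * (\<integral>\<^sup>+\<omega>. ennreal ((I s \<omega>)\<^sup>2) \<partial>P) + ennreal (s\<^sub>1 / 2)"
    using I_meas[OF s(1)] by (simp add: nn_integral_add nn_integral_cmult emeasure_space_1)
  also have "\<dots> \<le> ennreal (1 / (2 * s\<^sub>1)) * ennreal (s\<^sub>1\<^sup>2 * 1) + ennreal (s\<^sub>1 / 2)"
    using s s\<^sub>1 by (intro add_right_mono mult_left_mono order_trans[OF I_second_moment] ennreal_leI) auto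
  also have "\<dots> = ennreal s\<^sub>1"
    using s\<^sub>1 by (simp add: ennreal_mult[symmetric] ennreal_plus[symmetric] power2_eq_square del: ennreal_plus)
  finally show ?thesis .
qed

definition K where "K = 2 * Kb * (1 + s\<^sub>1)"

lemma K_pos: "0 < K" unfolding K_def using Kb s\<^sub>1 by simp

text \<open>Without jumps the difference is the time integral of the drift.
  \<open>drift_path_bound\<close> reduces it to the time integral of \<open>\<bar>G\<bar>\<close>,
  and on the event \<open>G\<close> coincides with \<open>I\<close>, whose first absolute moment is
  at most \<open>s\<^sub>1\<close> up to time one.\<close>

lemma drift_bound:
  assumes t: "0 \<le> t" "t \<le> 1" "Kb * t \<le> 1 / 2"
  shows "(\<integral>\<^sup>+\<omega>. ennreal \<bar>X t \<omega> - x0 - I t \<omega>\<bar> * indicator (nojump t) \<omega> \<partial>P) \<le> ennreal (K * t * (1 + \<bar>x0\<bar>))"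
proof -
  let ?c = "2 * Kb * (t + t * \<bar>x0\<bar>)"
  have c: "0 \<le> ?c" using Kb t by simp
  have O: "nojump t \<in> sets P" by (rule nojump_sets[OF t(1)])
  have Y: "(\<lambda>(s, \<omega>). \<bar>G (max 0 s) \<omega>\<bar> * indicator (nojump t) \<omega>) \<in> borel_measurable (borel \<Otimes>\<^sub>M P)"
    using abs_G_joint O by (simp add: case_prod_beta')
  have "(\<integral>\<^sup>+\<omega>. ennreal \<bar>X t \<omega> - x0 - I t \<omega>\<bar> * indicator (nojump t) \<omega> \<partial>P)
    \<le> (\<integral>\<^sup>+\<omega>. ennreal ?c + ennreal (2 * Kb) * (\<integral>\<^sup>+s\<in>{0..t}. ennreal (\<bar>G s \<omega>\<bar> * indicator (nojump t) \<omega>) \<partial>lborel) \<partial>P)"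
  proof (rule nn_integral_mono_AE)
    show "AE \<omega> in P. ennreal \<bar>X t \<omega> - x0 - I t \<omega>\<bar> * indicator (nojump t) \<omega> \<le>
      ennreal ?c + ennreal (2 * Kb) * (\<integral>\<^sup>+s\<in>{0..t}. ennreal (\<bar>G s \<omega>\<bar> * indicator (nojump t) \<omega>) \<partial>lborel)"
      using nojump_equation AE_space
    proof eventually_elim
      case (elim \<omega>)
      show ?case
      proof (cases "\<omega> \<in> nojump t")
        case True
        have "cadlag (\<lambda>s. \<bar>G s \<omega>\<bar>)"
          using cadlag_continuous_compose[OF G_cadlag[OF elim(2)], of abs] by (simp add: continuous_on_rabs continuous_on_id)
        then have i: "integrable lborel (\<lambda>s. indicator {0..t} s *\<^sub>R \<bar>G s \<omega>\<bar>)"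
          using cadlag_set_integrable unfolding set_integrable_def by blast
        have e: "ennreal (LBINT s:{0..t}. \<bar>G s \<omega>\<bar>) = (\<integral>\<^sup>+s\<in>{0..t}. ennreal (\<bar>G s \<omega>\<bar> * indicator (nojump t) \<omega>) \<partial>lborel)"
          unfolding set_lebesgue_integral_def
          by (subst nn_integral_eq_integral[OF i, symmetric])
            (auto simp: True indicator_def intro!: nn_integral_cong)
        have D0: "0 \<le> (LBINT s:{0..t}. \<bar>G s \<omega>\<bar>)" unfolding set_lebesgue_integral_def
          by (intro Bochner_Integration.integral_nonneg) (auto simp: indicator_def)
        have "X t \<omega> - x0 - I t \<omega> = (LBINT u:{0..t}. b (X u \<omega>))"
          using elim(1)[rule_format, OF True t(1) order_refl] unfolding G_def by simp
        also have "\<bar>\<dots>\<bar> \<le> 2 * Kb * (t + t * \<bar>x0\<bar> + (LBINT s:{0..t}. \<bar>G s \<omega>\<bar>))"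
          by (rule drift_path_bound[OF X_cadlag[OF elim(2)] b_cont b_lin Kb t(1,3)]) (simp add: G_def)
        also have "\<dots> = ?c + 2 * Kb * (LBINT s:{0..t}. \<bar>G s \<omega>\<bar>)" by (simp add: algebra_simps)
        finally have "ennreal \<bar>X t \<omega> - x0 - I t \<omega>\<bar> \<le> ennreal (?c + 2 * Kb * (LBINT s:{0..t}. \<bar>G s \<omega>\<bar>))"
          by (rule ennreal_leI)
        also have "\<dots> = ennreal ?c + ennreal (2 * Kb) * ennreal (LBINT s:{0..t}. \<bar>G s \<omega>\<bar>)"
          using Kb D0 c by (simp only: ennreal_plus ennreal_mult mult_nonneg_nonneg)
        finally show ?thesis using True unfolding e by simp
      qed simp
    qed
  qed
  also have "\<dots> = ennreal ?c + ennreal (2 * Kb) * (\<integral>\<^sup>+s\<in>{0..t}. (\<integral>\<^sup>+\<omega>. ennreal (\<bar>G s \<omega>\<bar> * indicator (nojump t) \<omega>) \<partial>P) \<partial>lborel)"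
    using path_nn_integral[OF Y, of t] by (simp add: nn_integral_add nn_integral_cmult emeasure_space_1)
  also have "\<dots> \<le> ennreal ?c + ennreal (2 * Kb) * (\<integral>\<^sup>+s\<in>{0..t}. ennreal s\<^sub>1 \<partial>lborel)"
  proof (intro add_left_mono mult_left_mono nn_integral_mono)
    fix s
    show "(\<integral>\<^sup>+\<omega>. ennreal (\<bar>G s \<omega>\<bar> * indicator (nojump t) \<omega>) \<partial>P) * indicator {0..t} s \<le> ennreal s\<^sub>1 * indicator {0..t} s"
    proof (cases "s \<in> {0..t}")
      case True
      then have s: "0 \<le> s" "s \<le> t" by auto
      have "(\<integral>\<^sup>+\<omega>. ennreal (\<bar>G s \<omega>\<bar> * indicator (nojump t) \<omega>) \<partial>P) \<le> (\<integral>\<^sup>+\<omega>. ennreal \<bar>I s \<omega>\<bar> \<partial>P)"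
        by (rule nn_integral_mono_AE, use nojump_equation in eventually_elim) (use s in \<open>auto simp: indicator_def\<close>)
      also have "\<dots> \<le> ennreal s\<^sub>1" using s t by (intro I_abs) auto
      finally show ?thesis using True by simp
    qed simp
  qed simp
  also have "\<dots> = ennreal (?c + 2 * Kb * (s\<^sub>1 * t))"
    using Kb s\<^sub>1 t c by (subst nn_integral_cmult_indicator) (simp_all add: ennreal_mult[symmetric] ennreal_plus[symmetric] del: ennreal_plus)
  also have "\<dots> \<le> ennreal (K * t * (1 + \<bar>x0\<bar>))"
  proof (rule ennreal_leI)
    have "0 \<le> Kb * s\<^sub>1 * (t * \<bar>x0\<bar>)" using Kb s\<^sub>1 t by simp
    then show "?c + 2 * Kb * (s\<^sub>1 * t) \<le> K * t * (1 + \<bar>x0\<bar>)" unfolding K_def by (simp add: algebra_simps)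
  qed
  finally show ?thesis .
qed

section \<open>Probability of a jump and size of the drift in short time\<close>

text \<open>A rate for the expected number of jumps, valid up to time one. It is affine in
  \<open>v\<close>, hence integrable against the invariant law as soon as \<open>v\<close>
  is.\<close>

definition J :: real where "J = (\<Sum>j\<in>UNIV. 1 / \<kappa> $ j) * (v + C)"

lemma J_nonneg: "0 \<le> J"
  unfolding J_def using \<kappa>_pos v_nonneg C_pos by (intro mult_nonneg_nonneg sum_nonneg) (auto simp: less_imp_le)

lemma jump_prob:
  assumes t: "0 \<le> t" "t \<le> 1"
  shows "prob (space P - nojump t) \<le> t * J"
proof -
  have m: "(\<lambda>\<omega>. ennreal (real (N j t \<omega>))) \<in> borel_measurable P" for j using N_real_meas[OF t(1)] by simp
  have "emeasure P (space P - nojump t) = (\<integral>\<^sup>+\<omega>. indicator (space P - nojump t) \<omega> \<partial>P)"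
    using nojump_sets[OF t(1)] by simp
  also have "\<dots> \<le> (\<integral>\<^sup>+\<omega>. (\<Sum>j\<in>UNIV. ennreal (real (N j t \<omega>))) \<partial>P)"
  proof (rule nn_integral_mono)
    fix \<omega> assume w: "\<omega> \<in> space P"
    show "indicator (space P - nojump t) \<omega> \<le> (\<Sum>j\<in>UNIV. ennreal (real (N j t \<omega>)))"
    proof (cases "\<omega> \<in> nojump t")
      case False
      then have "1 \<le> Nt t \<omega>" using w by (auto simp: nojump_def)
      then have "ennreal 1 \<le> ennreal (real (Nt t \<omega>))" by (intro ennreal_leI) simp
      then show ?thesis using False w unfolding Nt_def by (simp add: sum_ennreal)
    qed simp
  qed
  also have "\<dots> = (\<Sum>j\<in>UNIV. \<integral>\<^sup>+\<omega>. ennreal (real (N j t \<omega>)) \<partial>P)" using m by (rule nn_integral_sum)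
  also have "\<dots> \<le> (\<Sum>j\<in>UNIV. ennreal (t * ((v + C) / \<kappa> $ j)))"
  proof (rule sum_mono)
    fix j
    have "t * ((v + C * t) / \<kappa> $ j) \<le> t * ((v + C) / \<kappa> $ j)"
      using t \<kappa>_pos[of j] C_pos by (intro mult_left_mono divide_right_mono) (auto simp: mult_left_le)
    then show "(\<integral>\<^sup>+\<omega>. ennreal (real (N j t \<omega>)) \<partial>P) \<le> ennreal (t * ((v + C) / \<kappa> $ j))"
      using N_mean_le[OF t(1), of j] by (meson ennreal_leI order_trans)
  qed
  also have "\<dots> = ennreal (t * J)"
    using t \<kappa>_pos v_nonneg C_pos unfolding J_def
    by (subst sum_ennreal) (auto simp: less_imp_le sum_distrib_left sum_distrib_right divide_inverse mult_ac)
  finally show ?thesis using t J_nonneg by (simp add: emeasure_eq_measure)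
qed

definition U :: "real \<Rightarrow> 'w \<Rightarrow> real" where
  "U t \<omega> = \<bar>X t \<omega> - x0 - I t \<omega>\<bar> * indicator (nojump t) \<omega>"

lemma U_nonneg: "0 \<le> U t \<omega>" by (simp add: U_def)

lemma U_mean:
  assumes t: "0 \<le> t" "t \<le> 1" "Kb * t \<le> 1 / 2"
  shows "integrable P (U t)" "expectation (U t) \<le> K * t * (1 + \<bar>x0\<bar>)"
proof -
  have "U t \<in> borel_measurable P" unfolding U_def
    using X_meas_P[OF t(1)] I_meas[OF t(1)] nojump_sets[OF t(1)] by simp
  moreover have "(\<integral>\<^sup>+\<omega>. ennreal (U t \<omega>) \<partial>P) \<le> ennreal (K * t * (1 + \<bar>x0\<bar>))"
    using drift_bound[OF t] unfolding U_def by (simp add: ennreal_mult' ennreal_indicator)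
  moreover have "0 \<le> K * t * (1 + \<bar>x0\<bar>)" using K_pos t by simp
  ultimately show "integrable P (U t)" "expectation (U t) \<le> K * t * (1 + \<bar>x0\<bar>)"
    using integrable_of_nn_integral_le[of "U t"] U_nonneg by blast+
qed

lemma I_square_mean:
  assumes t: "0 \<le> t"
  shows "integrable P (\<lambda>\<omega>. (I t \<omega>)\<^sup>2)" "expectation (\<lambda>\<omega>. (I t \<omega>)\<^sup>2) \<le> s\<^sub>1\<^sup>2 * t"
  using integrable_of_nn_integral_le[of "\<lambda>\<omega>. (I t \<omega>)\<^sup>2" "s\<^sub>1\<^sup>2 * t"] I_second_moment[OF t] I_meas[OF t] t by auto

lemma jump_integrable:
  "0 \<le> t \<Longrightarrow> integrable P (indicator (space P - nojump t) :: _ \<Rightarrow> real)"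
  "0 \<le> t \<Longrightarrow> expectation (indicator (space P - nojump t)) = prob (space P - nojump t)"
  using nojump_sets[of t] by (auto simp: less_top[symmetric] intro!: integrable_real_indicator)

section \<open>Lower bounds uniform in the starting point\<close>

text \<open>Replacing \<open>X t\<close> by \<open>x0 + I t\<close> costs the Lipschitz constant
  times the drift when there is no jump, and the oscillation of \<open>f\<close> otherwise. The
  factor \<open>1 + \<bar>x0\<bar>\<close> confines this estimate to bounded starting
  points.\<close>

lemma near_lower:
  assumes t: "0 \<le> t" "t \<le> 1" "Kb * t \<le> 1 / 2"
    and f: "continuous_on UNIV f" "\<And>x. \<bar>f x\<bar> \<le> Fb" "\<And>x y. \<bar>f x - f y\<bar> \<le> Fl * \<bar>x - y\<bar>"
  shows "expectation (\<lambda>\<omega>. f (x0 + I t \<omega>)) - Fl * (K * t * (1 + \<bar>x0\<bar>)) - 2 * Fb * (t * J) \<le> expectation (\<lambda>\<omega>. f (X t \<omega>))"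
proof -
  have fm: "f \<in> borel_measurable borel" using f(1) by (rule borel_measurable_continuous_onI)
  have Fb: "0 \<le> Fb" using f(2)[of 0] by linarith
  have Fl: "0 \<le> Fl" using f(3)[of 0 1] by simp
  have int: "integrable P (\<lambda>\<omega>. f (Y \<omega>))" if "Y \<in> borel_measurable P" for Y
    by (rule integrable_const_bound[where B=Fb]) (use f(2) measurable_compose[OF that fm] in auto)
  note i1 = int[OF X_meas_P[OF t(1)]]
  have i2: "integrable P (\<lambda>\<omega>. f (x0 + I t \<omega>))" using I_meas[OF t(1)] by (intro int) simp
  note ji = jump_integrable[OF t(1)]
  have "expectation (\<lambda>\<omega>. f (x0 + I t \<omega>) - Fl * U t \<omega> - 2 * Fb * indicator (space P - nojump t) \<omega>) \<le> expectation (\<lambda>\<omega>. f (X t \<omega>))"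
  proof (rule integral_mono[OF _ i1])
    show "integrable P (\<lambda>\<omega>. f (x0 + I t \<omega>) - Fl * U t \<omega> - 2 * Fb * indicator (space P - nojump t) \<omega>)"
      using i2 U_mean(1)[OF t] ji(1) by (intro Bochner_Integration.integrable_diff integrable_mult_right)
    fix \<omega> assume w: "\<omega> \<in> space P"
    show "f (x0 + I t \<omega>) - Fl * U t \<omega> - 2 * Fb * indicator (space P - nojump t) \<omega> \<le> f (X t \<omega>)"
    proof (cases "\<omega> \<in> nojump t")
      case True
      then show ?thesis using f(3)[of "x0 + I t \<omega>" "X t \<omega>"] by (simp add: U_def abs_minus_commute algebra_simps)
    next
      case False
      then show ?thesis using w f(2)[of "x0 + I t \<omega>"] f(2)[of "X t \<omega>"] by (simp add: U_def)
    qed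
  qed
  moreover have "expectation (\<lambda>\<omega>. f (x0 + I t \<omega>) - Fl * U t \<omega> - 2 * Fb * indicator (space P - nojump t) \<omega>)
      = expectation (\<lambda>\<omega>. f (x0 + I t \<omega>)) - Fl * expectation (U t) - 2 * Fb * prob (space P - nojump t)"
    using i2 U_mean(1)[OF t] ji
    by (simp only: Bochner_Integration.integral_diff Bochner_Integration.integrable_diff integrable_mult_right integral_mult_right_zero)
  moreover have "Fl * expectation (U t) \<le> Fl * (K * t * (1 + \<bar>x0\<bar>))"
    using U_mean(2)[OF t] Fl by (rule mult_left_mono)
  moreover have "2 * Fb * prob (space P - nojump t) \<le> 2 * Fb * (t * J)"
    using jump_prob[OF t(1,2)] Fb by (intro mult_left_mono) auto
  ultimately show ?thesis by linarith
qed

text \<open>The crude bound \<open>1 \<le> U/m + I\<^sup>2/m\<^sup>2\<close> suffices because its right-hand side has expectation of order \<open>t\<close>.\<close>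

lemma deviation_le:
  assumes m: "0 < m" and w: "\<omega> \<in> nojump t" and d: "2 * m \<le> \<bar>X t \<omega> - x0\<bar>"
  shows "1 \<le> U t \<omega> / m + (I t \<omega>)\<^sup>2 / m\<^sup>2"
proof -
  have U: "U t \<omega> = \<bar>X t \<omega> - x0 - I t \<omega>\<bar>" using w by (simp add: U_def)
  have "2 * m \<le> U t \<omega> + \<bar>I t \<omega>\<bar>" using d unfolding U by linarith
  then consider "m \<le> U t \<omega>" | "m \<le> \<bar>I t \<omega>\<bar>" by linarith
  then show ?thesis
  proof cases
    case 1
    then have "1 \<le> U t \<omega> / m" using m by simp
    then show ?thesis using m by (simp add: add_increasing2)
  next
    case 2
    then have "m\<^sup>2 \<le> (I t \<omega>)\<^sup>2" using m power_mono[of m "\<bar>I t \<omega>\<bar>" 2] by simp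
    then have "1 \<le> (I t \<omega>)\<^sup>2 / m\<^sup>2" using m by simp
    then show ?thesis using m U_nonneg[of t \<omega>] by (simp add: add_increasing)
  qed
qed

lemma deviation_prob:
  assumes t: "0 \<le> t" "t \<le> 1" "Kb * t \<le> 1 / 2" and m: "0 < m"
    and A: "A \<in> sets P" "\<And>\<omega>. \<omega> \<in> A \<Longrightarrow> 2 * m \<le> \<bar>X t \<omega> - x0\<bar>"
  shows "prob A \<le> K * t * (1 + \<bar>x0\<bar>) / m + s\<^sub>1\<^sup>2 * t / m\<^sup>2 + t * J"
proof -
  note ji = jump_integrable[OF t(1)]
  have iA: "integrable P (indicator A :: _ \<Rightarrow> real)" using A(1) by (auto simp: less_top[symmetric] intro!: integrable_real_indicator)
  have iR: "integrable P (\<lambda>\<omega>. U t \<omega> / m + (I t \<omega>)\<^sup>2 / m\<^sup>2 + indicator (space P - nojump t) \<omega>)"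
    using U_mean(1)[OF t] I_square_mean(1)[OF t(1)] ji(1) by (intro Bochner_Integration.integrable_add integrable_divide)
  have "prob A = expectation (indicator A)" using A(1) sets.sets_into_space by (simp add: Int_absorb2)
  also have "\<dots> \<le> expectation (\<lambda>\<omega>. U t \<omega> / m + (I t \<omega>)\<^sup>2 / m\<^sup>2 + indicator (space P - nojump t) \<omega>)"
  proof (rule integral_mono[OF iA iR])
    fix \<omega> assume w: "\<omega> \<in> space P"
    have nn: "0 \<le> U t \<omega> / m + (I t \<omega>)\<^sup>2 / m\<^sup>2" using m U_nonneg by simp
    show "indicator A \<omega> \<le> U t \<omega> / m + (I t \<omega>)\<^sup>2 / m\<^sup>2 + indicator (space P - nojump t) \<omega>"
    proof (cases "\<omega> \<in> A")
      case True
      then show ?thesis using deviation_le[OF m _ A(2)[OF True]] w nn by (cases "\<omega> \<in> nojump t") auto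
    next
      case False
      then show ?thesis using nn by simp
    qed
  qed
  also have "\<dots> = expectation (U t) / m + expectation (\<lambda>\<omega>. (I t \<omega>)\<^sup>2) / m\<^sup>2 + prob (space P - nojump t)"
    using U_mean(1)[OF t] I_square_mean(1)[OF t(1)] ji
    by (simp only: Bochner_Integration.integral_add Bochner_Integration.integrable_add integrable_divide integral_divide_zero)
  also have "\<dots> \<le> K * t * (1 + \<bar>x0\<bar>) / m + s\<^sub>1\<^sup>2 * t / m\<^sup>2 + t * J"
    using U_mean(2)[OF t] I_square_mean(2)[OF t(1)] jump_prob[OF t(1,2)] m by (intro add_mono divide_right_mono) auto
  finally show ?thesis .
qed

text \<open>From \<open>x0\<close>, the region where \<open>f\<close> may differ from
  \<open>f x0\<close> is at distance at least \<open>2 * m\<close> with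
  \<open>m = (1 + \<bar>x0\<bar>) / 6\<close>. Scaling \<open>m\<close> with
  \<open>1 + \<bar>x0\<bar>\<close> cancels the growth of the drift in \<open>deviation_prob\<close>
  and leaves the constant \<open>6 * K\<close>; \<open>m \<ge> 1 / 6\<close> gives the
  \<open>36\<close>.\<close>

lemma far_lower:
  assumes t: "0 \<le> t" "t \<le> 1" "Kb * t \<le> 1 / 2"
    and f: "f \<in> borel_measurable borel" "\<And>x. \<bar>f x\<bar> \<le> Fb"
    and R: "0 < R" "\<And>y. R \<le> y \<Longrightarrow> f y = f R" "\<And>y. y \<le> - R \<Longrightarrow> f y = f (- R)"
    and x0: "2 * R + 2 \<le> \<bar>x0\<bar>"
  shows "f x0 - 2 * Fb * (t * (6 * K + 36 * s\<^sub>1\<^sup>2 + J)) \<le> expectation (\<lambda>\<omega>. f (X t \<omega>))"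
proof -
  have Fb: "0 \<le> Fb" using f(2)[of 0] by linarith
  define A where "A = {\<omega>\<in>space P. f (X t \<omega>) \<noteq> f x0}"
  have fX: "(\<lambda>\<omega>. f (X t \<omega>)) \<in> borel_measurable P" by (rule measurable_compose[OF X_meas_P[OF t(1)] f(1)])
  have A: "A \<in> sets P" unfolding A_def using fX by measurable
  define m where "m = (1 + \<bar>x0\<bar>) / 6"
  have m: "0 < m" "1 / 6 \<le> m" unfolding m_def by auto
  have iA: "integrable P (indicator A :: _ \<Rightarrow> real)" using A by (auto simp: less_top[symmetric] intro!: integrable_real_indicator)
  have dev: "2 * m \<le> \<bar>X t \<omega> - x0\<bar>" if "\<omega> \<in> A" for \<omega>
  proof -
    have ne: "f (X t \<omega>) \<noteq> f x0" using that by (simp add: A_def)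
    show ?thesis
    proof (cases "0 \<le> x0")
      case True
      then have "f x0 = f R" using x0 R(1) by (intro R(2)) auto
      then have "X t \<omega> < R" using ne R(2)[of "X t \<omega>"] by (cases "R \<le> X t \<omega>") auto
      then show ?thesis using x0 R(1) True unfolding m_def by (auto simp: field_simps)
    next
      case False
      then have "f x0 = f (- R)" using x0 R(1) by (intro R(3)) auto
      then have "- R < X t \<omega>" using ne R(3)[of "X t \<omega>"] by (cases "X t \<omega> \<le> - R") auto
      then show ?thesis using x0 R(1) False unfolding m_def by (auto simp: field_simps)
    qed
  qed
  have "prob A \<le> K * t * (1 + \<bar>x0\<bar>) / m + s\<^sub>1\<^sup>2 * t / m\<^sup>2 + t * J"
    by (rule deviation_prob[OF t m(1) A dev])
  also have "\<dots> \<le> 6 * K * t + 36 * s\<^sub>1\<^sup>2 * t + t * J"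
  proof (intro add_mono order_refl)
    show "K * t * (1 + \<bar>x0\<bar>) / m \<le> 6 * K * t" unfolding m_def by (simp add: divide_simps)
    have "(1 / 6)\<^sup>2 \<le> m\<^sup>2" using m by (intro power_mono) auto
    then have "s\<^sub>1\<^sup>2 * t / m\<^sup>2 \<le> s\<^sub>1\<^sup>2 * t / (1 / 6)\<^sup>2" using m t by (intro divide_left_mono) auto
    then show "s\<^sub>1\<^sup>2 * t / m\<^sup>2 \<le> 36 * s\<^sub>1\<^sup>2 * t" by (simp add: power2_eq_square)
  qed
  also have "\<dots> = t * (6 * K + 36 * s\<^sub>1\<^sup>2 + J)" by (simp add: algebra_simps)
  finally have pA: "2 * Fb * prob A \<le> 2 * Fb * (t * (6 * K + 36 * s\<^sub>1\<^sup>2 + J))" using Fb by (intro mult_left_mono) auto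
  have "expectation (\<lambda>\<omega>. f x0 - 2 * Fb * indicator A \<omega>) \<le> expectation (\<lambda>\<omega>. f (X t \<omega>))"
  proof (rule integral_mono)
    show "integrable P (\<lambda>\<omega>. f x0 - 2 * Fb * indicator A \<omega>)" using iA by simp
    show "integrable P (\<lambda>\<omega>. f (X t \<omega>))" by (rule integrable_const_bound[where B=Fb]) (use f(2) fX in auto)
    fix \<omega> assume "\<omega> \<in> space P"
    then show "f x0 - 2 * Fb * indicator A \<omega> \<le> f (X t \<omega>)"
      using f(2)[of x0] f(2)[of "X t \<omega>"] by (auto simp: A_def indicator_def)
  qed
  moreover have "expectation (\<lambda>\<omega>. f x0 - 2 * Fb * indicator A \<omega>) = f x0 - 2 * Fb * prob A"
    using iA A sets.sets_into_space[OF A]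
    by (subst Bochner_Integration.integral_diff) (auto simp: prob_space Int_absorb2)
  ultimately show ?thesis using pA by linarith
qed

text \<open>At each time up to \<open>t\<close> the process is within distance 1 of
  \<open>x0\<close>, hence inside the radius \<open>R + 1\<close>, up to a probability of order
  \<open>t\<close>. If the correction exceeds one, \<open>ennreal\<close> turns the negative number
  on the left into zero.\<close>

lemma quadratic_variation_lower:
  assumes t: "0 \<le> t" "t \<le> 1" "Kb * t \<le> 1 / 2"
    and s: "0 \<le> s\<^sub>0" "\<And>y. \<bar>y\<bar> \<le> R + 1 \<Longrightarrow> s\<^sub>0 \<le> (\<sigma> y)\<^sup>2" and x0: "\<bar>x0\<bar> \<le> R"
  shows "ennreal (s\<^sub>0 * t * (1 - t * (2 * K * (1 + R) + 4 * s\<^sub>1\<^sup>2 + J)))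
    \<le> (\<integral>\<^sup>+\<omega>. (\<integral>\<^sup>+s\<in>{0..t}. ennreal ((\<sigma> (X s \<omega>))\<^sup>2) \<partial>lborel) \<partial>P)"
proof -
  let ?D = "2 * K * (1 + R) + 4 * s\<^sub>1\<^sup>2 + J"
  have D0: "0 \<le> ?D" using K_pos s\<^sub>1 J_nonneg x0 by (intro add_nonneg_nonneg mult_nonneg_nonneg) auto
  have \<sigma>m: "(\<lambda>y. (\<sigma> y)\<^sup>2) \<in> borel_measurable borel" using borel_measurable_continuous_onI[OF \<sigma>_cont] by simp
  have mean: "ennreal (s\<^sub>0 * (1 - t * ?D)) \<le> (\<integral>\<^sup>+\<omega>. ennreal ((\<sigma> (X s \<omega>))\<^sup>2) \<partial>P)" if u: "0 \<le> s" "s \<le> t" for s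
  proof -
    have u': "0 \<le> s" "s \<le> 1" "Kb * s \<le> 1 / 2"
      using u t mult_left_mono[OF u(2), of Kb] Kb by linarith+
    define A where "A = {\<omega>\<in>space P. 1 \<le> \<bar>X s \<omega> - x0\<bar>}"
    have A: "A \<in> sets P" unfolding A_def using X_meas_P[OF u(1)] by measurable
    have "prob A \<le> K * s * (1 + \<bar>x0\<bar>) / (1 / 2) + s\<^sub>1\<^sup>2 * s / (1 / 2)\<^sup>2 + s * J"
      by (rule deviation_prob[OF u' _ A]) (auto simp: A_def)
    also have "\<dots> = s * (2 * K * (1 + \<bar>x0\<bar>) + 4 * s\<^sub>1\<^sup>2 + J)" by (simp add: power2_eq_square algebra_simps)
    also have "\<dots> \<le> t * ?D"
      using u K_pos J_nonneg x0 D0 by (intro mult_mono add_mono mult_left_mono) (auto intro!: add_nonneg_nonneg mult_nonneg_nonneg)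
    finally have pA: "prob A \<le> t * ?D" .
    have "ennreal (s\<^sub>0 * (1 - t * ?D)) \<le> ennreal (s\<^sub>0 * prob (space P - A))"
      using pA s(1) A by (intro ennreal_leI mult_left_mono) (auto simp: prob_compl)
    also have "\<dots> = (\<integral>\<^sup>+\<omega>. ennreal s\<^sub>0 * indicator (space P - A) \<omega> \<partial>P)"
      using A s(1) by (subst nn_integral_cmult_indicator) (auto simp: emeasure_eq_measure ennreal_mult)
    also have "\<dots> \<le> (\<integral>\<^sup>+\<omega>. ennreal ((\<sigma> (X s \<omega>))\<^sup>2) \<partial>P)"
    proof (rule nn_integral_mono)
      fix \<omega> assume w: "\<omega> \<in> space P"
      show "ennreal s\<^sub>0 * indicator (space P - A) \<omega> \<le> ennreal ((\<sigma> (X s \<omega>))\<^sup>2)"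
      proof (cases "\<omega> \<in> A")
        case False
        then have "\<bar>X s \<omega>\<bar> \<le> R + 1" using x0 w by (auto simp: A_def)
        then show ?thesis using s(2) False w by (auto intro: ennreal_leI)
      qed simp
    qed
    finally show ?thesis .
  qed
  have "ennreal (s\<^sub>0 * t * (1 - t * ?D)) = (\<integral>\<^sup>+s. ennreal (s\<^sub>0 * (1 - t * ?D)) * indicator {0..t} s \<partial>lborel)"
  proof -
    have "ennreal (s\<^sub>0 * t * (1 - t * ?D)) = ennreal (t * (s\<^sub>0 * (1 - t * ?D)))" by (simp add: mult_ac)
    also have "\<dots> = ennreal t * ennreal (s\<^sub>0 * (1 - t * ?D))" using t(1) by (rule ennreal_mult')
    finally show ?thesis using t by (subst nn_integral_cmult_indicator) (auto simp: mult.commute)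
  qed
  also have "\<dots> \<le> (\<integral>\<^sup>+s\<in>{0..t}. (\<integral>\<^sup>+\<omega>. ennreal ((\<sigma> (X s \<omega>))\<^sup>2) \<partial>P) \<partial>lborel)"
    using mean by (intro nn_integral_mono) (auto simp: indicator_def)
  also have "\<dots> = (\<integral>\<^sup>+\<omega>. (\<integral>\<^sup>+s\<in>{0..t}. ennreal ((\<sigma> (X s \<omega>))\<^sup>2) \<partial>lborel) \<partial>P)"
    by (rule path_nn_integral(2)[OF X_compose_joint[OF \<sigma>m], symmetric])
  finally show ?thesis .
qed

text \<open>One bound for all starting points. Beyond \<open>2 * R' + 2\<close> the estimate
  \<open>far_lower\<close> applies and \<open>h x0 = 0\<close>; below it
  \<open>1 + \<bar>x0\<bar> \<le> 3 + 2 * R'\<close> makes \<open>near_lower\<close> uniform. A gain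
  from \<open>h\<close> arises only for \<open>\<bar>x0\<bar> \<le> R\<close>, where the quadratic
  variation has a lower bound.\<close>

lemma small_time_lower:
  assumes t: "0 < t" "t \<le> 1" "Kb * t \<le> 1 / 2"
    and f: "continuous_on UNIV f" "\<And>x. \<bar>f x\<bar> \<le> Fb" "\<And>x y. \<bar>f x - f y\<bar> \<le> Fl * \<bar>x - y\<bar>"
    and taylor: "\<And>x y. \<bar>f (x + y) - f x - f1 x * y - (h x - w x) / 2 * y\<^sup>2\<bar> \<le> L * \<bar>y\<bar> ^ 3"
    and h: "\<And>x. 0 \<le> h x" "\<And>x. R < \<bar>x\<bar> \<Longrightarrow> h x = 0" and w: "\<And>x. 0 \<le> w x" "\<And>x. w x \<le> wb" and L: "0 \<le> L"
    and R': "0 < R'" "R \<le> R'" "\<And>y. R' \<le> y \<Longrightarrow> f y = f R'" "\<And>y. y \<le> - R' \<Longrightarrow> f y = f (- R')"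
    and s: "0 \<le> s\<^sub>0" "\<And>y. \<bar>y\<bar> \<le> R + 1 \<Longrightarrow> s\<^sub>0 \<le> (\<sigma> y)\<^sup>2"
  shows "f x0 + h x0 / 4 * (s\<^sub>0 * t * (1 - t * (2 * K * (1 + R) + 4 * s\<^sub>1\<^sup>2 + J))) - wb / 2 * (s\<^sub>1\<^sup>2 * t)
      - L * ((s\<^sub>1\<^sup>2 + 3 * s\<^sub>1 ^ 4) / 2 * (t * sqrt t)) - Fl * (K * t * (3 + 2 * R'))
      - 2 * Fb * (t * (6 * K + 36 * s\<^sub>1\<^sup>2 + J)) \<le> expectation (\<lambda>\<omega>. f (X t \<omega>))"
proof -
  let ?Q = "s\<^sub>0 * t * (1 - t * (2 * K * (1 + R) + 4 * s\<^sub>1\<^sup>2 + J))"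
  have t0: "0 \<le> t" using t by simp
  have Fb: "0 \<le> Fb" using f(2)[of 0] by linarith
  have Fl: "0 \<le> Fl" using f(3)[of 0 1] by simp
  have wb: "0 \<le> wb" using w(1)[of 0] w(2)[of 0] by linarith
  have p1: "0 \<le> L * ((s\<^sub>1\<^sup>2 + 3 * s\<^sub>1 ^ 4) / 2 * (t * sqrt t))" using L t by simp
  have p2: "0 \<le> Fl * (K * t * (3 + 2 * R'))" using Fl K_pos t R'(1) by simp
  have p3: "0 \<le> wb / 2 * (s\<^sub>1\<^sup>2 * t)" using wb t by simp
  have p4: "2 * Fb * (t * J) \<le> 2 * Fb * (t * (6 * K + 36 * s\<^sub>1\<^sup>2 + J))"
    using Fb t K_pos by (intro mult_left_mono) auto
  show ?thesis
  proof (cases "2 * R' + 2 \<le> \<bar>x0\<bar>")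
    case True
    have "h x0 = 0" using True R' by (intro h(2)) auto
    then show ?thesis
      using far_lower[OF t0 t(2,3) borel_measurable_continuous_onI[OF f(1)] f(2) R'(1,3,4) True] p1 p2 p3 by simp
  next
    case False
    have near: "expectation (\<lambda>\<omega>. f (x0 + I t \<omega>)) - Fl * (K * t * (1 + \<bar>x0\<bar>)) - 2 * Fb * (t * J) \<le> expectation (\<lambda>\<omega>. f (X t \<omega>))"
      by (rule near_lower[OF t0 t(2,3) f])
    have "K * t * (1 + \<bar>x0\<bar>) \<le> K * t * (3 + 2 * R')" using False K_pos t by (intro mult_left_mono) auto
    then have n2: "Fl * (K * t * (1 + \<bar>x0\<bar>)) \<le> Fl * (K * t * (3 + 2 * R'))" using Fl by (rule mult_left_mono)
    \<comment> \<open>\<open>bounded_ito_expansion\<close> asks for a nonnegative \<open>Q\<close>,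
      while \<open>?Q\<close> may be negative when \<open>J\<close> is large; since
      \<open>h x0 \<ge> 0\<close>, the cut at zero can be undone afterwards.\<close>
    have "f x0 + h x0 / 4 * max 0 ?Q - w x0 / 2 * (s\<^sub>1\<^sup>2 * t) - L * ((s\<^sub>1\<^sup>2 + 3 * s\<^sub>1 ^ 4) / 2 * (t * sqrt t))
        \<le> expectation (\<lambda>\<omega>. f (x0 + I t \<omega>))" if "\<bar>x0\<bar> \<le> R"
    proof (rule bounded_ito_expansion[OF fps bm t(1) I_ito[OF t0] \<sigma>_joint _ _ f taylor h(1) w(1) L])
      show "ennreal (max 0 ?Q) \<le> (\<integral>\<^sup>+\<omega>. (\<integral>\<^sup>+s\<in>{0..t}. ennreal ((\<sigma> (X s \<omega>))\<^sup>2) \<partial>lborel) \<partial>P)"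
        using quadratic_variation_lower[OF t0 t(2,3) s that] by (simp add: max_def ennreal_neg)
    qed (use \<sigma>_bound s\<^sub>1 in auto)
    moreover have "f x0 + h x0 / 4 * 0 - w x0 / 2 * (s\<^sub>1\<^sup>2 * t) - L * ((s\<^sub>1\<^sup>2 + 3 * s\<^sub>1 ^ 4) / 2 * (t * sqrt t))
        \<le> expectation (\<lambda>\<omega>. f (x0 + I t \<omega>))"
      by (rule bounded_ito_expansion[OF fps bm t(1) I_ito[OF t0] \<sigma>_joint _ _ f taylor h(1) w(1) L])
        (use \<sigma>_bound s\<^sub>1 in auto)
    ultimately have "f x0 + h x0 / 4 * ?Q - w x0 / 2 * (s\<^sub>1\<^sup>2 * t) - L * ((s\<^sub>1\<^sup>2 + 3 * s\<^sub>1 ^ 4) / 2 * (t * sqrt t))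
        \<le> expectation (\<lambda>\<omega>. f (x0 + I t \<omega>))"
    proof (cases "\<bar>x0\<bar> \<le> R")
      case True
      have "h x0 / 4 * ?Q \<le> h x0 / 4 * max 0 ?Q" using h(1)[of x0] by (intro mult_left_mono) auto
      then show ?thesis
        using \<open>\<bar>x0\<bar> \<le> R \<Longrightarrow> f x0 + h x0 / 4 * max 0 ?Q - w x0 / 2 * (s\<^sub>1\<^sup>2 * t) - L * ((s\<^sub>1\<^sup>2 + 3 * s\<^sub>1 ^ 4) / 2 * (t * sqrt t))
        \<le> expectation (\<lambda>\<omega>. f (x0 + I t \<omega>))\<close>[OF True] by linarith
    next
      case False
      then have "h x0 = 0" by (intro h(2)) auto
      then show ?thesis
        using \<open>f x0 + h x0 / 4 * 0 - w x0 / 2 * (s\<^sub>1\<^sup>2 * t) - L * ((s\<^sub>1\<^sup>2 + 3 * s\<^sub>1 ^ 4) / 2 * (t * sqrt t))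
        \<le> expectation (\<lambda>\<omega>. f (x0 + I t \<omega>))\<close> by simp
    qed
    moreover have "w x0 / 2 * (s\<^sub>1\<^sup>2 * t) \<le> wb / 2 * (s\<^sub>1\<^sup>2 * t)" using w(2)[of x0] t by (intro mult_right_mono) auto
    ultimately show ?thesis using near n2 p4 by linarith
  qed
qed

end

section \<open>Test functions\<close>

text \<open>A base point \<open>a\<close> strictly left of the support makes \<open>G\<close> a
  two-sided antiderivative on the whole line, because \<open>G\<close> vanishes identically to the
  left of the support.\<close>

lemma antiderivative_of_compactly_supported:
  fixes g :: "real \<Rightarrow> real"
  assumes g: "continuous_on UNIV g" and A: "\<And>y. y \<le> A \<Longrightarrow> g y = 0" and B: "\<And>y. B \<le> y \<Longrightarrow> g y = 0"
    and a: "a < A" "A \<le> B"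
  defines "G \<equiv> \<lambda>y. integral {a..y} g"
  shows "(G has_field_derivative g y) (at y)" "y \<le> A \<Longrightarrow> G y = 0" "B \<le> y \<Longrightarrow> G y = G B"
proof -
  have gi: "g integrable_on {u..w}" for u w
    by (rule integrable_continuous_real) (rule continuous_on_subset[OF g], simp)
  show z: "G y = 0" if "y \<le> A" for y
  proof -
    have "G y = integral {a..y} (\<lambda>_. 0)" unfolding G_def using that A
      by (intro Henstock_Kurzweil_Integration.integral_cong) auto
    then show ?thesis by simp
  qed
  show "B \<le> y \<Longrightarrow> G y = G B"
  proof -
    assume y: "B \<le> y"
    have "integral {a..B} g + integral {B..y} g = integral {a..y} g"
      using a y gi by (intro Henstock_Kurzweil_Integration.integral_combine) auto
    moreover have "integral {B..y} g = integral {B..y} (\<lambda>_. 0)"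
      using B by (intro Henstock_Kurzweil_Integration.integral_cong) auto
    ultimately show "G y = G B" unfolding G_def by simp
  qed
  show "(G has_field_derivative g y) (at y)"
  proof (cases "a < y")
    case True
    have "(G has_real_derivative g y) (at y within {a..y + 1})" unfolding G_def
      by (rule integral_has_real_derivative) (use True continuous_on_subset[OF g] in auto)
    then show ?thesis using True by (simp add: at_within_Icc_at)
  next
    case False
    have "((\<lambda>_. 0) has_field_derivative g y) (at y)" using A[of y] False a by simp
    then show ?thesis
      by (rule has_field_derivative_transform_within_open[of _ _ _ "{..<A}"]) (use False a z in auto)
  qed
qed

text \<open>The mean value inequality applied twice, to the remainder of \<open>f1\<close> and then
  to that of \<open>f\<close>, on an interval symmetric about zero so that both signs of
  \<open>y\<close> are covered. The constant is not optimal; what matters is the order in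
  \<open>y\<close>.\<close>

lemma second_order_taylor_bound:
  fixes f :: "real \<Rightarrow> real"
  assumes f: "\<And>x. (f has_field_derivative f1 x) (at x)" and f1: "\<And>x. (f1 has_field_derivative g x) (at x)"
    and g: "\<And>x y. \<bar>g x - g y\<bar> \<le> L * \<bar>x - y\<bar>"
  shows "\<bar>f (x + y) - f x - f1 x * y - g x / 2 * y\<^sup>2\<bar> \<le> L * \<bar>y\<bar> ^ 3"
proof -
  have L: "0 \<le> L" using g[of 0 1] by simp
  let ?S = "{- \<bar>y\<bar>..\<bar>y\<bar>}"
  define q where "q s = f1 (x + s) - f1 x - g x * s" for s
  define p where "p s = f (x + s) - f x - f1 x * s - g x / 2 * s\<^sup>2" for s
  have shift: "((\<lambda>s. F (x + s)) has_field_derivative F' (x + s)) (at s within ?S)"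
    if "\<And>x. (F has_field_derivative F' x) (at x)" for F F' :: "real \<Rightarrow> real" and s
  proof -
    have "((\<lambda>s. x + s) has_field_derivative 1) (at s within ?S)" by (auto intro!: derivative_eq_intros)
    from DERIV_chain2[OF that this] show ?thesis by simp
  qed
  have q': "(q has_field_derivative g (x + s) - g x) (at s within ?S)" for s
    unfolding q_def by (auto intro!: derivative_eq_intros shift[OF f1])
  have p': "(p has_field_derivative q s) (at s within ?S)" for s
    unfolding p_def q_def by (auto intro!: derivative_eq_intros shift[OF f])
  have qb: "norm (q s) \<le> L * \<bar>y\<bar>\<^sup>2" if s: "s \<in> ?S" for s
  proof -
    have "norm (q s - q 0) \<le> (L * \<bar>y\<bar>) * norm (s - 0)"
    proof (rule field_differentiable_bound[OF _ q'])
      fix u assume "u \<in> ?S"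
      then have "L * \<bar>x + u - x\<bar> \<le> L * \<bar>y\<bar>" using L by (intro mult_left_mono) auto
      then show "norm (g (x + u) - g x) \<le> L * \<bar>y\<bar>" using g[of "x + u" x] by simp
    qed (use s in auto)
    also have "\<dots> \<le> (L * \<bar>y\<bar>) * \<bar>y\<bar>" using s L by (intro mult_left_mono) auto
    finally show ?thesis by (simp add: q_def power2_eq_square)
  qed
  have "norm (p y - p 0) \<le> (L * \<bar>y\<bar>\<^sup>2) * norm (y - 0)"
    by (rule field_differentiable_bound[OF _ p' qb]) auto
  then show ?thesis by (simp add: p_def power2_eq_square power3_eq_cube mult.assoc)
qed

text \<open>The fixed bump, of unit height on \<open>[R, R + 2]\<close> and just outside the range
  of \<open>h\<close>. The interval in \<open>tent_mass\<close> contains both supports, and its left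
  end lies strictly below \<open>- R\<close> because it serves as base point of the
  antiderivatives.\<close>

definition tent :: "real \<Rightarrow> real \<Rightarrow> real" where "tent R x = max 0 (1 - \<bar>x - (R + 1)\<bar>)"

definition tent_mass :: "real \<Rightarrow> real" where "tent_mass R = integral {- R - 3..R + 2} (tent R)"

lemma tent_continuous: "continuous_on S (tent R)"
  unfolding tent_def[abs_def] by (intro continuous_intros)

lemma tent_mass_pos: assumes "0 < R" shows "0 < tent_mass R"
proof -
  have i: "tent R integrable_on {- R - 3..R + 2}"
    by (rule integrable_continuous_real[OF tent_continuous])
  have nn: "0 \<le> tent R x" for x by (simp add: tent_def)
  have "0 \<le> tent_mass R" unfolding tent_mass_def
    by (rule Henstock_Kurzweil_Integration.integral_nonneg[OF i]) (rule nn)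
  moreover have "tent_mass R \<noteq> 0"
  proof
    assume "tent_mass R = 0"
    then have "\<forall>x\<in>{- R - 3..R + 2}. tent R x = 0"
      unfolding tent_mass_def
      using integral_eq_0_iff[OF tent_continuous, of "- R - 3" "R + 2" R] nn assms by auto
    then have "tent R (R + 1) = 0" using assms by auto
    then show False by (simp add: tent_def)
  qed
  ultimately show ?thesis by simp
qed

text \<open>The second derivative is \<open>h\<close>, compensated by a multiple of a fixed bump so that \<open>f'\<close> has compact
  support; both \<open>f\<close> and \<open>f'\<close> are then controlled by the integral of \<open>h\<close> alone.\<close>

lemma test_function:
  fixes h :: "real \<Rightarrow> real"
  assumes R: "0 < R" and h: "\<And>x. 0 \<le> h x" "\<And>x. R \<le> \<bar>x\<bar> \<Longrightarrow> h x = 0" "\<And>x y. \<bar>h x - h y\<bar> \<le> Lh * \<bar>x - y\<bar>"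
  defines "m \<equiv> integral {- R - 3..R + 2} h"
  obtains f f1 :: "real \<Rightarrow> real" and L where
    "continuous_on UNIV f" "\<And>x. \<bar>f x\<bar> \<le> m * (2 * R + 5)" "\<And>x y. \<bar>f x - f y\<bar> \<le> m * \<bar>x - y\<bar>"
    "\<And>x y. \<bar>f (x + y) - f x - f1 x * y - (h x - m / tent_mass R * tent R x) / 2 * y\<^sup>2\<bar> \<le> L * \<bar>y\<bar> ^ 3"
    "0 \<le> L" "\<And>y. R + 2 \<le> y \<Longrightarrow> f y = f (R + 2)" "\<And>y. y \<le> - (R + 2) \<Longrightarrow> f y = f (- (R + 2))"
proof -
  let ?a = "- R - 3" and ?w = "\<lambda>x. m / tent_mass R * tent R x"
  have h_lip: "Lh-lipschitz_on UNIV h"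
    using h(3) h(3)[of 0 1] by (intro lipschitz_onI) (auto simp: dist_real_def)
  have h_cont: "continuous_on S h" for S
    by (rule continuous_on_subset[OF lipschitz_on_continuous_on[OF h_lip]]) simp
  have Lh: "0 \<le> Lh" using h(3)[of 0 1] by simp
  note c0 = tent_mass_pos[OF R]
  have hi: "h integrable_on {u..w}" for u w by (rule integrable_continuous_real[OF h_cont])
  have ti: "tent R integrable_on {u..w}" for u w by (rule integrable_continuous_real[OF tent_continuous])
  have tn: "0 \<le> tent R x" "tent R x \<le> 1" for x by (auto simp: tent_def)
  have m0: "0 \<le> m" unfolding m_def by (rule Henstock_Kurzweil_Integration.integral_nonneg[OF hi h(1)])
  define g where "g x = h x - ?w x" for x
  have g_cont: "continuous_on S g" for S unfolding g_def
    by (intro continuous_intros h_cont tent_continuous)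
  have gA: "g y = 0" if "y \<le> - R" for y using that h(2)[of y] R by (simp add: g_def tent_def)
  have gB: "g y = 0" if "R + 2 \<le> y" for y using that h(2)[of y] R by (simp add: g_def tent_def)
  define f1 where "f1 = (\<lambda>y. integral {?a..y} g)"
  note d1 = antiderivative_of_compactly_supported[of g "- R" "R + 2" ?a, OF g_cont gA gB]
  have f1': "(f1 has_field_derivative g y) (at y)" for y unfolding f1_def by (rule d1(1)) (use R in auto)
  have f1_split: "f1 y = integral {?a..y} h - m / tent_mass R * integral {?a..y} (tent R)" for y
  proof -
    have "?w integrable_on {?a..y}"
      by (rule integrable_continuous_real) (intro continuous_intros tent_continuous)
    then show ?thesis unfolding f1_def g_def
      by (simp only: Henstock_Kurzweil_Integration.integral_diff[OF hi] Henstock_Kurzweil_Integration.integral_mult_right)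
  qed
  \<comment> \<open>The factor \<open>m / tent_mass R\<close> is chosen for this: the scaled bump
    has the mass of \<open>h\<close>, so \<open>f1\<close> returns to zero.\<close>
  have f1B0: "f1 (R + 2) = 0"
    unfolding f1_split using c0 by (simp add: m_def tent_mass_def)
  have f1A: "f1 y = 0" if "y \<le> - R" for y unfolding f1_def by (rule d1(2)) (use R that in auto)
  have f1B: "f1 y = 0" if "R + 2 \<le> y" for y
    unfolding f1B0[symmetric] unfolding f1_def by (rule d1(3)) (use R that in auto)
  \<comment> \<open>Both terms of \<open>f1_split\<close>, the second one with its factor, lie
    between \<open>0\<close> and \<open>m\<close>, so their difference is at most \<open>m\<close>
    in absolute value.\<close>
  have f1_b: "\<bar>f1 y\<bar> \<le> m" for y
  proof (cases "y \<le> R + 2")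
    case True
    have sub: "{?a..y} \<subseteq> {?a..R + 2}" using True by auto
    have 1: "integral {?a..y} h \<le> m" unfolding m_def
      by (rule integral_subset_le[OF sub hi hi]) (use h(1) in auto)
    have 2: "0 \<le> integral {?a..y} h" by (rule Henstock_Kurzweil_Integration.integral_nonneg[OF hi h(1)])
    have 3: "integral {?a..y} (tent R) \<le> tent_mass R" unfolding tent_mass_def
      by (rule integral_subset_le[OF sub ti ti]) (use tn in auto)
    have 4: "0 \<le> integral {?a..y} (tent R)" by (rule Henstock_Kurzweil_Integration.integral_nonneg[OF ti]) (use tn in auto)
    have 5: "m / tent_mass R * integral {?a..y} (tent R) \<le> m / tent_mass R * tent_mass R"
      using 3 m0 c0 by (intro mult_left_mono) auto
    have 6: "0 \<le> m / tent_mass R * integral {?a..y} (tent R)" using 4 m0 c0 by (intro mult_nonneg_nonneg) auto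
    from 5 have 7: "m / tent_mass R * integral {?a..y} (tent R) \<le> m" using c0 by simp
    show ?thesis unfolding f1_split using 1 2 6 7 by linarith
  next
    case False
    then show ?thesis using f1B m0 by simp
  qed
  have f1_cont: "continuous_on S f1" for S
    by (rule DERIV_continuous_on) (rule has_field_derivative_at_within[OF f1'])
  define f where "f = (\<lambda>y. integral {?a..y} f1)"
  note d = antiderivative_of_compactly_supported[of f1 "- R" "R + 2" ?a, OF f1_cont f1A f1B]
  have f': "(f has_field_derivative f1 y) (at y)" for y unfolding f_def by (rule d(1)) (use R in auto)
  have fA: "f y = 0" if "y \<le> - R" for y unfolding f_def by (rule d(2)) (use R that in auto)
  have fB: "f y = f (R + 2)" if "R + 2 \<le> y" for y
    unfolding f_def by (rule d(3)) (use R that in auto)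
  have f_lip: "\<bar>f x - f y\<bar> \<le> m * \<bar>x - y\<bar>" for x y
    using field_differentiable_bound[of UNIV f f1 m x y] f' f1_b by auto
  \<comment> \<open>\<open>f\<close> vanishes at the left end and has Lipschitz constant
    \<open>m\<close>; \<open>2 * R + 5\<close> is the length of the interval.\<close>
  have f_b: "\<bar>f x\<bar> \<le> m * (2 * R + 5)" for x
  proof -
    have *: "\<bar>f y\<bar> \<le> m * (2 * R + 5)" if "y \<le> R + 2" for y
    proof (cases "?a \<le> y")
      case True
      have "\<bar>f y - f ?a\<bar> \<le> m * \<bar>y - ?a\<bar>" by (rule f_lip)
      also have "\<dots> \<le> m * (2 * R + 5)" using True that m0 by (intro mult_left_mono) auto
      finally show ?thesis using fA[of ?a] R by simp
    next
      case False
      then show ?thesis using fA[of y] R m0 by simp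
    qed
    show ?thesis using *[of x] *[of "R + 2"] fB[of x] by (cases "x \<le> R + 2") auto
  qed
  have g_lip: "\<bar>g x - g y\<bar> \<le> (Lh + m / tent_mass R) * \<bar>x - y\<bar>" for x y
  proof -
    have "\<bar>tent R x - tent R y\<bar> \<le> \<bar>x - y\<bar>" unfolding tent_def by linarith
    then have "m / tent_mass R * \<bar>tent R x - tent R y\<bar> \<le> m / tent_mass R * \<bar>x - y\<bar>"
      using m0 c0 by (intro mult_left_mono) auto
    moreover have "\<bar>?w x - ?w y\<bar> = m / tent_mass R * \<bar>tent R x - tent R y\<bar>"
      unfolding right_diff_distrib[symmetric] abs_mult using m0 c0 by simp
    moreover have tri: "\<bar>p - u - (q - w)\<bar> \<le> \<bar>p - q\<bar> + \<bar>u - w\<bar>" for p q u w :: real by linarith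
    ultimately have "\<bar>h x - h y\<bar> + \<bar>?w x - ?w y\<bar> \<le> Lh * \<bar>x - y\<bar> + m / tent_mass R * \<bar>x - y\<bar>"
      using h(3)[of x y] by (intro add_mono) simp_all
    then show ?thesis unfolding g_def distrib_right by (rule order_trans[OF tri])
  qed
  show ?thesis
  proof (rule that[of f f1 "Lh + m / tent_mass R"])
    show "continuous_on UNIV f" by (rule DERIV_continuous_on) (rule has_field_derivative_at_within[OF f'])
    show "\<bar>f (x + y) - f x - f1 x * y - (h x - ?w x) / 2 * y\<^sup>2\<bar> \<le> (Lh + m / tent_mass R) * \<bar>y\<bar> ^ 3" for x y
      using second_order_taylor_bound[OF f' f1' g_lip, of x y] by (simp add: g_def)
    show "0 \<le> Lh + m / tent_mass R" using Lh m0 c0 by simp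
    show "f y = f (R + 2)" if "R + 2 \<le> y" for y by (rule fB[OF that])
    show "f y = f (- (R + 2))" if "y \<le> - (R + 2)" for y using fA that R by simp
  qed (rule f_b f_lip)+
qed

section \<open>Stationarity\<close>

locale hawkes_stationary =
  fixes \<alpha> :: real and \<zeta> :: "real^'m" and c :: "real^'m^'m" and b \<sigma> a :: "real \<Rightarrow> real"
    and Pr :: "real \<times> (real^'m) \<Rightarrow> 'w measure" and F :: "real \<Rightarrow> 'w measure"
    and N :: "'m \<Rightarrow> real \<Rightarrow> 'w \<Rightarrow> nat" and W X :: "real \<Rightarrow> 'w \<Rightarrow> real"
    and lam :: "real \<Rightarrow> 'w \<Rightarrow> real^'m" and \<pi> :: "(real \<times> (real^'m)) measure"
    and \<kappa> :: "real^'m" and r Kb s\<^sub>1 :: real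
  assumes start: "\<And>z. z \<in> space state_space \<Longrightarrow> hawkes_small_time \<alpha> \<zeta> c b \<sigma> a (Pr z) F N W X lam z \<kappa> r Kb s\<^sub>1"
    and kernel: "\<And>t. 0 \<le> t \<Longrightarrow> transition Pr X lam t \<in> state_space \<rightarrow>\<^sub>M prob_algebra state_space"
    and invariant: "invariant_probability state_space (transition Pr X lam) \<pi>"
begin

section \<open>The invariant law and the transition kernel\<close>

sublocale pi: prob_space \<pi> using invariant unfolding invariant_probability_def by blast

lemma sets_pi: "sets \<pi> = sets state_space"
  using invariant unfolding invariant_probability_def by blast

lemma space_pi: "space \<pi> = space state_space"
  by (rule sets_eq_imp_space_eq[OF sets_pi])

lemma space_state_space: "space (state_space :: (real \<times> (real^'m)) measure) = UNIV \<times> {l. \<forall>i. 0 \<le> l $ i}"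
  by (simp add: state_space_def space_restrict_space)

lemma zero_state: "(0, 0) \<in> space (state_space :: (real \<times> (real^'m)) measure)"
  by (simp add: space_state_space)

lemma pi_not_empty: "space \<pi> \<noteq> {}"
  using pi.not_empty .

lemma borel_measurable_pi: "f \<in> borel_measurable borel \<Longrightarrow> f \<in> borel_measurable \<pi>"
  for f :: "real \<times> (real^'m) \<Rightarrow> 'b::topological_space"
  unfolding measurable_cong_sets[OF sets_pi refl] state_space_def by (rule measurable_restrict_space1)

lemma process_measurable:
  assumes z: "z \<in> space state_space" and t: "0 \<le> t"
  shows "(\<lambda>\<omega>. (X t \<omega>, lam t \<omega>)) \<in> Pr z \<rightarrow>\<^sub>M state_space"
proof -
  interpret Z: hawkes_small_time \<alpha> \<zeta> c b \<sigma> a "Pr z" F N W X lam z \<kappa> r Kb s\<^sub>1 by (rule start[OF z])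
  have "lam t \<in> borel_measurable (Pr z)" by (rule filtered_measurable_P[OF Z.fps Z.lam_meas[OF t]])
  then have "(\<lambda>\<omega>. (X t \<omega>, lam t \<omega>)) \<in> Pr z \<rightarrow>\<^sub>M (borel :: (real \<times> (real^'m)) measure)"
    using Z.X_meas_P[OF t] by simp
  then show ?thesis unfolding state_space_def
    by (intro measurable_restrict_space2) (auto simp: Z.lam_nonneg[OF t])
qed

lemma transition_nn_integral:
  assumes z: "z \<in> space state_space" and t: "0 \<le> t" and g: "g \<in> borel_measurable state_space"
  shows "(\<integral>\<^sup>+y. g y \<partial>transition Pr X lam t z) = (\<integral>\<^sup>+\<omega>. g (X t \<omega>, lam t \<omega>) \<partial>Pr z)"
  unfolding transition_def using g by (subst nn_integral_distr[OF process_measurable[OF z t]]) simp_all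

text \<open>Invariance is given for sets and amounts to \<open>\<pi> = \<pi> \<bind> ?K\<close>;
  integration against the bind extends it to nonnegative functions. Measurability in the starting
  point comes from the kernel hypothesis.\<close>

lemma invariant_nn_integral:
  assumes t: "0 \<le> t" and g: "g \<in> borel_measurable state_space"
  shows "(\<lambda>z. \<integral>\<^sup>+\<omega>. g (X t \<omega>, lam t \<omega>) \<partial>Pr z) \<in> borel_measurable \<pi>"
    and "(\<integral>\<^sup>+z. (\<integral>\<^sup>+\<omega>. g (X t \<omega>, lam t \<omega>) \<partial>Pr z) \<partial>\<pi>) = (\<integral>\<^sup>+z. g z \<partial>\<pi>)"
proof -
  let ?K = "transition Pr X lam t"
  have K: "?K \<in> \<pi> \<rightarrow>\<^sub>M subprob_algebra state_space"
    using measurable_prob_algebraD[OF kernel[OF t]] measurable_cong_sets[OF sets_pi refl] by blast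
  have "(\<lambda>z. \<integral>\<^sup>+y. g y \<partial>?K z) \<in> borel_measurable \<pi>"
    by (rule measurable_compose[OF K nn_integral_measurable_subprob_algebra[OF g]])
  then show "(\<lambda>z. \<integral>\<^sup>+\<omega>. g (X t \<omega>, lam t \<omega>) \<partial>Pr z) \<in> borel_measurable \<pi>"
    by (rule measurable_cong[THEN iffD1, rotated]) (simp add: space_pi transition_nn_integral[OF _ t g])
  have "\<pi> = \<pi> \<bind> ?K"
  proof (rule measure_eqI)
    show "sets \<pi> = sets (\<pi> \<bind> ?K)"
      using sets_bind[OF sets_kernel[OF K] pi_not_empty] sets_pi by simp
    fix A assume "A \<in> sets \<pi>"
    then have "A \<in> sets state_space" by (simp add: sets_pi)
    then show "emeasure \<pi> A = emeasure (\<pi> \<bind> ?K) A"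
      using emeasure_bind[OF pi_not_empty K] t invariant unfolding invariant_probability_def by simp
  qed
  then have "(\<integral>\<^sup>+z. g z \<partial>\<pi>) = (\<integral>\<^sup>+z. (\<integral>\<^sup>+y. g y \<partial>?K z) \<partial>\<pi>)"
    using nn_integral_bind[OF g K] by simp
  also have "\<dots> = (\<integral>\<^sup>+z. (\<integral>\<^sup>+\<omega>. g (X t \<omega>, lam t \<omega>) \<partial>Pr z) \<partial>\<pi>)"
    by (rule nn_integral_cong) (simp add: space_pi transition_nn_integral[OF _ t g])
  finally show "(\<integral>\<^sup>+z. (\<integral>\<^sup>+\<omega>. g (X t \<omega>, lam t \<omega>) \<partial>Pr z) \<partial>\<pi>) = (\<integral>\<^sup>+z. g z \<partial>\<pi>)" ..
qed

section \<open>Integrability of the intensities under the invariant law\<close>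

definition v :: "real \<times> (real^'m) \<Rightarrow> real" where "v z = (\<Sum>i\<in>UNIV. \<kappa> $ i * snd z $ i)"
definition C :: real where "C = \<alpha> * (\<Sum>i\<in>UNIV. \<kappa> $ i * \<zeta> $ i)"

lemma parameters: "0 < \<alpha>" "r < 1" "0 < r" "0 < C" "0 < Kb" "0 < s\<^sub>1" "0 < \<kappa> $ i"
proof -
  interpret Z: hawkes_small_time \<alpha> \<zeta> c b \<sigma> a "Pr (0, 0)" F N W X lam "(0, 0)" \<kappa> r Kb s\<^sub>1
    by (rule start[OF zero_state])
  show "0 < \<alpha>" "r < 1" "0 < r" "0 < C" "0 < Kb" "0 < s\<^sub>1" "0 < \<kappa> $ i"
    using Z.\<alpha>_pos Z.r_less Z.r_pos Z.C_pos Z.Kb Z.s\<^sub>1 Z.\<kappa>_pos by (auto simp: C_def Z.C_def)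
qed

lemma v_measurable: "v \<in> borel_measurable borel"
  unfolding v_def by (intro borel_measurable_continuous_onI continuous_intros)

lemma v_nonneg: "z \<in> space state_space \<Longrightarrow> 0 \<le> v z"
  using parameters(7) unfolding v_def by (intro sum_nonneg mult_nonneg_nonneg) (auto simp: space_state_space less_imp_le)

lemma expectation_V_contraction:
  assumes z: "z \<in> space state_space"
  shows "(\<integral>\<^sup>+\<omega>. ennreal (v (X 1 \<omega>, lam 1 \<omega>)) \<partial>Pr z) \<le> ennreal ((1 - \<alpha> * (1 - r) / (1 + \<alpha>)) * v z + C)"
proof -
  interpret Z: hawkes_small_time \<alpha> \<zeta> c b \<sigma> a "Pr z" F N W X lam z \<kappa> r Kb s\<^sub>1 by (rule start[OF z])
  show ?thesis using Z.V_contraction unfolding Z.V_def Z.v_def Z.C_def v_def C_def by simp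
qed

text \<open>The Lyapunov function \<open>v\<close> is tested through the bounded convex decreasing functions
  \<open>exp (- e * v)\<close>, so that no integrability of \<open>v\<close> is presupposed.\<close>

lemma exp_test:
  assumes e: "0 < e"
  shows "(\<integral>\<^sup>+z. ennreal (v z * exp (- e * v z)) \<partial>\<pi>) \<le> ennreal (C * (1 + \<alpha>) / (\<alpha> * (1 - r)))"
proof -
  define d where "d = \<alpha> * (1 - r) / (1 + \<alpha>)"
  have d: "0 < d" "d \<le> 1" unfolding d_def using parameters(1-3) by (auto simp: field_simps)
  define \<phi> where "\<phi> z = exp (- e * v z)" for z
  have \<phi>m: "\<phi> \<in> borel_measurable borel" unfolding \<phi>_def using v_measurable by simp
  have gm: "(\<lambda>z. ennreal (\<phi> z)) \<in> borel_measurable state_space"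
    unfolding state_space_def using \<phi>m by (intro measurable_restrict_space1) simp
  note inv = invariant_nn_integral[OF zero_le_one gm]
  have \<phi>1: "\<phi> z \<le> 1" "0 < \<phi> z" if "z \<in> space state_space" for z
    unfolding \<phi>_def using v_nonneg[OF that] e by auto
  have pt: "ennreal (\<phi> z) + ennreal (e * d) * ennreal (v z * \<phi> z)
      \<le> (\<integral>\<^sup>+\<omega>. ennreal (\<phi> (X 1 \<omega>, lam 1 \<omega>)) \<partial>Pr z) + ennreal (e * C)" if z: "z \<in> space state_space" for z
  proof -
    interpret Z: hawkes_small_time \<alpha> \<zeta> c b \<sigma> a "Pr z" F N W X lam z \<kappa> r Kb s\<^sub>1 by (rule start[OF z])
    let ?Y = "\<lambda>\<omega>. (X 1 \<omega>, lam 1 \<omega>)"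
    note pm = process_measurable[OF z zero_le_one]
    have Ys: "?Y \<omega> \<in> space state_space" if "\<omega> \<in> space (Pr z)" for \<omega> using measurable_space[OF pm that] .
    have mb: "(\<lambda>\<omega>. f (?Y \<omega>)) \<in> borel_measurable (Pr z)" if "f \<in> borel_measurable borel" for f :: "real \<times> (real^'m) \<Rightarrow> real"
    proof -
      have "f \<in> borel_measurable state_space" unfolding state_space_def by (rule measurable_restrict_space1[OF that])
      from measurable_compose[OF pm this] show ?thesis .
    qed
    have k0: "0 \<le> (1 - d) * v z + C" using d v_nonneg[OF z] parameters(4) by (intro add_nonneg_nonneg mult_nonneg_nonneg) auto
    have vi: "integrable (Pr z) (\<lambda>\<omega>. v (?Y \<omega>))" "Z.expectation (\<lambda>\<omega>. v (?Y \<omega>)) \<le> (1 - d) * v z + C"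
      using Z.integrable_of_nn_integral_le[OF mb[OF v_measurable] v_nonneg[OF Ys] _ k0]
        expectation_V_contraction[OF z] unfolding d_def by auto
    have \<phi>i: "integrable (Pr z) (\<lambda>\<omega>. \<phi> (?Y \<omega>))"
    proof (rule Z.integrable_const_bound[where B=1])
      show "AE \<omega> in Pr z. norm (\<phi> (?Y \<omega>)) \<le> 1" using \<phi>1[OF Ys] by (auto simp: less_imp_le)
    qed (rule mb[OF \<phi>m])
    have "\<phi> z - e * \<phi> z * (Z.expectation (\<lambda>\<omega>. v (?Y \<omega>)) - v z) = Z.expectation (\<lambda>\<omega>. \<phi> z - e * \<phi> z * (v (?Y \<omega>) - v z))"
      using vi(1) by (simp add: Z.prob_space)
    also have "\<dots> \<le> Z.expectation (\<lambda>\<omega>. \<phi> (?Y \<omega>))"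
    proof (rule integral_mono[OF _ \<phi>i])
      show "integrable (Pr z) (\<lambda>\<omega>. \<phi> z - e * \<phi> z * (v (?Y \<omega>) - v z))" using vi(1) by simp
      fix \<omega>
      \<comment> \<open>The tangent line of \<open>exp\<close> at the starting value: by convexity
        the upper bound on the mean of \<open>v\<close> becomes a lower bound on the mean of
        \<open>\<phi>\<close>.\<close>
      have "\<phi> z * (1 + - e * (v (?Y \<omega>) - v z)) \<le> \<phi> z * exp (- e * (v (?Y \<omega>) - v z))"
        using \<phi>1(2)[OF z] exp_ge_add_one_self[of "- e * (v (?Y \<omega>) - v z)"] by (intro mult_left_mono) auto
      also have "\<dots> = \<phi> (?Y \<omega>)" unfolding \<phi>_def by (simp add: exp_add[symmetric] algebra_simps)
      finally show "\<phi> z - e * \<phi> z * (v (?Y \<omega>) - v z) \<le> \<phi> (?Y \<omega>)" by (simp add: algebra_simps)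
    qed
    finally have 1: "\<phi> z - e * \<phi> z * (Z.expectation (\<lambda>\<omega>. v (?Y \<omega>)) - v z) \<le> Z.expectation (\<lambda>\<omega>. \<phi> (?Y \<omega>))" .
    have "e * \<phi> z * (Z.expectation (\<lambda>\<omega>. v (?Y \<omega>)) - v z) \<le> e * \<phi> z * ((1 - d) * v z + C - v z)"
      using vi(2) e \<phi>1(2)[OF z] by (intro mult_left_mono) auto
    also have "\<dots> = e * \<phi> z * C - e * d * (v z * \<phi> z)" by (simp add: algebra_simps)
    also have "\<dots> \<le> e * C - e * d * (v z * \<phi> z)"
      using e parameters(4) \<phi>1(1)[OF z] by (simp add: mult_left_le)
    finally have "\<phi> z + e * d * (v z * \<phi> z) \<le> Z.expectation (\<lambda>\<omega>. \<phi> (?Y \<omega>)) + e * C" using 1 by linarith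
    then have "ennreal (\<phi> z + e * d * (v z * \<phi> z)) \<le> ennreal (Z.expectation (\<lambda>\<omega>. \<phi> (?Y \<omega>)) + e * C)" by (rule ennreal_leI)
    moreover have "ennreal (\<phi> z + e * d * (v z * \<phi> z)) = ennreal (\<phi> z) + ennreal (e * d) * ennreal (v z * \<phi> z)"
      using e d v_nonneg[OF z] \<phi>1(2)[OF z] by (simp add: ennreal_mult)
    moreover have "ennreal (Z.expectation (\<lambda>\<omega>. \<phi> (?Y \<omega>)) + e * C) = (\<integral>\<^sup>+\<omega>. ennreal (\<phi> (?Y \<omega>)) \<partial>Pr z) + ennreal (e * C)"
      using e parameters(4)
      by (subst nn_integral_eq_integral[OF \<phi>i]) (auto simp: \<phi>_def intro!: ennreal_plus Bochner_Integration.integral_nonneg)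
    ultimately show ?thesis by simp
  qed
  have "(\<integral>\<^sup>+z. ennreal (\<phi> z) \<partial>\<pi>) + ennreal (e * d) * (\<integral>\<^sup>+z. ennreal (v z * \<phi> z) \<partial>\<pi>)
      = (\<integral>\<^sup>+z. ennreal (\<phi> z) + ennreal (e * d) * ennreal (v z * \<phi> z) \<partial>\<pi>)"
    using borel_measurable_pi[OF \<phi>m] borel_measurable_pi[OF v_measurable] by (simp add: nn_integral_add nn_integral_cmult)
  also have "\<dots> \<le> (\<integral>\<^sup>+z. (\<integral>\<^sup>+\<omega>. ennreal (\<phi> (X 1 \<omega>, lam 1 \<omega>)) \<partial>Pr z) + ennreal (e * C) \<partial>\<pi>)"
    by (rule nn_integral_mono) (use pt in \<open>simp add: space_pi\<close>)
  also have "\<dots> = (\<integral>\<^sup>+z. ennreal (\<phi> z) \<partial>\<pi>) + ennreal (e * C)"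
    using inv by (simp add: nn_integral_add pi.emeasure_space_1)
  finally have le: "(\<integral>\<^sup>+z. ennreal (\<phi> z) \<partial>\<pi>) + ennreal (e * d) * (\<integral>\<^sup>+z. ennreal (v z * \<phi> z) \<partial>\<pi>)
      \<le> (\<integral>\<^sup>+z. ennreal (\<phi> z) \<partial>\<pi>) + ennreal (e * C)" .
  have "(\<integral>\<^sup>+z. ennreal (\<phi> z) \<partial>\<pi>) \<le> (\<integral>\<^sup>+z. ennreal 1 \<partial>\<pi>)"
    by (rule nn_integral_mono) (use \<phi>1(1) in \<open>auto simp: space_pi intro: ennreal_leI\<close>)
  then have "(\<integral>\<^sup>+z. ennreal (\<phi> z) \<partial>\<pi>) < top" by (rule le_less_trans) (simp add: pi.emeasure_space_1)
  \<comment> \<open>The integral of \<open>\<phi>\<close> is finite and cancels. What remains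
    carries the factor \<open>e\<close> on both sides, so the final bound does not depend on
    \<open>e\<close>.\<close>
  then have le2: "ennreal (e * d) * (\<integral>\<^sup>+z. ennreal (v z * \<phi> z) \<partial>\<pi>) \<le> ennreal (e * C)"
    using le unfolding ennreal_add_left_cancel_le by auto
  have "(\<integral>\<^sup>+z. ennreal (v z * \<phi> z) \<partial>\<pi>) = ennreal (1 / (e * d)) * (ennreal (e * d) * (\<integral>\<^sup>+z. ennreal (v z * \<phi> z) \<partial>\<pi>))"
    using e d by (simp add: mult.assoc[symmetric] ennreal_mult[symmetric] del: ennreal_1) (simp add: ennreal_1)
  also have "\<dots> \<le> ennreal (1 / (e * d)) * ennreal (e * C)" by (rule mult_left_mono[OF le2]) simp
  also have "\<dots> = ennreal (C * (1 + \<alpha>) / (\<alpha> * (1 - r)))"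
  proof -
    have "1 / (e * d) * (e * C) = C * (1 + \<alpha>) / (\<alpha> * (1 - r))" using e by (simp add: d_def mult.commute)
    then show ?thesis using e d parameters(4) by (subst ennreal_mult[symmetric]) (simp_all add: less_imp_le)
  qed
  finally show ?thesis unfolding \<phi>_def .
qed

text \<open>The bound of \<open>exp_test\<close> is uniform in \<open>e\<close>, so Fatou's lemma
  along \<open>e = 1 / Suc n\<close> gives the first moment.\<close>

lemma v_mean: "integrable \<pi> v"
proof -
  let ?B = "ennreal (C * (1 + \<alpha>) / (\<alpha> * (1 - r)))"
  let ?f = "\<lambda>n z. ennreal (v z * exp (- (1 / real (Suc n)) * v z))"
  have "(\<integral>\<^sup>+z. ennreal (v z) \<partial>\<pi>) = (\<integral>\<^sup>+z. liminf (\<lambda>n. ?f n z) \<partial>\<pi>)"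
  proof (rule nn_integral_cong)
    fix z
    have "(\<lambda>n. ?f n z) \<longlonglongrightarrow> ennreal (v z * exp (- 0 * v z))"
      using LIMSEQ_inverse_real_of_nat by (intro tendsto_intros) (simp add: inverse_eq_divide)
    then show "ennreal (v z) = liminf (\<lambda>n. ?f n z)" by (simp add: lim_imp_Liminf)
  qed
  also have "\<dots> \<le> liminf (\<lambda>n. \<integral>\<^sup>+z. ?f n z \<partial>\<pi>)"
    using borel_measurable_pi[OF v_measurable] by (intro nn_integral_liminf) simp
  also have "\<dots> \<le> ?B"
  proof (rule Liminf_le)
    have "(\<integral>\<^sup>+z. ?f n z \<partial>\<pi>) \<le> ?B" for n by (rule exp_test) simp
    then show "\<forall>\<^sub>F n in sequentially. (\<integral>\<^sup>+z. ?f n z \<partial>\<pi>) \<le> ?B" by simp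
  qed simp
  finally have "(\<integral>\<^sup>+z. ennreal (v z) \<partial>\<pi>) < \<infinity>" by (rule le_less_trans) simp
  then show ?thesis using v_nonneg borel_measurable_pi[OF v_measurable]
    by (intro integrableI_nonneg) (auto simp: space_pi)
qed

section \<open>Stationarity tested against functions of \<open>X\<close>\<close>

text \<open>Adding \<open>B\<close> makes the integrands nonnegative and reduces the claim to
  \<open>invariant_nn_integral\<close>, which also supplies measurability in the starting
  point.\<close>

lemma invariant_expectation:
  fixes f :: "real \<Rightarrow> real"
  assumes t: "0 \<le> t" and f: "f \<in> borel_measurable borel" "\<And>x. \<bar>f x\<bar> \<le> B"
  shows "integrable \<pi> (\<lambda>z. \<integral>\<omega>. f (X t \<omega>) \<partial>Pr z)"
    and "(\<integral>z. (\<integral>\<omega>. f (X t \<omega>) \<partial>Pr z) \<partial>\<pi>) = (\<integral>z. f (fst z) \<partial>\<pi>)"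
proof -
  define g where "g z = f (fst z) + B" for z :: "real \<times> (real^'m)"
  have g: "0 \<le> g z" for z unfolding g_def using f(2)[of "fst z"] by linarith
  have B: "0 \<le> B" using f(2)[of 0] by linarith
  have gm: "g \<in> borel_measurable borel" unfolding g_def using f(1)
    by (intro borel_measurable_add measurable_compose[OF _ f(1)]) (simp_all add: borel_prod[symmetric])
  have gm': "(\<lambda>z. ennreal (g z)) \<in> borel_measurable state_space"
    unfolding state_space_def using gm by (intro measurable_restrict_space1) simp
  note inv = invariant_nn_integral[OF t gm']
  have E: "(\<integral>\<^sup>+\<omega>. ennreal (g (X t \<omega>, lam t \<omega>)) \<partial>Pr z) = ennreal ((\<integral>\<omega>. f (X t \<omega>) \<partial>Pr z) + B)"
    and Eb: "\<bar>\<integral>\<omega>. f (X t \<omega>) \<partial>Pr z\<bar> \<le> B"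
    if z: "z \<in> space state_space" for z
  proof -
    interpret Z: hawkes_small_time \<alpha> \<zeta> c b \<sigma> a "Pr z" F N W X lam z \<kappa> r Kb s\<^sub>1 by (rule start[OF z])
    have i: "integrable (Pr z) (\<lambda>\<omega>. f (X t \<omega>))"
      by (rule Z.integrable_const_bound[where B=B]) (use f measurable_compose[OF Z.X_meas_P[OF t] f(1)] in auto)
    have "(\<integral>\<^sup>+\<omega>. ennreal (g (X t \<omega>, lam t \<omega>)) \<partial>Pr z) = ennreal (\<integral>\<omega>. f (X t \<omega>) + B \<partial>Pr z)"
      unfolding g_def fst_conv using i g unfolding g_def
      by (intro nn_integral_eq_integral) (auto simp: f(2) abs_le_iff intro!: AE_I2)
    then show "(\<integral>\<^sup>+\<omega>. ennreal (g (X t \<omega>, lam t \<omega>)) \<partial>Pr z) = ennreal ((\<integral>\<omega>. f (X t \<omega>) \<partial>Pr z) + B)"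
      using i by (simp add: Z.prob_space)
    have "norm (\<integral>\<omega>. f (X t \<omega>) \<partial>Pr z) \<le> (\<integral>\<omega>. norm (f (X t \<omega>)) \<partial>Pr z)" by (rule integral_norm_bound)
    also have "\<dots> \<le> (\<integral>\<omega>. B \<partial>Pr z)" using i f(2) by (intro integral_mono) auto
    finally show "\<bar>\<integral>\<omega>. f (X t \<omega>) \<partial>Pr z\<bar> \<le> B" by (simp add: Z.prob_space)
  qed
  have m: "(\<lambda>z. (\<integral>\<omega>. f (X t \<omega>) \<partial>Pr z) + B) \<in> borel_measurable \<pi>"
  proof (rule measurable_cong[THEN iffD1, rotated, OF borel_measurable_enn2real[OF inv(1)]])
    fix z assume "z \<in> space \<pi>"
    then have z: "z \<in> space state_space" by (simp add: space_pi)
    show "enn2real (\<integral>\<^sup>+\<omega>. ennreal (g (X t \<omega>, lam t \<omega>)) \<partial>Pr z) = (\<integral>\<omega>. f (X t \<omega>) \<partial>Pr z) + B"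
      unfolding E[OF z] using Eb[OF z] by (intro enn2real_ennreal) linarith
  qed
  then have m': "(\<lambda>z. \<integral>\<omega>. f (X t \<omega>) \<partial>Pr z) \<in> borel_measurable \<pi>"
    using borel_measurable_diff[OF m borel_measurable_const[of B]] by simp
  show i: "integrable \<pi> (\<lambda>z. \<integral>\<omega>. f (X t \<omega>) \<partial>Pr z)"
    by (rule pi.integrable_const_bound[where B=B, OF _ m']) (use Eb in \<open>auto simp: space_pi\<close>)
  have fi: "integrable \<pi> (\<lambda>z. f (fst z))"
  proof (rule pi.integrable_const_bound[where B=B])
    show "(\<lambda>z. f (fst z)) \<in> borel_measurable \<pi>"
      using borel_measurable_diff[OF borel_measurable_pi[OF gm] borel_measurable_const[of B]] by (simp add: g_def)
  qed (use f(2) in auto)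
  have "ennreal ((\<integral>z. (\<integral>\<omega>. f (X t \<omega>) \<partial>Pr z) \<partial>\<pi>) + B) = ennreal (\<integral>z. (\<integral>\<omega>. f (X t \<omega>) \<partial>Pr z) + B \<partial>\<pi>)"
    using i by (simp add: pi.prob_space)
  also have "\<dots> = (\<integral>\<^sup>+z. ennreal ((\<integral>\<omega>. f (X t \<omega>) \<partial>Pr z) + B) \<partial>\<pi>)"
  proof (rule nn_integral_eq_integral[symmetric])
    have "0 \<le> (\<integral>\<omega>. f (X t \<omega>) \<partial>Pr z) + B" if "z \<in> space \<pi>" for z
      using Eb[of z] that unfolding space_pi by linarith
    then show "AE z in \<pi>. 0 \<le> (\<integral>\<omega>. f (X t \<omega>) \<partial>Pr z) + B" by (rule AE_I2)
  qed (use i in simp)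
  also have "\<dots> = (\<integral>\<^sup>+z. (\<integral>\<^sup>+\<omega>. ennreal (g (X t \<omega>, lam t \<omega>)) \<partial>Pr z) \<partial>\<pi>)"
    by (rule nn_integral_cong) (simp add: space_pi E)
  also have "\<dots> = (\<integral>\<^sup>+z. ennreal (g z) \<partial>\<pi>)" by (rule inv(2))
  also have "\<dots> = ennreal (\<integral>z. g z \<partial>\<pi>)"
    using fi g unfolding g_def by (intro nn_integral_eq_integral) auto
  also have "(\<integral>z. g z \<partial>\<pi>) = (\<integral>z. f (fst z) \<partial>\<pi>) + B"
    unfolding g_def using fi by (simp add: pi.prob_space)
  finally have e: "ennreal ((\<integral>z. (\<integral>\<omega>. f (X t \<omega>) \<partial>Pr z) \<partial>\<pi>) + B) = ennreal ((\<integral>z. f (fst z) \<partial>\<pi>) + B)" .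
  have nb: "0 \<le> (\<integral>z. h z \<partial>\<pi>) + B" if "integrable \<pi> h" "\<And>z. z \<in> space \<pi> \<Longrightarrow> \<bar>h z\<bar> \<le> B" for h :: "real \<times> (real^'m) \<Rightarrow> real"
  proof -
    have "(\<integral>z. - B \<partial>\<pi>) \<le> (\<integral>z. h z \<partial>\<pi>)" using that by (intro integral_mono) (auto simp: abs_le_iff minus_le_iff)
    then show ?thesis by (simp add: pi.prob_space)
  qed
  show "(\<integral>z. (\<integral>\<omega>. f (X t \<omega>) \<partial>Pr z) \<partial>\<pi>) = (\<integral>z. f (fst z) \<partial>\<pi>)"
    using e nb[OF i] nb[OF fi] Eb f(2) by (simp add: space_pi)
qed

definition K :: real where "K = 2 * Kb * (1 + s\<^sub>1)"
definition J :: real where "J = (\<Sum>j\<in>UNIV. 1 / \<kappa> $ j) * ((\<integral>z. v z \<partial>\<pi>) + C)"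

text \<open>The errors of \<open>small_time_lower\<close> that survive division by \<open>t\<close>,
  per unit of the integral of \<open>h\<close>: the compensating bump, the drift for near starting
  points, and jumps together with far starting points. Here \<open>R + 2\<close> is the radius
  outside which \<open>f\<close> is constant and \<open>2 * R + 5\<close> comes from the supremum of
  \<open>f\<close>; the factor \<open>4 / s\<^sub>0\<close> inverts the gain
  \<open>h / 4 * s\<^sub>0\<close>.\<close>

definition bound :: "real \<Rightarrow> real \<Rightarrow> real" where
  "bound R s\<^sub>0 = 4 / s\<^sub>0 * (1 / tent_mass R / 2 * s\<^sub>1\<^sup>2 + K * (3 + 2 * (R + 2)) + 2 * (2 * R + 5) * (6 * K + 36 * s\<^sub>1\<^sup>2 + J))"

lemma fst_measurable: "g \<in> borel_measurable borel \<Longrightarrow> (\<lambda>z. g (fst z)) \<in> borel_measurable \<pi>"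
  for g :: "real \<Rightarrow> real"
  by (intro borel_measurable_pi measurable_compose[of fst borel borel g]) (simp_all add: borel_prod[symmetric])

text \<open>\<open>small_time_lower\<close> is integrated against \<open>\<pi>\<close>, and by
  invariance the two integrals of \<open>f\<close> cancel. After division by \<open>t\<close> the
  Taylor remainder, with its uncontrolled constant \<open>L\<close>, is of order
  \<open>sqrt t\<close> and the loss in the quadratic variation of order \<open>t\<close>, so both
  vanish as \<open>t\<close> tends to zero. All remaining terms are multiples of
  \<open>m\<close>.\<close>

lemma test_integral_le:
  assumes R: "0 < R" and s: "0 < s\<^sub>0" "\<And>y. \<bar>y\<bar> \<le> R + 1 \<Longrightarrow> s\<^sub>0 \<le> (\<sigma> y)\<^sup>2"
    and h: "\<And>x. 0 \<le> h x" "\<And>x. h x \<le> 1" "\<And>x. R \<le> \<bar>x\<bar> \<Longrightarrow> h x = 0" "\<And>x y. \<bar>h x - h y\<bar> \<le> Lh * \<bar>x - y\<bar>"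
  shows "(\<integral>z. h (fst z) \<partial>\<pi>) \<le> bound R s\<^sub>0 * integral {- R - 3..R + 2} h"
proof -
  define m where "m = integral {- R - 3..R + 2} h"
  obtain f f1 L where f: "continuous_on UNIV f" "\<And>x. \<bar>f x\<bar> \<le> m * (2 * R + 5)" "\<And>x y. \<bar>f x - f y\<bar> \<le> m * \<bar>x - y\<bar>"
    "\<And>x y. \<bar>f (x + y) - f x - f1 x * y - (h x - m / tent_mass R * tent R x) / 2 * y\<^sup>2\<bar> \<le> L * \<bar>y\<bar> ^ 3"
    "0 \<le> L" "\<And>y. R + 2 \<le> y \<Longrightarrow> f y = f (R + 2)" "\<And>y. y \<le> - (R + 2) \<Longrightarrow> f y = f (- (R + 2))"
    by (rule test_function[OF R h(1) _ h(4), folded m_def], erule h(3), rule that; assumption)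
  have m0: "0 \<le> m" using f(3)[of 0 1] by simp
  have h_lip: "Lh-lipschitz_on UNIV h"
    using h(4) h(4)[of 0 1] by (intro lipschitz_onI) (auto simp: dist_real_def)
  have hm: "h \<in> borel_measurable borel"
    by (rule borel_measurable_continuous_onI[OF lipschitz_on_continuous_on[OF h_lip]])
  have fm: "f \<in> borel_measurable borel" by (rule borel_measurable_continuous_onI[OF f(1)])
  define kk where "kk = (\<Sum>j\<in>UNIV. 1 / \<kappa> $ j)"
  define D where "D = 2 * K * (1 + R) + 4 * s\<^sub>1\<^sup>2"
  define E where "E = 6 * K + 36 * s\<^sub>1\<^sup>2"
  define Fb where "Fb = m * (2 * R + 5)"
  have kk: "0 \<le> kk" unfolding kk_def using parameters(7) by (intro sum_nonneg) (auto simp: less_imp_le)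
  have K0: "0 < K" unfolding K_def using parameters by simp
  have D0: "0 \<le> D" unfolding D_def using K0 R by simp
  have ih: "integrable \<pi> (\<lambda>z. h (fst z))"
    by (rule pi.integrable_const_bound[where B=1]) (use h(1,2) fst_measurable[OF hm] in auto)
  have iF: "integrable \<pi> (\<lambda>z. f (fst z))"
    by (rule pi.integrable_const_bound[where B=Fb]) (use f(2) fst_measurable[OF fm] in \<open>auto simp: Fb_def\<close>)
  have JE: "(\<integral>z. kk * (v z + C) \<partial>\<pi>) = J" unfolding J_def kk_def using v_mean by (simp add: pi.prob_space)
  define c1 where "c1 = (s\<^sub>1\<^sup>2 + 3 * s\<^sub>1 ^ 4) / 2"
  define A where "A t = m / tent_mass R / 2 * (s\<^sub>1\<^sup>2 * t) + L * (c1 * (t * sqrt t)) + m * (K * t * (3 + 2 * (R + 2)))" for t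
  have main: "s\<^sub>0 / 4 * (\<integral>z. h (fst z) \<partial>\<pi>) \<le> s\<^sub>0 / 4 * t * (D + J) + (m / tent_mass R / 2 * s\<^sub>1\<^sup>2 + L * c1 * sqrt t
      + m * (K * (3 + 2 * (R + 2)))) + 2 * Fb * (E + J)"
    if t: "0 < t" "t \<le> 1" "Kb * t \<le> 1 / 2" for t
  proof -
    have pt: "f (fst z) + s\<^sub>0 * t / 4 * (h (fst z) - t * (D + kk * (v z + C))) - A t - 2 * Fb * (t * (E + kk * (v z + C)))
        \<le> (\<integral>\<omega>. f (X t \<omega>) \<partial>Pr z)" if z: "z \<in> space state_space" for z
    proof -
      interpret Z: hawkes_small_time \<alpha> \<zeta> c b \<sigma> a "Pr z" F N W X lam z \<kappa> r Kb s\<^sub>1 by (rule start[OF z])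
      have J: "Z.J = kk * (v z + C)" unfolding Z.J_def kk_def Z.v_def Z.C_def v_def C_def ..
      have KK: "Z.K = K" unfolding Z.K_def K_def ..
      have x0: "Z.x0 = fst z" unfolding Z.x0_def ..
      have J0: "0 \<le> kk * (v z + C)" using Z.J_nonneg J by simp
      have c0: "0 < tent_mass R" by (rule tent_mass_pos[OF R])
      have "f (fst z) + h (fst z) / 4 * (s\<^sub>0 * t * (1 - t * (2 * K * (1 + R) + 4 * s\<^sub>1\<^sup>2 + kk * (v z + C)))) - m / tent_mass R / 2 * (s\<^sub>1\<^sup>2 * t)
        - L * ((s\<^sub>1\<^sup>2 + 3 * s\<^sub>1 ^ 4) / 2 * (t * sqrt t)) - m * (K * t * (3 + 2 * (R + 2)))
        - 2 * (m * (2 * R + 5)) * (t * (6 * K + 36 * s\<^sub>1\<^sup>2 + kk * (v z + C))) \<le> (\<integral>\<omega>. f (X t \<omega>) \<partial>Pr z)"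
      proof (rule Z.small_time_lower[where R=R and R'="R + 2" and w="\<lambda>x. m / tent_mass R * tent R x" and h=h and f=f and ?f1.0=f1,
            OF t f(1,2,3,4) h(1), unfolded J KK x0])
        show "h x = 0" if "R < \<bar>x\<bar>" for x using that by (intro h(3)) auto
        show "0 \<le> m / tent_mass R * tent R x" for x using m0 c0 by (auto simp: tent_def)
        show "m / tent_mass R * tent R x \<le> m / tent_mass R" for x
          using m0 c0 by (intro mult_left_le) (auto simp: tent_def)
        show "f y = f (R + 2)" if "R + 2 \<le> y" for y by (rule f(6)[OF that])
        show "f y = f (- (R + 2))" if "y \<le> - (R + 2)" for y by (rule f(7)[OF that])
        show "s\<^sub>0 \<le> (\<sigma> y)\<^sup>2" if "\<bar>y\<bar> \<le> R + 1" for y by (rule s(2)[OF that])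
        show "0 \<le> L" by (rule f(5))
      qed (use R s(1) in simp_all)
      moreover have "s\<^sub>0 * t / 4 * (h (fst z) - t * (D + kk * (v z + C)))
          \<le> h (fst z) / 4 * (s\<^sub>0 * t * (1 - t * (2 * K * (1 + R) + 4 * s\<^sub>1\<^sup>2 + kk * (v z + C))))"
      proof -
        \<comment> \<open>As \<open>h \<le> 1\<close>, the correction can be detached from the
          factor \<open>h (fst z)\<close>; what is left is affine in \<open>v\<close>, and its
          integral is expressed through \<open>J\<close>.\<close>
        have "h (fst z) * (t * (D + kk * (v z + C))) \<le> 1 * (t * (D + kk * (v z + C)))"
          using h(2) t D0 J0 by (intro mult_right_mono) auto
        then have "h (fst z) - t * (D + kk * (v z + C)) \<le> h (fst z) * (1 - t * (D + kk * (v z + C)))"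
          by (simp add: right_diff_distrib)
        then have "s\<^sub>0 * t / 4 * (h (fst z) - t * (D + kk * (v z + C))) \<le> s\<^sub>0 * t / 4 * (h (fst z) * (1 - t * (D + kk * (v z + C))))"
          using s t by (intro mult_left_mono) auto
        also have "\<dots> = h (fst z) / 4 * (s\<^sub>0 * t * (1 - t * (2 * K * (1 + R) + 4 * s\<^sub>1\<^sup>2 + kk * (v z + C))))"
          unfolding D_def by simp
        finally show ?thesis .
      qed
      ultimately show ?thesis unfolding A_def Fb_def E_def c1_def by linarith
    qed
    let ?g = "\<lambda>z. f (fst z) + s\<^sub>0 * t / 4 * (h (fst z) - t * (D + kk * (v z + C))) - A t - 2 * Fb * (t * (E + kk * (v z + C)))"
    have ik: "integrable \<pi> (\<lambda>z. kk * (v z + C))" using v_mean by simp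
    have i1: "integrable \<pi> (\<lambda>z. D + kk * (v z + C))" "integrable \<pi> (\<lambda>z. E + kk * (v z + C))"
      by (rule Bochner_Integration.integrable_add[OF pi.integrable_const ik])+
    have e1: "(\<integral>z. D + kk * (v z + C) \<partial>\<pi>) = D + J" "(\<integral>z. E + kk * (v z + C) \<partial>\<pi>) = E + J"
      unfolding Bochner_Integration.integral_add[OF pi.integrable_const ik] JE by (simp_all add: pi.prob_space)
    have i2: "integrable \<pi> (\<lambda>z. h (fst z) - t * (D + kk * (v z + C)))"
      by (intro Bochner_Integration.integrable_diff ih integrable_mult_right i1)
    have e2: "(\<integral>z. h (fst z) - t * (D + kk * (v z + C)) \<partial>\<pi>) = (\<integral>z. h (fst z) \<partial>\<pi>) - t * (D + J)"
      by (subst Bochner_Integration.integral_diff[OF ih integrable_mult_right[OF i1(1)]]) (simp only: integral_mult_right_zero e1)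
    note i3 = integrable_mult_right[OF i2, of "s\<^sub>0 * t / 4"]
    note i4 = Bochner_Integration.integrable_add[OF iF i3]
    note i5 = Bochner_Integration.integrable_diff[OF i4 pi.integrable_const[of "A t"]]
    note i6 = integrable_mult_right[OF integrable_mult_right[OF i1(2), of t], of "2 * Fb"]
    note ig = Bochner_Integration.integrable_diff[OF i5 i6]
    note inv = invariant_expectation[OF less_imp_le[OF t(1)] fm f(2)]
    have "(\<integral>z. ?g z \<partial>\<pi>) \<le> (\<integral>z. (\<integral>\<omega>. f (X t \<omega>) \<partial>Pr z) \<partial>\<pi>)"
      by (rule integral_mono[OF ig inv(1)]) (rule pt, simp only: space_pi)
    then have le: "(\<integral>z. ?g z \<partial>\<pi>) \<le> (\<integral>z. f (fst z) \<partial>\<pi>)" using inv(2) by simp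
    have "(\<integral>z. ?g z \<partial>\<pi>) = (\<integral>z. f (fst z) \<partial>\<pi>) + s\<^sub>0 * t / 4 * ((\<integral>z. h (fst z) \<partial>\<pi>) - t * (D + J)) - A t - 2 * Fb * (t * (E + J))"
      unfolding Bochner_Integration.integral_diff[OF i5 i6] Bochner_Integration.integral_diff[OF i4 pi.integrable_const]
        Bochner_Integration.integral_add[OF iF i3] integral_mult_right_zero e1 e2
      by (simp add: pi.prob_space)
    with le have "s\<^sub>0 * t / 4 * ((\<integral>z. h (fst z) \<partial>\<pi>) - t * (D + J)) \<le> A t + 2 * Fb * (t * (E + J))" by linarith
    moreover have "s\<^sub>0 * t / 4 * ((\<integral>z. h (fst z) \<partial>\<pi>) - t * (D + J)) = t * (s\<^sub>0 / 4 * (\<integral>z. h (fst z) \<partial>\<pi>) - s\<^sub>0 / 4 * t * (D + J))"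
      by (simp add: algebra_simps)
    moreover have "A t + 2 * Fb * (t * (E + J)) = t * ((m / tent_mass R / 2 * s\<^sub>1\<^sup>2 + L * c1 * sqrt t
      + m * (K * (3 + 2 * (R + 2)))) + 2 * Fb * (E + J))"
      unfolding A_def by (simp add: algebra_simps)
    ultimately have "t * (s\<^sub>0 / 4 * (\<integral>z. h (fst z) \<partial>\<pi>) - s\<^sub>0 / 4 * t * (D + J)) \<le> t * ((m / tent_mass R / 2 * s\<^sub>1\<^sup>2 + L * c1 * sqrt t
      + m * (K * (3 + 2 * (R + 2)))) + 2 * Fb * (E + J))" by (simp only:)
    then have "s\<^sub>0 / 4 * (\<integral>z. h (fst z) \<partial>\<pi>) - s\<^sub>0 / 4 * t * (D + J) \<le> (m / tent_mass R / 2 * s\<^sub>1\<^sup>2 + L * c1 * sqrt t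
      + m * (K * (3 + 2 * (R + 2)))) + 2 * Fb * (E + J)" using t(1) by (rule mult_left_le_imp_le)
    then show ?thesis by linarith
  qed
  have "s\<^sub>0 / 4 * (\<integral>z. h (fst z) \<partial>\<pi>) \<le> s\<^sub>0 / 4 * 0 * (D + J) + (m / tent_mass R / 2 * s\<^sub>1\<^sup>2 + L * c1 * sqrt 0
      + m * (K * (3 + 2 * (R + 2)))) + 2 * Fb * (E + J)"
  proof (rule tendsto_lowerbound)
    show "((\<lambda>t. s\<^sub>0 / 4 * t * (D + J) + (m / tent_mass R / 2 * s\<^sub>1\<^sup>2 + L * c1 * sqrt t
      + m * (K * (3 + 2 * (R + 2)))) + 2 * Fb * (E + J)) \<longlongrightarrow> s\<^sub>0 / 4 * 0 * (D + J) + (m / tent_mass R / 2 * s\<^sub>1\<^sup>2 + L * c1 * sqrt 0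
      + m * (K * (3 + 2 * (R + 2)))) + 2 * Fb * (E + J)) (at_right 0)"
      by (intro tendsto_intros)
    have "0 < min 1 (1 / (2 * Kb))" using parameters by simp
    then have "\<forall>\<^sub>F t in at_right 0. t \<in> {0<..<min 1 (1 / (2 * Kb))}" by (rule eventually_at_right_real)
    then show "\<forall>\<^sub>F t in at_right 0. s\<^sub>0 / 4 * (\<integral>z. h (fst z) \<partial>\<pi>) \<le> s\<^sub>0 / 4 * t * (D + J) + (m / tent_mass R / 2 * s\<^sub>1\<^sup>2 + L * c1 * sqrt t
      + m * (K * (3 + 2 * (R + 2)))) + 2 * Fb * (E + J)"
    proof eventually_elim
      case (elim t)
      then have "Kb * t \<le> 1 / 2" using parameters(5) by (simp add: field_simps)
      with elim show ?case by (intro main) auto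
    qed
  qed simp
  also have "\<dots> = s\<^sub>0 / 4 * (bound R s\<^sub>0 * m)"
    unfolding bound_def Fb_def E_def using s(1) by (simp add: field_simps)
  finally show ?thesis using s(1) unfolding m_def by simp
qed

lemma bound_pos:
  assumes "0 < R" "0 < s\<^sub>0" shows "0 < bound R s\<^sub>0"
proof -
  have K0: "0 < K" unfolding K_def using parameters by simp
  have "0 \<le> (\<integral>z. v z \<partial>\<pi>)" using v_nonneg by (intro Bochner_Integration.integral_nonneg) (auto simp: space_pi)
  then have "0 \<le> J" unfolding J_def using parameters(4,7)
    by (intro mult_nonneg_nonneg sum_nonneg add_nonneg_nonneg) (auto simp: less_imp_le)
  then show ?thesis unfolding bound_def using assms K0 tent_mass_pos[OF assms(1)] parameters(6)
    by (intro mult_pos_pos add_pos_nonneg) auto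
qed

section \<open>From test functions to open sets, Borel sets and the density\<close>

text \<open>The functions \<open>min 1 (n * infdist x (- U))\<close> increase to the indicator of
  \<open>U\<close>. Their Lipschitz constants \<open>n\<close> are unbounded, which is harmless
  since \<open>bound\<close> does not involve them.\<close>

lemma open_set_le:
  assumes R: "0 < R" and s: "0 < s\<^sub>0" "\<And>y. \<bar>y\<bar> \<le> R + 1 \<Longrightarrow> s\<^sub>0 \<le> (\<sigma> y)\<^sup>2"
    and U: "open U" "U \<subseteq> {- R<..<R}"
  shows "emeasure \<pi> (fst -` U \<inter> space \<pi>) \<le> ennreal (bound R s\<^sub>0) * emeasure lborel U"
proof -
  define h where "h n x = min 1 (real n * infdist x (- U))" for n :: nat and x :: real
  have ne: "- U \<noteq> {}" using U(2) R by (auto intro!: exI[of _ R])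
  have cl: "closed (- U)" using U(1) by (rule closed_Compl)
  have h0: "0 \<le> h n x" "h n x \<le> 1" for n x by (auto simp: h_def infdist_nonneg)
  have hz: "h n x = 0" if "x \<notin> U" for n x using that by (simp add: h_def)
  have h_lip: "\<bar>h n x - h n y\<bar> \<le> real n * \<bar>x - y\<bar>" for n x y
  proof -
    have "\<bar>h n x - h n y\<bar> \<le> \<bar>real n * infdist x (- U) - real n * infdist y (- U)\<bar>" by (simp add: h_def)
    also have "\<dots> = real n * \<bar>infdist x (- U) - infdist y (- U)\<bar>" by (simp add: right_diff_distrib[symmetric] abs_mult)
    also have "\<dots> \<le> real n * \<bar>x - y\<bar>"
      using infdist_triangle_abs[of x "- U" y] by (intro mult_left_mono) (auto simp: dist_real_def)
    finally show ?thesis .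
  qed
  have h_cont: "continuous_on S (h n)" for S n
    unfolding h_def by (intro continuous_intros)
  have hm: "h n \<in> borel_measurable borel" for n by (rule borel_measurable_continuous_onI[OF h_cont])
  have mass: "ennreal (integral {- R - 3..R + 2} (h n)) \<le> emeasure lborel U" for n
  proof -
    have i: "set_integrable lborel {- R - 3..R + 2} (h n)" by (rule borel_integrable_atLeastAtMost'[OF h_cont])
    have "ennreal (integral {- R - 3..R + 2} (h n)) = ennreal (LBINT x:{- R - 3..R + 2}. h n x)"
      using set_borel_integral_eq_integral(2)[OF i] by simp
    also have "\<dots> = (\<integral>\<^sup>+x. ennreal (indicator {- R - 3..R + 2} x *\<^sub>R h n x) \<partial>lborel)"
      using i h0(1) unfolding set_lebesgue_integral_def set_integrable_def
      by (intro nn_integral_eq_integral[symmetric]) (auto simp: indicator_def)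
    also have "\<dots> \<le> (\<integral>\<^sup>+x. indicator U x \<partial>lborel)"
    proof (rule nn_integral_mono)
      fix x
      show "ennreal (indicator {- R - 3..R + 2} x *\<^sub>R h n x) \<le> indicator U x"
        using h0(2)[of n x] hz[of x n] by (auto simp: indicator_def ennreal_le_1)
    qed
    also have "\<dots> = emeasure lborel U" using U(1) by simp
    finally show ?thesis .
  qed
  have le: "(\<integral>\<^sup>+z. ennreal (h n (fst z)) \<partial>\<pi>) \<le> ennreal (bound R s\<^sub>0) * emeasure lborel U" for n
  proof -
    have i: "integrable \<pi> (\<lambda>z. h n (fst z))"
      by (rule pi.integrable_const_bound[where B=1]) (use h0 fst_measurable[OF hm] in auto)
    have "(\<integral>z. h n (fst z) \<partial>\<pi>) \<le> bound R s\<^sub>0 * integral {- R - 3..R + 2} (h n)"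
    proof (rule test_integral_le[OF R s h0 _ h_lip])
      show "h n x = 0" if "R \<le> \<bar>x\<bar>" for x using that subsetD[OF U(2), of x] by (intro hz) auto
    qed
    then have "ennreal (\<integral>z. h n (fst z) \<partial>\<pi>) \<le> ennreal (bound R s\<^sub>0) * ennreal (integral {- R - 3..R + 2} (h n))"
      using bound_pos[OF R s(1)] by (subst ennreal_mult'[symmetric]) (auto intro: ennreal_leI)
    also have "\<dots> \<le> ennreal (bound R s\<^sub>0) * emeasure lborel U" by (intro mult_left_mono mass) simp
    finally show ?thesis using h0(1) by (subst nn_integral_eq_integral[OF i]) auto
  qed
  have "emeasure \<pi> (fst -` U \<inter> space \<pi>) = (\<integral>\<^sup>+z. indicator U (fst z) \<partial>\<pi>)"
  proof -
    have "fst -` U \<inter> space \<pi> \<in> sets \<pi>"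
      using borel_measurable_pi[of fst] U(1) by (auto simp: borel_prod[symmetric] intro!: measurable_sets[of fst \<pi> borel])
    then have "emeasure \<pi> (fst -` U \<inter> space \<pi>) = (\<integral>\<^sup>+z. indicator (fst -` U \<inter> space \<pi>) z \<partial>\<pi>)" by simp
    also have "\<dots> = (\<integral>\<^sup>+z. indicator U (fst z) \<partial>\<pi>)" by (rule nn_integral_cong) (auto simp: indicator_def)
    finally show ?thesis .
  qed
  also have "\<dots> = (\<integral>\<^sup>+z. liminf (\<lambda>n. ennreal (h n (fst z))) \<partial>\<pi>)"
  proof (rule nn_integral_cong)
    fix z :: "real \<times> (real^'m)"
    have "\<forall>\<^sub>F n in sequentially. ennreal (h n (fst z)) = indicator U (fst z)"
    proof (cases "fst z \<in> U")
      case True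
      then have d: "0 < infdist (fst z) (- U)"
        using in_closed_iff_infdist_zero[OF cl ne, of "fst z"] infdist_nonneg[of "fst z" "- U"] by auto
      show ?thesis
        using eventually_ge_at_top[of "nat \<lceil>1 / infdist (fst z) (- U)\<rceil>"]
      proof eventually_elim
        case (elim n)
        then have "1 / infdist (fst z) (- U) \<le> real n" by linarith
        then have "1 \<le> real n * infdist (fst z) (- U)" using d by (simp add: field_simps)
        then show ?case using True by (simp add: h_def)
      qed
    qed (simp add: hz)
    then show "indicator U (fst z) = liminf (\<lambda>n. ennreal (h n (fst z)))"
      by (intro lim_imp_Liminf[OF _ tendsto_eventually, symmetric]) simp_all
  qed
  also have "\<dots> \<le> liminf (\<lambda>n. \<integral>\<^sup>+z. ennreal (h n (fst z)) \<partial>\<pi>)"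
    using fst_measurable[OF hm] by (intro nn_integral_liminf) simp
  also have "\<dots> \<le> ennreal (bound R s\<^sub>0) * emeasure lborel U"
    by (rule Liminf_le) (simp_all add: le)
  finally show ?thesis .
qed

text \<open>Outer regularity of Lebesgue measure. The open superset is cut down to
  \<open>{- R<..<R}\<close> to stay within the range of \<open>open_set_le\<close>, and the excess
  measure \<open>e / ?b\<close> is scaled to contribute \<open>e\<close>.\<close>

lemma borel_set_le:
  assumes R: "0 < R" and s: "0 < s\<^sub>0" "\<And>y. \<bar>y\<bar> \<le> R + 1 \<Longrightarrow> s\<^sub>0 \<le> (\<sigma> y)\<^sup>2"
    and A: "A \<in> sets borel" "A \<subseteq> {- R<..<R}"
  shows "emeasure \<pi> (fst -` A \<inter> space \<pi>) \<le> ennreal (bound R s\<^sub>0) * emeasure lborel A"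
proof (rule ennreal_le_epsilon)
  fix e :: real assume e: "0 < e"
  let ?b = "bound R s\<^sub>0"
  have b: "0 < ?b" by (rule bound_pos[OF R s(1)])
  obtain U where U: "open U" "A \<subseteq> U" "emeasure lborel (U - A) < ennreal (e / ?b)"
    using outer_regular_lborel[OF A(1), of "e / ?b"] e b by auto
  define G where "G = U \<inter> {- R<..<R}"
  have G: "open G" "G \<subseteq> {- R<..<R}" "A \<subseteq> G" using U A by (auto simp: G_def)
  have "fst -` G \<inter> space \<pi> \<in> sets \<pi>"
    using borel_measurable_pi[of fst] G(1) by (auto simp: borel_prod[symmetric] intro!: measurable_sets[of fst \<pi> borel])
  then have "emeasure \<pi> (fst -` A \<inter> space \<pi>) \<le> emeasure \<pi> (fst -` G \<inter> space \<pi>)"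
    using G(3) by (intro emeasure_mono) auto
  also have "\<dots> \<le> ennreal ?b * emeasure lborel G" by (rule open_set_le[OF R s G(1,2)])
  also have "\<dots> \<le> ennreal ?b * (emeasure lborel A + emeasure lborel (U - A))"
  proof (rule mult_left_mono)
    have "emeasure lborel G \<le> emeasure lborel (A \<union> (U - A))"
      using U(1) A(1) by (intro emeasure_mono) (auto simp: G_def)
    also have "\<dots> \<le> emeasure lborel A + emeasure lborel (U - A)"
      using U(1) A(1) by (intro emeasure_subadditive) auto
    finally show "emeasure lborel G \<le> emeasure lborel A + emeasure lborel (U - A)" .
  qed simp
  also have "\<dots> \<le> ennreal ?b * (emeasure lborel A + ennreal (e / ?b))"
    using U(3) by (intro mult_left_mono add_left_mono) auto
  also have "\<dots> = ennreal ?b * emeasure lborel A + ennreal e"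
    using b e by (simp add: distrib_left ennreal_mult[symmetric])
  finally show "emeasure \<pi> (fst -` A \<inter> space \<pi>) \<le> ennreal ?b * emeasure lborel A + ennreal e" .
qed

text \<open>On the set \<open>A\<close> where \<open>p\<close> exceeds the bound, the excess has
  integral zero by \<open>borel_set_le\<close>. Boundedness of \<open>A\<close> makes its measure
  finite, which allows the cancellation.\<close>

lemma density_le:
  assumes R: "0 < R" and s: "0 < s\<^sub>0" "\<And>y. \<bar>y\<bar> \<le> R + 1 \<Longrightarrow> s\<^sub>0 \<le> (\<sigma> y)\<^sup>2"
    and p: "\<And>x. 0 \<le> p x" "distributed \<pi> lborel fst (\<lambda>x. ennreal (p x))"
  shows "AE x in lborel. \<bar>x\<bar> < R \<longrightarrow> p x \<le> bound R s\<^sub>0"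
proof -
  let ?b = "bound R s\<^sub>0"
  have b: "0 < ?b" by (rule bound_pos[OF R s(1)])
  have pm: "p \<in> borel_measurable borel"
    using distributed_real_measurable[OF p(1,2)] by simp
  define A where "A = {x. \<bar>x\<bar> < R \<and> ?b < p x}"
  have A: "A \<in> sets borel" unfolding A_def using pm by measurable
  have AR: "A \<subseteq> {- R<..<R}" by (auto simp: A_def)
  have "emeasure lborel A \<le> emeasure lborel {- R<..<R}" using AR by (intro emeasure_mono) auto
  also have "\<dots> < top" using R by simp
  finally have fin: "emeasure lborel A < top" .
  have i1: "(\<integral>\<^sup>+x. ennreal ?b * indicator A x \<partial>lborel) = ennreal ?b * emeasure lborel A"
    using A by (intro nn_integral_cmult_indicator) simp
  have "(\<integral>\<^sup>+x. ennreal ?b * indicator A x \<partial>lborel) + (\<integral>\<^sup>+x. ennreal (p x - ?b) * indicator A x \<partial>lborel)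
      = (\<integral>\<^sup>+x. ennreal ?b * indicator A x + ennreal (p x - ?b) * indicator A x \<partial>lborel)"
    using A pm by (intro nn_integral_add[symmetric]) auto
  also have "\<dots> = (\<integral>\<^sup>+x. ennreal (p x) * indicator A x \<partial>lborel)"
    using b by (intro nn_integral_cong) (auto simp: A_def indicator_def ennreal_plus[symmetric] simp del: ennreal_plus)
  also have "\<dots> = emeasure \<pi> (fst -` A \<inter> space \<pi>)"
    using distributed_emeasure[OF p(2), of A] A by simp
  also have "\<dots> \<le> ennreal ?b * emeasure lborel A" by (rule borel_set_le[OF R s A AR])
  finally have "ennreal ?b * emeasure lborel A + (\<integral>\<^sup>+x. ennreal (p x - ?b) * indicator A x \<partial>lborel)
      \<le> ennreal ?b * emeasure lborel A + 0" unfolding i1 by simp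
  moreover have "ennreal ?b * emeasure lborel A \<noteq> top" using fin by (simp add: ennreal_mult_eq_top_iff)
  ultimately have "(\<integral>\<^sup>+x. ennreal (p x - ?b) * indicator A x \<partial>lborel) = 0"
    unfolding ennreal_add_left_cancel_le by simp
  then have "AE x in lborel. ennreal (p x - ?b) * indicator A x = 0"
    using A pm by (subst (asm) nn_integral_0_iff_AE) auto
  then show ?thesis
  proof eventually_elim
    case (elim x)
    show ?case
    proof (intro impI, rule ccontr)
      assume "\<bar>x\<bar> < R" "\<not> p x \<le> ?b"
      then have "x \<in> A" "0 < p x - ?b" by (auto simp: A_def)
      then show False using elim by simp
    qed
  qed
qed

text \<open>A density is determined up to null sets, so a pointwise bound can be claimed for a
  suitable version. The exceptional sets of countably many radii are collected, and \<open>q\<close>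
  is set to zero on their union.\<close>

lemma locally_bounded_density:
  assumes \<sigma>: "continuous_on UNIV \<sigma>" "\<And>x. 0 < (\<sigma> x)\<^sup>2"
    and p: "\<And>x. 0 \<le> p x" "distributed \<pi> lborel fst (\<lambda>x. ennreal (p x))"
  shows "\<exists>q. (AE x in lborel. q x = p x)
           \<and> (\<forall>x. q x \<ge> 0) \<and> distributed \<pi> lborel fst (\<lambda>x. ennreal (q x))
           \<and> (\<forall>K. compact K \<longrightarrow> (\<exists>C\<^sub>K>0. \<forall>x\<in>K. q x \<le> C\<^sub>K))"
proof -
  \<comment> \<open>\<open>density_le\<close> with radius \<open>R = n + 1\<close> asks for a lower
    bound of \<open>\<sigma>\<^sup>2\<close> up to \<open>R + 1 = n + 2\<close>; continuity and
    positivity on a compact interval provide it.\<close>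
  have "\<exists>s>0. \<forall>y. \<bar>y\<bar> \<le> real n + 2 \<longrightarrow> s \<le> (\<sigma> y)\<^sup>2" for n :: nat
  proof -
    have "continuous_on {- (real n + 2)..real n + 2} (\<lambda>y. (\<sigma> y)\<^sup>2)"
      by (intro continuous_intros continuous_on_subset[OF \<sigma>(1)]) auto
    then obtain y where "\<forall>x\<in>{- (real n + 2)..real n + 2}. (\<sigma> y)\<^sup>2 \<le> (\<sigma> x)\<^sup>2"
      using continuous_attains_inf[of "{- (real n + 2)..real n + 2}" "\<lambda>y. (\<sigma> y)\<^sup>2"] by auto
    then have "(\<sigma> y)\<^sup>2 \<le> (\<sigma> x)\<^sup>2" if "\<bar>x\<bar> \<le> real n + 2" for x
      using that by (simp add: abs_le_iff)
    then show ?thesis using \<sigma>(2)[of y] by blast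
  qed
  then obtain s where s: "\<And>n :: nat. 0 < s n" "\<And>n y. \<bar>y\<bar> \<le> real n + 2 \<Longrightarrow> s n \<le> (\<sigma> y)\<^sup>2" by metis
  define B where "B n = bound (real n + 1) (s n)" for n
  define good where "good x \<longleftrightarrow> (\<forall>n. \<bar>x\<bar> < real n + 1 \<longrightarrow> p x \<le> B n)" for x
  define q where "q x = (if good x then p x else 0)" for x
  have pm: "p \<in> borel_measurable borel"
    using distributed_real_measurable[OF p(1,2)] by simp
  have "AE x in lborel. \<bar>x\<bar> < real n + 1 \<longrightarrow> p x \<le> B n" for n
    unfolding B_def by (rule density_le[OF _ s(1) _ p]) (auto intro: s(2))
  then have "AE x in lborel. good x" unfolding good_def by (simp add: AE_all_countable)
  then have ae: "AE x in lborel. q x = p x" by eventually_elim (simp add: q_def)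
  have qm: "q \<in> borel_measurable borel" unfolding q_def good_def using pm by measurable
  have q0: "0 \<le> q x" for x using p(1) by (simp add: q_def)
  have "distributed \<pi> lborel fst (\<lambda>x. ennreal (q x))"
  proof (subst distributed_cong_density)
    show "AE x in lborel. ennreal (q x) = ennreal (p x)" using ae by eventually_elim simp
  qed (use pm qm p(2) in auto)
  moreover have "\<exists>M>0. \<forall>x\<in>S. q x \<le> M" if S: "compact S" for S
  proof -
    obtain M where M: "\<And>x. x \<in> S \<Longrightarrow> \<bar>x\<bar> \<le> M" using compact_imp_bounded[OF S] by (auto simp: bounded_iff)
    define n where "n = nat \<lceil>M\<rceil>"
    have "q x \<le> \<bar>B n\<bar> + 1" if "x \<in> S" for x
    proof -
      have "\<bar>x\<bar> < real n + 1" using M[OF that] unfolding n_def by linarith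
      then show ?thesis unfolding q_def good_def by (auto intro: order_trans[of _ "B n"])
    qed
    then show ?thesis by (intro exI[of _ "\<bar>B n\<bar> + 1"]) auto
  qed
  ultimately show ?thesis using ae q0 by blast
qed

end

section \<open>From the model assumptions to the locale parameters\<close>

lemma C2_continuous: "C2 f \<Longrightarrow> continuous_on UNIV f"
  unfolding C2_def by (metis continuous_at_imp_continuous_on field_differentiable_imp_continuous_at)

lemma bounded_derivative_linear_growth:
  fixes f :: "real \<Rightarrow> real"
  assumes f: "\<And>x. f field_differentiable at x" "\<And>x. \<bar>deriv f x\<bar> \<le> k"
  shows "\<bar>f x\<bar> \<le> (\<bar>f 0\<bar> + k) * (1 + \<bar>x\<bar>)"
proof -
  have "norm (f x - f 0) \<le> k * norm (x - 0)"
  proof (rule field_differentiable_bound[of UNIV f "deriv f"])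
    show "(f has_field_derivative deriv f y) (at y within UNIV)" for y
      using f(1)[of y] by (simp add: DERIV_deriv_iff_field_differentiable)
  qed (use f(2) in auto)
  moreover have "0 \<le> k" using f(2)[of 0] by linarith
  moreover have "0 \<le> \<bar>f 0\<bar> * \<bar>x\<bar>" by simp
  moreover have "(\<bar>f 0\<bar> + k) * (1 + \<bar>x\<bar>) = \<bar>f 0\<bar> + k + \<bar>f 0\<bar> * \<bar>x\<bar> + k * \<bar>x\<bar>" by (simp add: algebra_simps)
  ultimately show ?thesis unfolding real_norm_def diff_zero by linarith
qed

theorem lemma2p2:
  fixes \<alpha> :: real and \<zeta> :: "real^'m" and c :: "real^'m^'m"
    and b \<sigma> a :: "real \<Rightarrow> real"
    and Pr :: "real \<times> (real^'m) \<Rightarrow> 'w measure" and F :: "real \<Rightarrow> 'w measure"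
    and N :: "'m \<Rightarrow> real \<Rightarrow> 'w \<Rightarrow> nat" and W X :: "real \<Rightarrow> 'w \<Rightarrow> real"
    and lam :: "real \<Rightarrow> 'w \<Rightarrow> real^'m"
    and \<pi> :: "(real \<times> (real^'m)) measure" and p :: "real \<Rightarrow> real"
  assumes "\<alpha> > 0" and "\<And>i. \<zeta> $ i > 0" and "\<And>i j. c $ i $ j > 0"
    and "coefficient_conditions b \<sigma> a"
    and "stability_conditions \<alpha> \<zeta> c"
    and "hawkes_family \<alpha> \<zeta> c b \<sigma> a Pr F N W X lam"
    and "\<And>t. t \<ge> 0 \<Longrightarrow> transition Pr X lam t \<in> state_space \<rightarrow>\<^sub>M prob_algebra state_space"
    and "invariant_probability state_space (transition Pr X lam) \<pi>"
    and "\<And>x. p x \<ge> 0" and "distributed \<pi> lborel fst (\<lambda>x. ennreal (p x))"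
  shows "\<exists>q. (AE x in lborel. q x = p x)
           \<and> (\<forall>x. q x \<ge> 0) \<and> distributed \<pi> lborel fst (\<lambda>x. ennreal (q x))
           \<and> (\<forall>K. compact K \<longrightarrow> (\<exists>C\<^sub>K>0. \<forall>x\<in>K. q x \<le> C\<^sub>K))"
proof -
  note coeff = \<open>coefficient_conditions b \<sigma> a\<close>[unfolded coefficient_conditions_def]
  have b: "C2 b" and \<sigma>: "C2 \<sigma>" using coeff by blast+
  obtain k where k: "0 < k" "\<And>x. \<bar>deriv b x\<bar> + \<bar>deriv \<sigma> x\<bar> + \<bar>deriv a x\<bar> \<le> k" using coeff by blast
  obtain s where s: "0 < s" "\<And>x. 0 < (\<sigma> x)\<^sup>2" "\<And>x. (\<sigma> x)\<^sup>2 < s\<^sup>2" using coeff by blast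
  have b_lin: "\<bar>b x\<bar> \<le> (\<bar>b 0\<bar> + k) * (1 + \<bar>x\<bar>)" for x
  proof (rule bounded_derivative_linear_growth)
    show "b field_differentiable at x" for x using b unfolding C2_def by blast
    show "\<bar>deriv b x\<bar> \<le> k" for x using k(2)[of x] by linarith
  qed
  have \<sigma>_b: "\<bar>\<sigma> x\<bar> \<le> s" for x
    using power_less_imp_less_base[of "\<bar>\<sigma> x\<bar>" 2 s] s(1) s(3)[of x] by simp
  define H :: "real^'m^'m" where "H = (\<chi> i j. c $ i $ j / \<alpha>)"
  have "real_spectral_radius H < 1"
    using \<open>stability_conditions \<alpha> \<zeta> c\<close> unfolding stability_conditions_def H_def Let_def by blast
  moreover have "0 < H $ i $ j" for i j using assms(1,3) by (simp add: H_def)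
  ultimately obtain \<kappa> :: "real^'m" and r where \<kappa>: "\<And>i. 0 < \<kappa> $ i" "0 < r" "r < 1" "\<kappa> v* H = r *\<^sub>R \<kappa>"
    using stable_positive_matrix_left_eigenvector[of H] by blast
  have eig: "(\<Sum>i\<in>UNIV. \<kappa> $ i * c $ i $ j) = \<alpha> * r * \<kappa> $ j" for j
  proof -
    have "(\<Sum>i\<in>UNIV. \<kappa> $ i * (c $ i $ j / \<alpha>)) = r * \<kappa> $ j"
      using arg_cong[OF \<kappa>(4), of "\<lambda>x. x $ j"] by (simp add: vector_matrix_mult_def H_def)
    then have "\<alpha> * (\<Sum>i\<in>UNIV. \<kappa> $ i * (c $ i $ j / \<alpha>)) = \<alpha> * (r * \<kappa> $ j)" by simp
    then show ?thesis using assms(1) by (simp add: sum_distrib_left mult.assoc)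
  qed
  interpret hawkes_stationary \<alpha> \<zeta> c b \<sigma> a Pr F N W X lam \<pi> \<kappa> r "\<bar>b 0\<bar> + k" s
  proof (rule hawkes_stationary.intro)
    fix z :: "real \<times> (real^'m)" assume z: "z \<in> space state_space"
    show "hawkes_small_time \<alpha> \<zeta> c b \<sigma> a (Pr z) F N W X lam z \<kappa> r (\<bar>b 0\<bar> + k) s"
    proof (intro hawkes_small_time.intro hawkes_start.intro hawkes_small_time_axioms.intro)
      show "hawkes_jump_diffusion \<alpha> \<zeta> c b \<sigma> a (Pr z) F N W X lam" "AE \<omega> in Pr z. (X 0 \<omega>, lam 0 \<omega>) = z"
        using \<open>hawkes_family \<alpha> \<zeta> c b \<sigma> a Pr F N W X lam\<close> z unfolding hawkes_family_def by blast+
    qed (use assms(1,2) \<kappa> eig b_lin \<sigma>_b C2_continuous[OF b] C2_continuous[OF \<sigma>] k(1) s(1) in auto)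
  qed (use assms in auto)
  show ?thesis by (rule locally_bounded_density[OF C2_continuous[OF \<sigma>] s(2) assms(9,10)])
qed

end
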